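(* Let $N\ge3$, let $n\in\mathbb{N}$ with $n>N/2$, and let $\Omega\subset\mathbb{R}^N$ be a bounded domain with $\partial\Omega\in C^{1,\alpha}$ (for some $\alpha>0$). Then there exists a unique equilibrium measure $\rho^{\ast,n}\in P(\partial\Omega)$ for $\mathcal{K}^n$. Moreover, setting $\lambda^{\ast,n}:=\langle\rho^{\ast,n},\phi^n_{\rho^{\ast,n}}\rangle$, one has $\phi^n_{\rho^{\ast,n}}=\lambda^{\ast,n}$ on $\overline{\Omega}$, and for every $\mu\in P(\partial\Omega)$ $$\lambda^{\ast,n}=\langle\rho^{\ast,n},\phi^n_{\rho^{\ast,n}}\rangle=\langle\mu,\phi^n_{\rho^{\ast,n}}\rangle.$$
   Context: $P(\partial\Omega)$ is the set of positive Borel measures $\rho$ on $\mathbb{R}^N$ supported on $\partial\Omega$ with $\rho(\partial\Omega)=1$. Let $\alpha_1=1$ and $\alpha_h=\frac{1\cdot3\cdot5\cdots(2h-3)}{2^{h-1}(h-1)!}$ for $h\ge2$. $\mathcal{X}_{2n}$ is the completion of $C_c^\infty(\mathbb{R}^N)$ with respect to the norm $\|\nabla\cdot\|_2+\|\nabla\cdot\|_{2n}$ ($L^p(\mathbb{R}^N)$ norms). For $n>N/2$ one has $\mathcal{X}_{2n}\subset C_b(\mathbb{R}^N)$ (bounded continuous functions) and $P(\partial\Omega)\subset\mathcal{X}_{2n}^\ast$ with $\langle\rho,\phi\rangle=\int_{\partial\Omega}\phi\,d\rho$. For $\rho\in P(\partial\Omega)$ the functional $$\mathcal{I}^n_\rho(\phi)=\sum_{h=1}^n\frac{\alpha_h}{2h}\|\nabla\phi\|_{2h}^{2h}-\langle\rho,\phi\rangle,\qquad\phi\in\mathcal{X}_{2n},$$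 has a unique minimizer, denoted $\phi^n_\rho$. Set $\mathcal{K}^n(\phi):=\sum_{h=1}^n\frac{2h-1}{2h}\alpha_h\|\nabla\phi\|_{2h}^{2h}$; one has $\mathcal{K}^n(\phi^n_\rho)=-\mathcal{I}^n_\rho(\phi^n_\rho)$. A measure $\rho^{\ast,n}\in P(\partial\Omega)$ is an equilibrium measure for $\mathcal{K}^n$ if $\mathcal{K}^n(\phi^n_{\rho^{\ast,n}})=\min_{\rho\in P(\partial\Omega)}\mathcal{K}^n(\phi^n_\rho)$. *)

theory Defs
  imports "HOL-Analysis.Analysis"
begin

section \<open>Test functions\<close>

definition gradient :: "('a::euclidean_space \<Rightarrow> real) \<Rightarrow> 'a \<Rightarrow> 'a" where
  "gradient f x = (THE D. GDERIV f x :> D)"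

text \<open>All partial derivatives up to order \<open>k\<close> exist and are continuous.  Demanding Frechet
  differentiability rather than mere partial derivatives costs nothing: the two agree for
  functions whose partial derivatives are continuous.\<close>

primrec times_cont_diff :: "nat \<Rightarrow> ('a::euclidean_space \<Rightarrow> real) \<Rightarrow> bool" where
  "times_cont_diff 0 f \<longleftrightarrow> continuous_on UNIV f"
| "times_cont_diff (Suc k) f \<longleftrightarrow>
     (\<forall>x. f differentiable (at x)) \<and>
     (\<forall>b\<in>Basis. times_cont_diff k (\<lambda>x. frechet_derivative f (at x) b))"

definition test_functions :: "('a::euclidean_space \<Rightarrow> real) set" where
  "test_functions = {f. (\<forall>k. times_cont_diff k f) \<and> compact (closure (support_on UNIV f))}"

section \<open>The space and its gradient\<close>

text \<open>The Bochner integral is \<open>0\<close> for non-integrable functions, so this is the \<open>L\<^sup>p\<close> norm only on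
  \<open>L\<^sup>p\<close>.  Below it is applied to gradients of elements of the space, which lie in
  \<open>L\<^sup>2 \<inter> L\<^sup>2\<^sup>n\<close>, with exponents between \<open>2\<close> and \<open>2 n\<close>.\<close>

definition Lp_norm :: "nat \<Rightarrow> ('a::euclidean_space \<Rightarrow> 'a) \<Rightarrow> real" where
  "Lp_norm p G = root p (LINT x|lborel. norm (G x) ^ p)"

definition X_norm :: "nat \<Rightarrow> ('a::euclidean_space \<Rightarrow> real) \<Rightarrow> real" where
  "X_norm n u = Lp_norm 2 (gradient u) + Lp_norm (2 * n) (gradient u)"

text \<open>\<open>X_space n\<close> is the completion of the test functions for \<open>X_norm n\<close>, each element (a class of
  Cauchy sequences) being identified with its image under the embedding into the bounded
  continuous functions.  That embedding extends the inclusion of the test functions by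
  continuity, so a Cauchy sequence is sent to its uniform limit.\<close>

definition X_space :: "nat \<Rightarrow> ('a::euclidean_space \<Rightarrow> real) set" where
  "X_space n = {\<phi>. \<exists>u. (\<forall>k. u k \<in> test_functions) \<and>
     (\<forall>e>0. \<exists>M. \<forall>j\<ge>M. \<forall>k\<ge>M. X_norm n (\<lambda>x. u j x - u k x) < e) \<and>
     uniform_limit UNIV u \<phi> sequentially}"

definition has_weak_gradient ::
    "('a::euclidean_space \<Rightarrow> real) \<Rightarrow> ('a \<Rightarrow> 'a) \<Rightarrow> bool" where
  "has_weak_gradient \<phi> G \<longleftrightarrow>
     G \<in> borel_measurable lborel \<and>
     (\<forall>C. compact C \<longrightarrow> set_integrable lborel C G) \<and>
     (\<forall>\<psi>\<in>test_functions.
        (LINT x|lborel. \<phi> x *\<^sub>R gradient \<psi> x) = - (LINT x|lborel. \<psi> x *\<^sub>R G x))"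

text \<open>Determined only up to null sets; it occurs below only inside integrals.\<close>

definition weak_gradient :: "('a::euclidean_space \<Rightarrow> real) \<Rightarrow> 'a \<Rightarrow> 'a" where
  "weak_gradient \<phi> = (SOME G. has_weak_gradient \<phi> G)"

section \<open>Measures on the boundary and the functionals\<close>

definition boundary_prob :: "'a::euclidean_space set \<Rightarrow> 'a measure set" where
  "boundary_prob \<Omega> = {\<rho>. sets \<rho> = sets borel \<and>
     emeasure \<rho> (frontier \<Omega>) = 1 \<and> emeasure \<rho> (- frontier \<Omega>) = 0}"

text \<open>For \<open>\<rho> \<in> boundary_prob \<Omega>\<close> this is the integral over \<open>frontier \<Omega>\<close>, as \<open>\<rho>\<close> vanishes off it.\<close>

definition pairing :: "'a::euclidean_space measure \<Rightarrow> ('a \<Rightarrow> real) \<Rightarrow> real" where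
  "pairing \<rho> \<phi> = (LINT x|\<rho>. \<phi> x)"

text \<open>The product is \<open>1 \<cdot> 3 \<cdot> 5 \<cdots> (2 h - 3)\<close>, which is empty for \<open>h = 1\<close>.\<close>

definition alpha :: "nat \<Rightarrow> real" where
  "alpha h = (\<Prod>i=1..h - 1. 2 * real i - 1) / (2 ^ (h - 1) * fact (h - 1))"

definition I_functional ::
    "nat \<Rightarrow> 'a::euclidean_space measure \<Rightarrow> ('a \<Rightarrow> real) \<Rightarrow> real" where
  "I_functional n \<rho> \<phi> =
     (\<Sum>h=1..n. alpha h / (2 * real h) * Lp_norm (2 * h) (weak_gradient \<phi>) ^ (2 * h))
     - pairing \<rho> \<phi>"

definition K_functional :: "nat \<Rightarrow> ('a::euclidean_space \<Rightarrow> real) \<Rightarrow> real" where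
  "K_functional n \<phi> =
     (\<Sum>h=1..n. (2 * real h - 1) / (2 * real h) * alpha h *
        Lp_norm (2 * h) (weak_gradient \<phi>) ^ (2 * h))"

definition potential :: "nat \<Rightarrow> 'a::euclidean_space measure \<Rightarrow> 'a \<Rightarrow> real" where
  "potential n \<rho> = (THE \<phi>. is_arg_min (I_functional n \<rho>) (\<lambda>\<psi>. \<psi> \<in> X_space n) \<phi>)"

definition equilibrium_measure ::
    "nat \<Rightarrow> 'a::euclidean_space set \<Rightarrow> 'a measure \<Rightarrow> bool" where
  "equilibrium_measure n \<Omega> \<rho> \<longleftrightarrow>
     is_arg_min (\<lambda>\<mu>. K_functional n (potential n \<mu>)) (\<lambda>\<mu>. \<mu> \<in> boundary_prob \<Omega>) \<rho>"

section \<open>Boundary regularity\<close>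

definition C1_holder :: "real \<Rightarrow> ('a::euclidean_space \<Rightarrow> real) \<Rightarrow> bool" where
  "C1_holder a g \<longleftrightarrow> (\<forall>x. g differentiable (at x)) \<and>
     (\<exists>L. \<forall>x y. norm (gradient g x - gradient g y) \<le> L * norm (x - y) powr a)"

text \<open>Near each boundary point, \<open>\<Omega>\<close> is the strict epigraph, in some unit direction \<open>e\<close>, of a
  \<open>C\<^sup>1\<^sup>,\<^sup>a\<close> function on the hyperplane orthogonal to \<open>e\<close>.  The function \<open>g\<close> is defined on the whole
  space but only evaluated at the projection \<open>x - (x \<bullet> e) e\<close> onto that hyperplane.\<close>

definition C1_holder_boundary :: "real \<Rightarrow> 'a::euclidean_space set \<Rightarrow> bool" where
  "C1_holder_boundary a \<Omega> \<longleftrightarrow>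
     (\<forall>p\<in>frontier \<Omega>. \<exists>r>0. \<exists>e g. norm e = 1 \<and> C1_holder a g \<and>
        \<Omega> \<inter> ball p r = {x \<in> ball p r. x \<bullet> e > g (x - (x \<bullet> e) *\<^sub>R e)})"

end

theory Submission
  imports Defs "HOL-Probability.Probability"
begin

text \<open>Write \<open>E(\<phi>)\<close> for the sum of gradient norms in \<open>I\<^sub>\<rho>\<close>.  Since \<open>E\<close> is the integral of a convex even
  polynomial \<open>\<Phi>\<close> of \<open>\<bar>\<nabla>\<phi>\<bar>\<close>, Clarkson's inequality
  \<open>E((\<phi> + \<psi>)/2) + E((\<phi> - \<psi>)/2) \<le> (E(\<phi>) + E(\<psi>))/2\<close> makes minimising sequences of \<open>I\<^sub>\<rho>\<close> Cauchy and
  minimisers unique.  Testing \<open>I\<^sub>\<rho>\<close> along \<open>t \<mapsto> t \<phi>\<close> gives \<open>K(\<phi>\<^sub>\<rho>) = max\<^sub>\<phi> (\<langle>\<rho>, \<phi>\<rangle> - E(\<phi>))\<close>, a weakly lower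
  semicontinuous convex function of \<open>\<rho>\<close>, so it attains its minimum on the weakly compact set
  \<open>P(\<partial>\<Omega>)\<close>.  If \<open>\<rho>\<close> and \<open>\<mu>\<close> are both minimal, the potential of \<open>(\<rho> + \<mu>)/2\<close> is also the potential
  of \<open>\<rho>\<close> and of \<open>\<mu>\<close>, and differentiability of \<open>E\<close> recovers a measure from its potential.

  For a minimal \<open>\<rho>\<close> with potential \<open>\<phi>\<close> and \<open>\<lambda> = \<langle>\<rho>, \<phi>\<rangle>\<close>, varying \<open>\<rho>\<close> towards point masses gives
  \<open>\<phi> \<ge> \<lambda>\<close> on \<open>\<partial>\<Omega>\<close>, hence \<open>\<phi> = \<lambda>\<close> \<open>\<rho>\<close>-almost everywhere.  Truncating \<open>\<phi>\<close> smoothly above \<open>\<lambda>\<close>, and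
  inside \<open>\<Omega>\<close> below \<open>\<lambda> - \<epsilon>\<close>, leaves \<open>\<langle>\<rho>, \<phi>\<rangle>\<close> unchanged and
  does not increase \<open>E\<close>; by uniqueness of the minimiser
  both truncations fix \<open>\<phi>\<close>, so \<open>\<phi> = \<lambda>\<close> on the closure of \<open>\<Omega>\<close>.\<close>

section \<open>Calculus of test functions\<close>

text \<open>Elements of \<open>X_space\<close> are known only as uniform limits of test functions,
  and \<open>weak_gradient\<close> is an arbitrary choice, so facts about the energy are stated for
  gradient fields and reach the space through convergence of gradients. Convergence is measured by
  the integral of \<Phi> itself: E mixes several powers and is no power of one norm, but \<Phi> is
  convex with growth between degrees 2 and 2 n, so its integral obeys a triangle inequality up to a
  constant and has the same null sequences of test functions as the norm. A bound on that integral
  must in turn produce a function, hence the sup bound: the L^(2n) part controls the gradient near a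
  point because 2 n > N, the L^2 part far away because N > 2. The sup bound also keeps the linear
  term below the energy and turns small energy into uniform closeness of potentials; with that
  closeness, varying towards point masses needs no derivative of K. Since the approximants are
  smooth, truncations have to be smooth, and the inner one needs a level strictly below the boundary
  value, so that the change vanishes near the boundary.\<close>

lemma has_derivative_frechet_derivative:
  "f differentiable (at x) \<Longrightarrow> (f has_derivative frechet_derivative f (at x)) (at x)"
  by (simp add: frechet_derivative_works)

lemma times_cont_diff_continuous: "times_cont_diff k f \<Longrightarrow> continuous_on UNIV f"
  by (cases k) (auto simp: continuous_on_eq_continuous_at differentiable_imp_continuous_within)

lemma times_cont_diff_Suc_imp: "times_cont_diff (Suc k) f \<Longrightarrow> times_cont_diff k f"
proof (induction k arbitrary: f)
  case 0
  then show ?case using times_cont_diff_continuous by fastforce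
next
  case (Suc k)
  have "times_cont_diff k (\<lambda>x. frechet_derivative f (at x) b)" if "b \<in> Basis" for b
    using Suc.prems that by (intro Suc.IH) (simp only: times_cont_diff.simps, blast)
  then show ?case using Suc.prems by simp
qed

lemma times_cont_diff_const: "times_cont_diff k (\<lambda>x::'a::euclidean_space. c)"
proof (induction k arbitrary: c)
  case (Suc k)
  then show ?case by simp
qed simp

lemma times_cont_diff_add:
  "times_cont_diff k f \<Longrightarrow> times_cont_diff k g \<Longrightarrow> times_cont_diff k (\<lambda>x. f x + g x)"
proof (induction k arbitrary: f g)
  case (Suc k)
  have d: "f differentiable (at x)" "g differentiable (at x)" for x
    using Suc.prems by auto
  have "frechet_derivative (\<lambda>x. f x + g x) (at x) =
      (\<lambda>h. frechet_derivative f (at x) h + frechet_derivative g (at x) h)" for x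
    using d[of x] by (intro frechet_derivative_at[symmetric] has_derivative_add)
      (auto simp: has_derivative_frechet_derivative)
  then show ?case using Suc d by simp
qed (auto intro: continuous_intros)

lemma times_cont_diff_mult:
  "times_cont_diff k f \<Longrightarrow> times_cont_diff k g \<Longrightarrow> times_cont_diff k (\<lambda>x. f x * g x)"
proof (induction k arbitrary: f g)
  case (Suc k)
  have d: "f differentiable (at x)" "g differentiable (at x)" for x
    using Suc.prems by auto
  have "frechet_derivative (\<lambda>x. f x * g x) (at x) =
      (\<lambda>h. f x * frechet_derivative g (at x) h + frechet_derivative f (at x) h * g x)" for x
    using d[of x] by (intro frechet_derivative_at[symmetric] has_derivative_mult)
      (auto simp: has_derivative_frechet_derivative)
  moreover have "times_cont_diff k f" "times_cont_diff k g"
    using Suc.prems by (auto intro: times_cont_diff_Suc_imp)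
  ultimately show ?case using Suc d by (auto intro!: times_cont_diff_add Suc.IH)
qed (auto intro: continuous_intros)

lemma times_cont_diff_inner: "times_cont_diff k (\<lambda>x::'a::euclidean_space. x \<bullet> b)"
proof (cases k)
  case (Suc m)
  have "frechet_derivative (\<lambda>x::'a. x \<bullet> b) (at x) = (\<lambda>h. h \<bullet> b)" for x
    by (intro frechet_derivative_at[symmetric] derivative_eq_intros) (auto)
  moreover have "(\<lambda>x::'a. x \<bullet> b) differentiable (at x)" for x
    by (intro linear_imp_differentiable bounded_linear.linear bounded_linear_inner_left)
  ultimately show ?thesis using Suc by (simp add: times_cont_diff_const)
qed (auto intro: continuous_intros)

text \<open>Indexing all derivatives of the outer function by \<open>j\<close> lets the induction on
  \<open>k\<close> run with \<open>j\<close> arbitrary: the chain rule replaces \<open>D j\<close>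
  by \<open>D (Suc j)\<close> times a partial derivative of \<open>u\<close>, both one order
  lower.\<close>

lemma times_cont_diff_compose:
  fixes D :: "nat \<Rightarrow> real \<Rightarrow> real"
  assumes D: "\<And>j t. (D j has_real_derivative D (Suc j) t) (at t)"
  shows "times_cont_diff k u \<Longrightarrow> times_cont_diff k (\<lambda>x. D j (u x))"
proof (induction k arbitrary: u j)
  case 0
  have "continuous_on UNIV (D j)"
    using D by (meson DERIV_continuous_on has_field_derivative_at_within)
  then show ?case using 0 by (auto intro: continuous_on_compose2)
next
  case (Suc k)
  have d: "u differentiable (at x)" for x
    using Suc.prems by auto
  have h: "((\<lambda>x. D j (u x)) has_derivative
      (\<lambda>h. frechet_derivative u (at x) h * D (Suc j) (u x))) (at x)" for x
    using D[of j "u x"] d[of x]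
    by (intro has_derivative_compose[of u, OF _ D[unfolded has_field_derivative_def],
        THEN has_derivative_eq_rhs]) (auto simp: has_derivative_frechet_derivative)
  have "frechet_derivative (\<lambda>x. D j (u x)) (at x) =
      (\<lambda>h. frechet_derivative u (at x) h * D (Suc j) (u x))" for x
    using h by (intro frechet_derivative_at[symmetric])
  moreover have "times_cont_diff k u"
    using Suc.prems by (auto intro: times_cont_diff_Suc_imp)
  moreover have "(\<lambda>x. D j (u x)) differentiable (at x)" for x
    using h differentiable_def by blast
  ultimately show ?case using Suc
    by (auto intro!: times_cont_diff_mult)
qed

text \<open>The open sets \<open>O'\<close> and \<open>- K\<close> cover the space. The description
  of \<open>v\<close> on each of them passes to its partial derivatives, so the induction closes.
  This is what makes a truncation carried out only inside \<Omega> smooth across the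
  boundary.\<close>

lemma times_cont_diff_glue:
  assumes "open O'" "closed K" "K \<subseteq> O'"
  shows "times_cont_diff k g \<Longrightarrow> (\<And>x. x \<in> O' \<Longrightarrow> v x = g x) \<Longrightarrow> (\<And>x. x \<notin> K \<Longrightarrow> v x = 0)
    \<Longrightarrow> times_cont_diff k v"
proof (induction k arbitrary: g v)
  case 0
  have "isCont v x" for x
  proof (cases "x \<in> O'")
    case True
    have "isCont g x" using 0 by (auto simp: continuous_on_eq_continuous_at)
    then show ?thesis
      using 0(2) True assms(1) by (subst isCont_cong[of v g]) (auto simp: eventually_nhds)
  next
    case False
    then have "x \<in> -K" "open (-K)" using assms by auto
    then show ?thesis
      using 0(3) by (subst isCont_cong[of v "\<lambda>_. 0"]) (auto simp: eventually_nhds intro!: exI[of _ "-K"])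
  qed
  then show ?case by (auto simp: continuous_on_eq_continuous_at)
next
  case (Suc k)
  have 1: "(v has_derivative frechet_derivative g (at x)) (at x)" if "x \<in> O'" for x
  proof (rule has_derivative_transform_within_open)
    show "(g has_derivative frechet_derivative g (at x)) (at x)"
      using Suc.prems(1) by (intro has_derivative_frechet_derivative) simp
  qed (use that assms(1) Suc.prems in auto)
  have 2: "(v has_derivative (\<lambda>h. 0)) (at x)" if "x \<notin> K" for x
  proof (rule has_derivative_transform_within_open)
    show "((\<lambda>y. 0) has_derivative (\<lambda>h. 0)) (at x)" by simp
    show "open (-K)" using assms(2) by auto
  qed (use that Suc.prems in auto)
  have "v differentiable (at x)" for x
    using 1[of x] 2[of x] assms(3) unfolding differentiable_def by blast
  moreover have "times_cont_diff k (\<lambda>x. frechet_derivative v (at x) b)" if b: "b \<in> Basis" for b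
  proof (rule Suc.IH)
    show "times_cont_diff k (\<lambda>x. frechet_derivative g (at x) b)" using Suc.prems b by simp
    show "frechet_derivative v (at x) b = frechet_derivative g (at x) b" if "x \<in> O'" for x
      using frechet_derivative_at[OF 1[OF that]] by simp
    show "frechet_derivative v (at x) b = 0" if "x \<notin> K" for x
      using frechet_derivative_at[OF 2[OF that]] by (metis)
  qed
  ultimately show ?case by simp
qed

section \<open>Gradients and closure properties of test functions\<close>

lemma GDERIV_unique: "GDERIV f x :> D \<Longrightarrow> gradient f x = D"
  unfolding gradient_def
proof (rule the_equality)
  fix D' assume "GDERIV f x :> D" "GDERIV f x :> D'"
  then have "(\<lambda>h. h \<bullet> D) = (\<lambda>h. h \<bullet> D')"
    unfolding gderiv_def by (rule has_derivative_unique)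
  then show "D' = D" by (metis euclidean_eqI inner_commute)
qed

lemma GDERIV_gradient:
  assumes "f differentiable (at x)"
  shows "GDERIV f x :> gradient f x"
    and "gradient f x = (\<Sum>b\<in>Basis. frechet_derivative f (at x) b *\<^sub>R b)"
proof -
  let ?D = "(\<Sum>b\<in>Basis. frechet_derivative f (at x) b *\<^sub>R b)"
  have w: "(f has_derivative frechet_derivative f (at x)) (at x)"
    using assms by (simp add: has_derivative_frechet_derivative)
  then interpret bounded_linear "frechet_derivative f (at x)" by (rule has_derivative_bounded_linear)
  have "frechet_derivative f (at x) h = h \<bullet> ?D" for h
  proof -
    have "frechet_derivative f (at x) h = frechet_derivative f (at x) (\<Sum>b\<in>Basis. (h \<bullet> b) *\<^sub>R b)"
      by (simp add: euclidean_representation)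
    also have "\<dots> = h \<bullet> ?D"
      by (simp add: sum scaleR inner_sum_right mult.commute)
    finally show ?thesis .
  qed
  then have "frechet_derivative f (at x) = (\<lambda>h. h \<bullet> ?D)" by (rule ext)
  then have "GDERIV f x :> ?D" using w unfolding gderiv_def by (simp only:)
  then show "gradient f x = ?D" "GDERIV f x :> gradient f x" using GDERIV_unique by metis+
qed

lemma test_functionsI:
  assumes "\<And>k. times_cont_diff k f" and "\<And>x. norm x > R \<Longrightarrow> f x = 0"
  shows "f \<in> test_functions"
proof -
  have "support_on UNIV f \<subseteq> cball 0 R"
    using assms(2) by (auto simp: support_on_def) (meson not_less)
  then have "bounded (support_on UNIV f)" using bounded_cball bounded_subset by blast
  then show ?thesis unfolding test_functions_def using assms(1) by (simp add: compact_closure)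
qed

lemma test_functions_support:
  assumes "f \<in> test_functions"
  obtains R where "R > 0" "\<And>x. norm x > R \<Longrightarrow> f x = 0"
proof -
  have "bounded (support_on UNIV f)"
    using assms bounded_subset[OF compact_imp_bounded closure_subset]
    by (auto simp: test_functions_def)
  then obtain R where "R > 0" "\<forall>x\<in>support_on UNIV f. norm x \<le> R"
    unfolding bounded_pos by blast
  then show ?thesis using that[of R] by (force simp: support_on_def)
qed

lemma test_functions_smooth: "f \<in> test_functions \<Longrightarrow> times_cont_diff k f"
  by (simp add: test_functions_def)

lemma test_functions_differentiable: "f \<in> test_functions \<Longrightarrow> f differentiable (at x)"
  using test_functions_smooth[of f "Suc 0"] by simp

lemma test_functions_continuous: "f \<in> test_functions \<Longrightarrow> continuous_on UNIV f"
  using test_functions_smooth[of f 0] by simp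

lemma test_functions_GDERIV: "f \<in> test_functions \<Longrightarrow> GDERIV f x :> gradient f x"
  by (intro GDERIV_gradient test_functions_differentiable)

lemma continuous_on_gradient: "f \<in> test_functions \<Longrightarrow> continuous_on UNIV (gradient f)"
proof -
  assume f: "f \<in> test_functions"
  have "gradient f = (\<lambda>x. \<Sum>b\<in>Basis. frechet_derivative f (at x) b *\<^sub>R b)"
    using GDERIV_gradient(2)[OF test_functions_differentiable[OF f]] by (rule ext)
  then show ?thesis using test_functions_smooth[OF f, of "Suc 0"]
    by (auto intro!: continuous_intros)
qed

lemma gradient_support:
  assumes "\<And>x. norm x > R \<Longrightarrow> f x = 0" "norm x > R"
  shows "gradient f x = 0"
proof (rule GDERIV_unique)
  have "open {x::'a. norm x > R}" by (intro open_Collect_less continuous_intros)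
  moreover have "x \<in> {x. norm x > R}" "\<And>y. y \<in> {x. norm x > R} \<Longrightarrow> 0 = f y"
    using assms by auto
  moreover have "((\<lambda>y. 0) has_derivative (\<lambda>h. h \<bullet> 0)) (at x)" by simp
  ultimately show "GDERIV f x :> 0" unfolding gderiv_def
    by (rule has_derivative_transform_within_open[rotated])
qed

lemma test_functions_zero: "(\<lambda>x. 0) \<in> test_functions"
  by (rule test_functionsI[of _ 0]) (auto simp: times_cont_diff_const)

lemma test_functions_add:
  assumes "f \<in> test_functions" "g \<in> test_functions"
  shows "(\<lambda>x. f x + g x) \<in> test_functions"
proof -
  obtain R R' where "\<And>x. norm x > R \<Longrightarrow> f x = 0" "\<And>x. norm x > R' \<Longrightarrow> g x = 0"
    using assms test_functions_support by metis
  then show ?thesis using assms test_functions_smooth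
    by (intro test_functionsI[of _ "max R R'"] times_cont_diff_add) auto
qed

lemma test_functions_cmult:
  assumes "f \<in> test_functions"
  shows "(\<lambda>x. c * f x) \<in> test_functions"
proof -
  obtain R where "\<And>x. norm x > R \<Longrightarrow> f x = 0"
    using assms test_functions_support by metis
  then show ?thesis using assms test_functions_smooth
    by (intro test_functionsI[of _ "R"] times_cont_diff_mult times_cont_diff_const) auto
qed

lemma test_functions_diff:
  "f \<in> test_functions \<Longrightarrow> g \<in> test_functions \<Longrightarrow> (\<lambda>x. f x - g x) \<in> test_functions"
  using test_functions_add[OF _ test_functions_cmult, of f g "-1"] by simp

lemma gradient_add:
  assumes "f \<in> test_functions" "g \<in> test_functions"
  shows "gradient (\<lambda>x. f x + g x) x = gradient f x + gradient g x"
  by (intro GDERIV_unique GDERIV_add test_functions_GDERIV assms)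

lemma gradient_diff:
  assumes "f \<in> test_functions" "g \<in> test_functions"
  shows "gradient (\<lambda>x. f x - g x) x = gradient f x - gradient g x"
  by (intro GDERIV_unique GDERIV_diff test_functions_GDERIV assms)

lemma gradient_cmult:
  assumes "f \<in> test_functions"
  shows "gradient (\<lambda>x. c * f x) x = c *\<^sub>R gradient f x"
  using GDERIV_mult[OF GDERIV_const test_functions_GDERIV[OF assms], of c x]
  by (intro GDERIV_unique) simp

lemma gradient_zero: "gradient (\<lambda>x. 0) x = 0"
  by (intro GDERIV_unique GDERIV_const)

lemma integrable_compact_support:
  fixes f :: "'a::euclidean_space \<Rightarrow> 'b::euclidean_space"
  assumes "continuous_on UNIV f" "\<And>x. norm x > R \<Longrightarrow> f x = 0"
  shows "integrable lborel f"
proof -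
  have "integrable lborel (\<lambda>x. indicator (cball 0 R) x *\<^sub>R f x)"
    by (intro borel_integrable_compact continuous_on_subset[OF assms(1)]) auto
  moreover have "(\<lambda>x. indicator (cball 0 R) x *\<^sub>R f x) = f"
    using assms(2) by (auto simp: fun_eq_iff indicator_def not_le)
  ultimately show ?thesis by simp
qed

lemma bounded_compact_support:
  fixes f :: "'a::euclidean_space \<Rightarrow> 'b::euclidean_space"
  assumes "continuous_on UNIV f" "\<And>x. norm x > R \<Longrightarrow> f x = 0"
  obtains B where "B > 0" "\<And>x. norm (f x) \<le> B"
proof -
  have "compact (f ` cball 0 R)"
    by (intro compact_continuous_image continuous_on_subset[OF assms(1)]) auto
  then obtain B where "B > 0" "\<forall>y\<in>f ` cball 0 R. norm y \<le> B"
    using compact_imp_bounded bounded_pos by metis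
  then show ?thesis using that[of B] assms(2)
    by (metis image_eqI linorder_not_less mem_cball_0 norm_zero order_less_imp_le)
qed

section \<open>Bump functions and their separation properties\<close>

text \<open>A class closed under differentiation that contains the classical smooth function
  exp(-1/t), \<open>flat 1\<close>, with all derivatives 0 at the origin. The polynomial in 1/t
  absorbs the factors that differentiation produces.\<close>

definition flat :: "real poly \<Rightarrow> real \<Rightarrow> real" where
  "flat p t = (if t > 0 then poly p (inverse t) * exp (- inverse t) else 0)"

text \<open>With x = 1/t, the derivative of p(x) exp(-x) in t is x^2 (p(x) - p'(x)) exp(-x).\<close>

definition flat_step :: "real poly \<Rightarrow> real poly" where
  "flat_step p = monom 1 2 * (p - pderiv p)"

lemma tendsto_flat_0: "(flat p \<longlongrightarrow> 0) (at 0)"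
proof -
  have "((\<lambda>x. \<Sum>i\<le>degree p. coeff p i * (x ^ i / exp x)) \<longlongrightarrow> (\<Sum>i\<le>degree p. coeff p i * 0)) at_top"
    by (intro tendsto_intros tendsto_power_div_exp_0)
  then have "((\<lambda>x. poly p x * exp (- x)) \<longlongrightarrow> 0) at_top"
    by (simp add: poly_altdef sum_distrib_right exp_minus divide_inverse mult.assoc)
  then have "((\<lambda>t. poly p (inverse t) * exp (- inverse t)) \<longlongrightarrow> 0) (at_right 0)"
    using filterlim_compose filterlim_inverse_at_top_right by blast
  then have r: "(flat p \<longlongrightarrow> 0) (at_right 0)"
    by (rule Lim_transform_eventually) (auto simp: flat_def eventually_at_filter)
  have "((\<lambda>_. 0) \<longlongrightarrow> (0::real)) (at_left 0)" by simp
  then have "(flat p \<longlongrightarrow> 0) (at_left 0)"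
    by (rule Lim_transform_eventually) (auto simp: flat_def eventually_at_filter)
  with r show ?thesis by (simp add: filterlim_at_split)
qed

lemma DERIV_flat: "(flat p has_real_derivative flat (flat_step p) t) (at t)"
proof -
  consider "t > 0" | "t < 0" | "t = 0" by linarith
  then show ?thesis
  proof cases
    case 1
    have "((\<lambda>t. poly p (inverse t) * exp (- inverse t)) has_real_derivative
        flat (flat_step p) t) (at t)"
      using 1 by (auto intro!: derivative_eq_intros simp: flat_def flat_step_def poly_monom
          field_simps power2_eq_square)
    then show ?thesis
      by (rule has_field_derivative_transform_within_open[of _ _ _ "{0<..}"])
        (use 1 in \<open>auto simp: flat_def\<close>)
  next
    case 2
    have "((\<lambda>t. 0) has_real_derivative flat (flat_step p) t) (at t)"
      using 2 by (simp add: flat_def)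
    then show ?thesis
      by (rule has_field_derivative_transform_within_open[of _ _ _ "{..<0}"])
        (use 2 in \<open>auto simp: flat_def\<close>)
  next
    case 3
    \<comment> \<open>Dividing by h multiplies the polynomial by 1/h, so for nonzero h the
      difference quotient at 0 is \<open>flat (pCons 0 p) h\<close>, again in the class.\<close>
    have "((\<lambda>h. (flat p (0 + h) - flat p 0) / h) \<longlongrightarrow> 0) (at 0)"
      using tendsto_flat_0[of "pCons 0 p"]
      by (rule Lim_transform_eventually)
        (auto simp: flat_def eventually_at_filter divide_inverse)
    then show ?thesis using 3 by (simp add: DERIV_def flat_def)
  qed
qed

lemma continuous_on_flat: "continuous_on A (flat p)"
  using DERIV_flat by (meson DERIV_continuous_on has_field_derivative_at_within)

lemma times_cont_diff_flat:
  assumes "times_cont_diff k u"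
  shows "times_cont_diff k (\<lambda>x. flat p (u x))"
  using times_cont_diff_compose[where D = "\<lambda>j. flat ((flat_step ^^ j) p)" and j = 0, OF _ assms]
  by (simp add: DERIV_flat)

text \<open>As k grows each factor increases to 1 on positive arguments, since exp(-1/(k s)) tends
  to 1, and stays 0 elsewhere. The bumps thus increase to the indicator of the open box, as monotone
  convergence requires.\<close>

definition box_bump :: "'a::euclidean_space \<Rightarrow> 'a \<Rightarrow> nat \<Rightarrow> 'a \<Rightarrow> real" where
  "box_bump a c k x =
     (\<Prod>b\<in>Basis. flat 1 (real k * (x \<bullet> b - a \<bullet> b)) * flat 1 (real k * (c \<bullet> b - x \<bullet> b)))"

lemma flat_1: "0 \<le> flat 1 t" "flat 1 t \<le> 1" "t \<le> 0 \<Longrightarrow> flat 1 t = 0"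
  by (auto simp: flat_def)

lemma flat_1_mono: "s \<le> t \<Longrightarrow> flat 1 s \<le> flat 1 t"
  by (auto simp: flat_def intro: le_imp_inverse_le)

lemma flat_1_scale_mono: "k \<le> l \<Longrightarrow> flat 1 (real k * t) \<le> flat 1 (real l * t)"
  by (cases "t \<ge> 0")
    (auto intro!: flat_1_mono mult_right_mono simp: flat_1 mult_nonneg_nonpos not_le)

lemma flat_1_scale_lim: "t > 0 \<Longrightarrow> (\<lambda>k. flat 1 (real k * t)) \<longlonglongrightarrow> 1"
proof -
  assume t: "t > 0"
  have "(\<lambda>k. exp (- inverse (real k * t))) \<longlonglongrightarrow> exp (- 0)"
    unfolding inverse_mult_distrib
    by (intro tendsto_intros tendsto_mult_left_zero lim_inverse_n)
  then show ?thesis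
    by (rule Lim_transform_eventually[OF tendsto_eq_rhs])
      (auto simp: flat_def t intro!: exI[of _ 1] eventually_sequentiallyI[of 1])
qed

lemma box_bump_nonneg: "0 \<le> box_bump a c k x"
  unfolding box_bump_def by (intro prod_nonneg) (auto intro: flat_1 mult_nonneg_nonneg)

lemma box_bump_mono: "k \<le> l \<Longrightarrow> box_bump a c k x \<le> box_bump a c l x"
  unfolding box_bump_def
  by (intro prod_mono) (auto intro!: mult_nonneg_nonneg mult_mono flat_1_scale_mono simp: flat_1)

lemma box_bump_outside: "x \<notin> box a c \<Longrightarrow> box_bump a c k x = 0"
proof -
  assume "x \<notin> box a c"
  then obtain b where "b \<in> Basis" "x \<bullet> b - a \<bullet> b \<le> 0 \<or> c \<bullet> b - x \<bullet> b \<le> 0"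
    by (auto simp: mem_box not_less)
  then show ?thesis unfolding box_bump_def
    by (intro prod_zero) (auto intro!: bexI[of _ b] simp: flat_1 mult_nonneg_nonpos)
qed

lemma box_bump_tendsto: "(\<lambda>k. box_bump a c k x) \<longlonglongrightarrow> indicator (box a c) x"
proof (cases "x \<in> box a c")
  case True
  have "(\<lambda>k. box_bump a c k x) \<longlonglongrightarrow> (\<Prod>b\<in>(Basis::'a set). 1 * 1)"
    unfolding box_bump_def using True
    by (intro tendsto_prod tendsto_mult flat_1_scale_lim) (auto simp: mem_box)
  then show ?thesis using True by simp
qed (simp add: box_bump_outside)

lemma times_cont_diff_prod:
  "finite A \<Longrightarrow> (\<And>i. i \<in> A \<Longrightarrow> times_cont_diff k (f i)) \<Longrightarrow> times_cont_diff k (\<lambda>x. \<Prod>i\<in>A. f i x)"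
  by (induction A rule: finite_induct) (auto simp: times_cont_diff_const intro!: times_cont_diff_mult)

lemma box_bump_test: "box_bump a c k \<in> test_functions"
proof -
  obtain R where R: "\<forall>x\<in>box a c. norm x \<le> R"
    using bounded_box[of a c] bounded_iff by blast
  have aff: "times_cont_diff m (\<lambda>x. s * (x \<bullet> b) + t)" for m s t and b :: 'a
    by (intro times_cont_diff_add times_cont_diff_mult times_cont_diff_const times_cont_diff_inner)
  show ?thesis
  proof (rule test_functionsI)
    show "box_bump a c k x = 0" if "norm x > R" for x
      using R that by (intro box_bump_outside) force
    have "times_cont_diff m (\<lambda>x. flat 1 (real k * (x \<bullet> b - a \<bullet> b)))" 
       "times_cont_diff m (\<lambda>x. flat 1 (real k * (c \<bullet> b - x \<bullet> b)))" for m b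
      using aff[of m "real k" b "- real k * (a \<bullet> b)"] aff[of m "- real k" b "real k * (c \<bullet> b)"]
      by (auto intro!: times_cont_diff_flat simp: algebra_simps)
    then show "times_cont_diff m (box_bump a c k)" for m
      unfolding box_bump_def by (intro times_cont_diff_prod times_cont_diff_mult) auto
  qed
qed

text \<open>Open boxes form an intersection-stable generator of the Borel sets, and the measure of a
  box is the supremum of the integrals of its bumps.\<close>

lemma measure_eqI_test_functions:
  fixes M N :: "'a::euclidean_space measure"
  assumes sets: "sets M = sets borel" "sets N = sets borel"
    and eq: "\<And>\<psi>. \<psi> \<in> test_functions \<Longrightarrow> (\<And>x. 0 \<le> \<psi> x) \<Longrightarrow>
      (\<integral>\<^sup>+x. ennreal (\<psi> x) \<partial>M) = (\<integral>\<^sup>+x. ennreal (\<psi> x) \<partial>N)"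
    and fin: "\<And>a c. emeasure M (box a c) \<noteq> \<infinity>"
  shows "M = N"
proof (rule measure_eqI_generator_eq)
  let ?E = "range (\<lambda>(a, b). box a b::'a set)"
  show "Int_stable ?E" by (auto simp: Int_stable_def box_Int_box)
  show "?E \<subseteq> Pow UNIV" by simp
  show "sets M = sigma_sets UNIV ?E" "sets N = sigma_sets UNIV ?E"
    using sets by (simp_all add: borel_eq_box)
  show "range (\<lambda>n::nat. box (- (real n *\<^sub>R One)) (real n *\<^sub>R One) :: 'a set) \<subseteq> ?E" by auto
  show "(\<Union>n. box (- (real n *\<^sub>R One)) (real n *\<^sub>R One) :: 'a set) = UNIV"
    by (rule UN_box_eq_UNIV)
  show "emeasure M (box (- (real n *\<^sub>R One)) (real n *\<^sub>R One)) \<noteq> \<infinity>" for n :: nat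
    by (rule fin)
  have *: "emeasure L (box a c) = (SUP k. \<integral>\<^sup>+x. ennreal (box_bump a c k x) \<partial>L)"
    if L: "sets L = sets borel" for L :: "'a measure" and a c
  proof -
    have [measurable]: "box_bump a c k \<in> borel_measurable L" for k
      using L test_functions_continuous[OF box_bump_test] borel_measurable_continuous_onI
        measurable_cong_sets by blast
    have inc: "incseq (\<lambda>k x. ennreal (box_bump a c k x))"
      by (auto simp: incseq_def le_fun_def intro: ennreal_leI box_bump_mono)
    have "(SUP k. ennreal (box_bump a c k x)) = indicator (box a c) x" for x
    proof (rule LIMSEQ_unique)
      show "(\<lambda>k. ennreal (box_bump a c k x)) \<longlonglongrightarrow> (SUP k. ennreal (box_bump a c k x))"
        using inc by (intro LIMSEQ_SUP) (auto simp: incseq_def le_fun_def)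
      show "(\<lambda>k. ennreal (box_bump a c k x)) \<longlonglongrightarrow> indicator (box a c) x"
        using tendsto_ennrealI[OF box_bump_tendsto[of a c x]] by (simp add: ennreal_indicator)
    qed
    then have "emeasure L (box a c) = (\<integral>\<^sup>+x. (SUP k. ennreal (box_bump a c k x)) \<partial>L)"
      using L by simp
    also have "\<dots> = (SUP k. \<integral>\<^sup>+x. ennreal (box_bump a c k x) \<partial>L)"
      by (intro nn_integral_monotone_convergence_SUP inc) measurable
    finally show ?thesis .
  qed
  fix X assume "X \<in> ?E"
  then show "emeasure M X = emeasure N X"
    by (auto simp: * sets eq[OF box_bump_test box_bump_nonneg])
qed

lemma finite_measure_eqI_test_functions:
  fixes M N :: "'a::euclidean_space measure"
  assumes sets: "sets M = sets borel" "sets N = sets borel"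
    and fin: "finite_measure M" "finite_measure N"
    and eq: "\<And>\<psi>. \<psi> \<in> test_functions \<Longrightarrow> (LINT x|M. \<psi> x) = (LINT x|N. \<psi> x)"
  shows "M = N"
proof (rule measure_eqI_test_functions[OF sets])
  show "emeasure M (box a c) \<noteq> \<infinity>" for a c
    using finite_measure.emeasure_finite[OF fin(1)] by simp
  fix \<psi> :: "'a \<Rightarrow> real" assume \<psi>: "\<psi> \<in> test_functions" "\<And>x. 0 \<le> \<psi> x"
  obtain R where "\<And>x. norm x > R \<Longrightarrow> \<psi> x = 0" using \<psi>(1) test_functions_support by blast
  then obtain B where B: "\<And>x. norm (\<psi> x) \<le> B"
    using bounded_compact_support[OF test_functions_continuous[OF \<psi>(1)]] by metis
  have "integrable L \<psi>" if "finite_measure L" "sets L = sets borel" for L :: "'a measure"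
    using that B test_functions_continuous[OF \<psi>(1)]
    by (intro finite_measure.integrable_const_bound[of _ _ B])
      (auto intro: borel_measurable_continuous_onI simp: measurable_cong_sets[OF that(2) refl])
  then show "(\<integral>\<^sup>+x. ennreal (\<psi> x) \<partial>M) = (\<integral>\<^sup>+x. ennreal (\<psi> x) \<partial>N)"
    using fin sets \<psi> eq by (simp add: nn_integral_eq_integral)
qed

text \<open>The fundamental lemma of the calculus of variations without mollifiers: the positive and
  negative parts of a component of \<open>G\<close> are densities of two measures with equal
  integrals of nonnegative test functions. The measures agree, so the two parts agree almost
  everywhere, and since one of them is 0 at each point both vanish.\<close>

lemma AE_zero_test_functions:
  fixes G :: "'a::euclidean_space \<Rightarrow> 'a"
  assumes [measurable]: "G \<in> borel_measurable lborel"
    and int: "\<And>C. compact C \<Longrightarrow> set_integrable lborel C G"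
    and zero: "\<And>\<psi>. \<psi> \<in> test_functions \<Longrightarrow> (LINT x|lborel. \<psi> x *\<^sub>R G x) = 0"
  shows "AE x in lborel. G x = 0"
proof -
  have "AE x in lborel. G x \<bullet> b = 0" if "b \<in> Basis" for b
  proof -
    have [measurable]: "(\<lambda>x. G x \<bullet> b) \<in> borel_measurable borel" using assms(1) by measurable
    have loc: "integrable lborel (\<lambda>x. \<psi> x *\<^sub>R G x)" if \<psi>: "\<psi> \<in> borel_measurable borel"
      "\<And>x. norm x > R \<Longrightarrow> \<psi> x = 0" "\<And>x. norm (\<psi> x) \<le> B" for \<psi> :: "'a \<Rightarrow> real" and R B
    proof (rule Bochner_Integration.integrable_bound)
      show "integrable lborel (\<lambda>x. B *\<^sub>R (indicator (cball 0 R) x *\<^sub>R G x))"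
        using int[of "cball 0 R"] unfolding set_integrable_def by (intro integrable_scaleR_right) auto
      show "AE x in lborel. norm (\<psi> x *\<^sub>R G x) \<le> norm (B *\<^sub>R (indicator (cball 0 R) x *\<^sub>R G x))"
      proof (rule AE_I2)
        fix x
        have "norm (\<psi> x) \<le> \<bar>B\<bar>" using order.trans[OF \<psi>(3) abs_ge_self] .
        then show "norm (\<psi> x *\<^sub>R G x) \<le> norm (B *\<^sub>R (indicator (cball 0 R) x *\<^sub>R G x))"
          using \<psi>(2)[of x] by (cases "norm x \<le> R") (simp_all add: mult_right_mono)
      qed
    qed (use \<psi>(1) in measurable)
    \<comment> \<open>\<open>ennreal\<close> sends negative numbers to 0, so the densities are the
      positive and the negative part.\<close>
    let ?M = "density lborel (\<lambda>x. ennreal (G x \<bullet> b))"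
    let ?N = "density lborel (\<lambda>x. ennreal (- (G x \<bullet> b)))"
    have "?M = ?N"
    proof (rule measure_eqI_test_functions)
      show "emeasure ?M (box a c) \<noteq> \<infinity>" for a c
      proof -
        obtain R where R: "\<forall>x\<in>box a c. norm x \<le> R"
          using bounded_box[of a c] bounded_iff by blast
        have "integrable lborel (\<lambda>x. indicator (box a c) x *\<^sub>R G x)"
          using R by (intro loc[of _ R 1]) (auto simp: indicator_def)
        then have "integrable lborel (\<lambda>x. (indicator (box a c) x *\<^sub>R G x) \<bullet> b)"
          by (rule integrable_inner_left)
        then have "integrable lborel (\<lambda>x. indicator (box a c) x * (G x \<bullet> b))" by simp
        then have "(\<integral>\<^sup>+x. ennreal (norm (indicator (box a c) x * (G x \<bullet> b))) \<partial>lborel) < \<infinity>"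
          unfolding integrable_iff_bounded by (rule conjunct2)
        moreover have "emeasure ?M (box a c) \<le>
            (\<integral>\<^sup>+x. ennreal (norm (indicator (box a c) x * (G x \<bullet> b))) \<partial>lborel)"
          by (subst emeasure_density)
            (auto intro!: nn_integral_mono ennreal_leI simp: indicator_def)
        ultimately show ?thesis by (auto simp: less_top[symmetric] top_unique)
      qed
      fix \<psi> :: "'a \<Rightarrow> real" assume \<psi>: "\<psi> \<in> test_functions" "\<And>x. 0 \<le> \<psi> x"
      obtain R where R: "\<And>x. norm x > R \<Longrightarrow> \<psi> x = 0" using \<psi>(1) test_functions_support by blast
      then obtain B where B: "\<And>x. norm (\<psi> x) \<le> B"
        using bounded_compact_support[OF test_functions_continuous[OF \<psi>(1)]] by metis
      have [measurable]: "\<psi> \<in> borel_measurable borel"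
        using test_functions_continuous[OF \<psi>(1)] by (rule borel_measurable_continuous_onI)
      have i0: "integrable lborel (\<lambda>x. \<psi> x *\<^sub>R G x)" using R B by (intro loc[of _ R B]) auto
      have i: "integrable lborel (\<lambda>x. \<psi> x * (G x \<bullet> b))"
        using integrable_inner_left[OF i0, of b] by simp
      have "(LINT x|lborel. (\<psi> x *\<^sub>R G x) \<bullet> b) = 0"
        using integral_inner_left[of b, OF i0] zero[OF \<psi>(1)] by simp
      then have z: "(LINT x|lborel. \<psi> x * (G x \<bullet> b)) = 0" by simp
      let ?p = "\<lambda>x. max 0 (\<psi> x * (G x \<bullet> b))" and ?n = "\<lambda>x. max 0 (- (\<psi> x * (G x \<bullet> b)))"
      have ip: "integrable lborel ?p" "integrable lborel ?n" using i by auto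
      have "(LINT x|lborel. ?p x) - (LINT x|lborel. ?n x) = (LINT x|lborel. \<psi> x * (G x \<bullet> b))"
        by (subst Bochner_Integration.integral_diff[symmetric, OF ip])
          (auto intro!: Bochner_Integration.integral_cong)
      then have e: "(LINT x|lborel. ?p x) = (LINT x|lborel. ?n x)" using z by simp
      have mult: "ennreal t * ennreal (\<psi> x) = ennreal (max 0 (\<psi> x * t))" for t x
        using \<psi>(2)[of x] by (cases "t \<ge> 0")
          (auto simp: ennreal_mult'[symmetric] mult.commute max_def ennreal_neg mult_le_0_iff
            intro: antisym)
      have p: "(\<integral>\<^sup>+x. ennreal (\<psi> x) \<partial>?M) = (\<integral>\<^sup>+x. ennreal (?p x) \<partial>lborel)"
        by (subst nn_integral_density) (simp_all add: mult)
      have n: "(\<integral>\<^sup>+x. ennreal (\<psi> x) \<partial>?N) = (\<integral>\<^sup>+x. ennreal (?n x) \<partial>lborel)"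
        by (subst nn_integral_density) (simp_all add: mult)
      show "(\<integral>\<^sup>+x. ennreal (\<psi> x) \<partial>?M) = (\<integral>\<^sup>+x. ennreal (\<psi> x) \<partial>?N)"
        unfolding p n using nn_integral_eq_integral[OF ip(1)] nn_integral_eq_integral[OF ip(2)] e
        by simp
    qed auto
    then have "AE x in lborel. ennreal (G x \<bullet> b) = ennreal (- (G x \<bullet> b))"
      by (intro sigma_finite_measure.density_unique) (auto intro: lborel.sigma_finite_measure_axioms)
    then show ?thesis
    proof (rule AE_mp, intro AE_I2 impI)
      fix x assume "ennreal (G x \<bullet> b) = ennreal (- (G x \<bullet> b))"
      then show "G x \<bullet> b = 0"
        by (cases "G x \<bullet> b \<ge> 0") (auto simp: ennreal_neg not_le dest: sym)
    qed
  qed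
  then have "AE x in lborel. \<forall>b\<in>Basis. G x \<bullet> b = 0"
    by (intro AE_finite_allI) auto
  then show ?thesis by (rule AE_mp) (auto intro!: AE_I2 simp: euclidean_all_zero_iff)
qed

section \<open>The sup bound\<close>

lemma nn_integral_lborel_dilate:
  fixes f :: "'a::euclidean_space \<Rightarrow> ennreal"
  assumes [measurable]: "f \<in> borel_measurable borel" and "c > 0"
  shows "(\<integral>\<^sup>+x. f (t + c *\<^sub>R x) \<partial>lborel) = ennreal (inverse (c ^ DIM('a))) * (\<integral>\<^sup>+x. f x \<partial>lborel)"
proof -
  have "(\<integral>\<^sup>+x. f x \<partial>lborel) =
      (\<integral>\<^sup>+x. f x \<partial>density (distr lborel borel (\<lambda>x. t + c *\<^sub>R x)) (\<lambda>_. ennreal (\<bar>c\<bar> ^ DIM('a))))"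
    using lborel_affine[of c t] \<open>c > 0\<close> by simp
  also have "\<dots> = ennreal (c ^ DIM('a)) * (\<integral>\<^sup>+x. f (t + c *\<^sub>R x) \<partial>lborel)"
    using \<open>c > 0\<close> by (simp add: nn_integral_density nn_integral_distr nn_integral_cmult)
  finally have "ennreal (inverse (c ^ DIM('a))) * (\<integral>\<^sup>+x. f x \<partial>lborel) =
      (ennreal (inverse (c ^ DIM('a))) * ennreal (c ^ DIM('a))) * (\<integral>\<^sup>+x. f (t + c *\<^sub>R x) \<partial>lborel)"
    by (simp add: mult.assoc)
  then show ?thesis using \<open>c > 0\<close> by (simp flip: ennreal_mult)
qed

text \<open>Below the level \<open>l\<close> the first term suffices; above it s/l is at most
  (s/l)^p. The free level takes the place of Hoelder's inequality on a ball and is later tuned to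
  the radius.\<close>

lemma Young_level:
  fixes s l :: real
  assumes "0 \<le> s" "0 < l" "1 \<le> p"
  shows "s \<le> l + l powr (1 - real p) * s ^ p"
proof (cases "s \<le> l")
  case True
  then show ?thesis using assms by (simp add: add_increasing2)
next
  case False
  have "l powr (1 - real p) * s ^ p = l * (s / l) ^ p"
    using assms by (simp add: powr_diff powr_realpow power_divide field_simps)
  also have "\<dots> \<ge> l * (s / l) ^ 1"
    using False assms by (intro mult_left_mono power_increasing) auto
  finally show ?thesis using assms by simp
qed

text \<open>Fundamental theorem of calculus along the ray from \<open>x\<close> in direction
  \<open>y\<close>, which leaves the support. The condition \<open>norm y \<le> 1\<close> absorbs
  the factor that Cauchy-Schwarz leaves behind.\<close>

lemma test_function_ray_bound:
  assumes u: "u \<in> test_functions" and y: "norm y \<le> 1" "y \<noteq> 0"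
  shows "ennreal \<bar>u x\<bar> \<le> (\<integral>\<^sup>+r. ennreal (norm (gradient u (x + r *\<^sub>R y))) * indicator {0<..} r \<partial>lborel)"
proof -
  obtain R where R: "R > 0" "\<And>z. norm z > R \<Longrightarrow> u z = 0" using test_functions_support[OF u] by blast
  \<comment> \<open>Chosen so that T y has norm R + |x| + 1, which puts x + T y outside the ball
    containing the support.\<close>
  define T where "T = (R + norm x + 1) / norm y"
  have "T > 0" using y R(1) by (simp add: T_def add_pos_nonneg)
  have "norm (T *\<^sub>R y) = R + norm x + 1" using y R(1) by (simp add: T_def abs_of_pos add_nonneg_nonneg)
  then have "norm (x + T *\<^sub>R y) > R" using norm_diff_ineq[of "T *\<^sub>R y" x] by (simp add: add.commute)
  then have uT: "u (x + T *\<^sub>R y) = 0" using R by simp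
  have c: "continuous_on A (\<lambda>r. gradient u (x + r *\<^sub>R y))" for A
    by (intro continuous_on_compose2[OF continuous_on_gradient[OF u]] continuous_intros) auto
  have "((\<lambda>r. u (x + r *\<^sub>R y)) has_vector_derivative gradient u (x + r *\<^sub>R y) \<bullet> y) (at r within {0..T})" for r
  proof -
    have 1: "((\<lambda>r. x + r *\<^sub>R y) has_derivative (\<lambda>h. h *\<^sub>R y)) (at r within {0..T})"
      by (auto intro!: derivative_eq_intros)
    have 2: "(u has_derivative (\<lambda>h. h \<bullet> gradient u (x + r *\<^sub>R y))) (at (x + r *\<^sub>R y))"
      using test_functions_GDERIV[OF u] unfolding gderiv_def .
    show ?thesis using has_derivative_compose[OF 1 2]
      by (simp add: has_vector_derivative_def inner_commute)
  qed
  then have "integral\<^sup>L lborel (\<lambda>r. indicator {0..T} r *\<^sub>R (gradient u (x + r *\<^sub>R y) \<bullet> y)) = - u x"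
    using \<open>T > 0\<close> c uT by (subst integral_FTC_atLeastAtMost[where F = "\<lambda>r. u (x + r *\<^sub>R y)"])
      (auto intro!: continuous_intros)
  then have "\<bar>u x\<bar> = norm (integral\<^sup>L lborel (\<lambda>r. indicator {0..T} r *\<^sub>R (gradient u (x + r *\<^sub>R y) \<bullet> y)))"
    by simp
  also have "ennreal \<dots> \<le> (\<integral>\<^sup>+r. norm (indicator {0..T} r *\<^sub>R (gradient u (x + r *\<^sub>R y) \<bullet> y)) \<partial>lborel)"
    by (intro integral_norm_bound_ennreal borel_integrable_compact continuous_intros c) auto
  also have "\<dots> \<le> (\<integral>\<^sup>+r. ennreal (norm (gradient u (x + r *\<^sub>R y))) * indicator {0<..} r \<partial>lborel)"
  proof (rule nn_integral_mono_AE)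
    have "AE r in lborel. r \<noteq> (0::real)" by (rule AE_lborel_singleton)
    then show "AE r in lborel. ennreal (norm (indicator {0..T} r *\<^sub>R (gradient u (x + r *\<^sub>R y) \<bullet> y)))
        \<le> ennreal (norm (gradient u (x + r *\<^sub>R y))) * indicator {0<..} r"
    proof (rule AE_mp, intro AE_I2 impI)
      fix r :: real assume "r \<noteq> 0"
      have "\<bar>gradient u (x + r *\<^sub>R y) \<bullet> y\<bar> \<le> norm (gradient u (x + r *\<^sub>R y)) * norm y"
        by (rule Cauchy_Schwarz_ineq2)
      also have "\<dots> \<le> norm (gradient u (x + r *\<^sub>R y))" using y by (simp add: mult_left_le)
      finally show "ennreal (norm (indicator {0..T} r *\<^sub>R (gradient u (x + r *\<^sub>R y) \<bullet> y)))
        \<le> ennreal (norm (gradient u (x + r *\<^sub>R y))) * indicator {0<..} r"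
        using \<open>r \<noteq> 0\<close> by (auto simp: indicator_def intro: ennreal_leI)
    qed
  qed
  finally show ?thesis .
qed

text \<open>Used with a = N/q and b = N/2: the L^q bound serves radii up to 1, the L^2 bound larger
  ones. Integrability at 0 and at infinity is exactly q > N and N > 2.\<close>

definition sobolev_weight :: "real \<Rightarrow> real \<Rightarrow> real \<Rightarrow> real" where
  "sobolev_weight a b r = (if r \<le> 1 then r powr (- a) else r powr (- b))"

lemma sobolev_weight_integral:
  assumes "a < 1" "b > 1"
  shows "(\<integral>\<^sup>+r. ennreal (sobolev_weight a b r) * indicator {0<..} r \<partial>lborel) < \<infinity>"
proof -
  have 1: "((\<lambda>x. x powr (- a)) has_integral (1 powr (- a + 1) / (- a + 1))) {0..1}"
    using assms by (intro has_integral_powr_from_0) auto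
  have 2: "((\<lambda>x. x powr (- b)) has_integral - (1 powr (- b + 1)) / (- b + 1)) {1..}"
    using assms by (intro has_integral_powr_to_inf) auto
  have m[measurable]: "(\<lambda>x::real. x powr c) \<in> borel_measurable borel" for c by measurable
  have "(\<integral>\<^sup>+r. ennreal (sobolev_weight a b r) * indicator {0<..} r \<partial>lborel) \<le>
    (\<integral>\<^sup>+r. ennreal (r powr (- a)) * indicator {0..1} r + ennreal (r powr (- b)) * indicator {1..} r \<partial>lborel)"
    by (intro nn_integral_mono) (auto simp: sobolev_weight_def indicator_def)
  also have "\<dots> = ennreal (1 powr (- a + 1) / (- a + 1)) + ennreal (- (1 powr (- b + 1)) / (- b + 1))"
    using nn_integral_has_integral_lebesgue'[OF _ 1] nn_integral_has_integral_lebesgue'[OF _ 2]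
    by (subst nn_integral_add) (auto simp: mult.commute)
  also have "\<dots> < \<infinity>" by (simp flip: ennreal_plus)
  finally show ?thesis .
qed

text \<open>Undoing the dilation costs r^(-N). The level l = r^(-N/p) in \<open>Young_level\<close>
  satisfies l^(1-p) r^(-N) = l, so both terms scale alike.\<close>

lemma test_function_dilated_ball_bound:
  fixes x :: "'a::euclidean_space"
  assumes u: "u \<in> test_functions" and r: "r > 0" and p: "1 \<le> p"
    and A: "(\<integral>\<^sup>+y. ennreal (norm (gradient u y) ^ p) \<partial>lborel) \<le> ennreal A"
  shows "(\<integral>\<^sup>+y. ennreal (norm (gradient u (x + r *\<^sub>R y))) * indicator (ball 0 1) y \<partial>lborel)
    \<le> ennreal (r powr (- (real DIM('a) / real p))) * (emeasure lborel (ball 0 1 :: 'a set) + ennreal A)"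
proof -
  define l where "l = r powr (- (real DIM('a) / real p))"
  have l: "l > 0" using r by (simp add: l_def)
  have [measurable]: "gradient u \<in> borel_measurable borel"
    using continuous_on_gradient[OF u] by (rule borel_measurable_continuous_onI)
  have pw: "l powr (1 - real p) * inverse (r ^ DIM('a)) = l"
  proof -
    have "inverse (r ^ DIM('a)) = r powr (- real DIM('a))"
      using r by (simp add: powr_minus powr_realpow)
    moreover have "- (real DIM('a) / real p) * (1 - real p) + - real DIM('a) = - (real DIM('a) / real p)"
      using p by (simp add: field_simps)
    ultimately show ?thesis by (simp only: l_def powr_powr powr_add[symmetric])
  qed
  have "(\<integral>\<^sup>+y. ennreal (norm (gradient u (x + r *\<^sub>R y))) * indicator (ball 0 1) y \<partial>lborel) \<le>
     (\<integral>\<^sup>+y. ennreal l * indicator (ball 0 1) y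
        + ennreal (l powr (1 - real p)) * ennreal (norm (gradient u (x + r *\<^sub>R y)) ^ p) \<partial>lborel)"
  proof (rule nn_integral_mono)
    fix y :: 'a
    have "ennreal (norm (gradient u (x + r *\<^sub>R y))) \<le>
        ennreal (l + l powr (1 - real p) * norm (gradient u (x + r *\<^sub>R y)) ^ p)"
      using l p by (intro ennreal_leI Young_level) auto
    also have "\<dots> = ennreal l + ennreal (l powr (1 - real p)) * ennreal (norm (gradient u (x + r *\<^sub>R y)) ^ p)"
      using l by (simp add: ennreal_mult)
    finally show "ennreal (norm (gradient u (x + r *\<^sub>R y))) * indicator (ball 0 1) y \<le>
      ennreal l * indicator (ball 0 1) y
        + ennreal (l powr (1 - real p)) * ennreal (norm (gradient u (x + r *\<^sub>R y)) ^ p)"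
      by (auto simp: indicator_def)
  qed
  also have "\<dots> = ennreal l * emeasure lborel (ball 0 1 :: 'a set)
      + ennreal (l powr (1 - real p)) * (ennreal (inverse (r ^ DIM('a))) *
          (\<integral>\<^sup>+y. ennreal (norm (gradient u y) ^ p) \<partial>lborel))"
  proof -
    have "(\<integral>\<^sup>+y. ennreal (norm (gradient u (x + r *\<^sub>R y)) ^ p) \<partial>lborel) =
        ennreal (inverse (r ^ DIM('a))) * (\<integral>\<^sup>+y. ennreal (norm (gradient u y) ^ p) \<partial>lborel)"
      by (rule nn_integral_lborel_dilate[of "\<lambda>y. ennreal (norm (gradient u y) ^ p)", OF _ r]) measurable
    moreover have "(\<integral>\<^sup>+y. ennreal l * indicator (ball 0 1 :: 'a set) y \<partial>lborel) =
        ennreal l * emeasure lborel (ball 0 1 :: 'a set)"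
      by (rule nn_integral_cmult_indicator) simp
    moreover have "(\<lambda>y. ennreal l * indicator (ball 0 1 :: 'a set) y) \<in> borel_measurable borel"
      by (intro borel_measurable_times_ennreal borel_measurable_indicator) auto
    ultimately show ?thesis by (subst nn_integral_add) (auto simp: nn_integral_cmult)
  qed
  also have "\<dots> \<le> ennreal l * emeasure lborel (ball 0 1 :: 'a set)
      + ennreal (l powr (1 - real p)) * (ennreal (inverse (r ^ DIM('a))) * ennreal A)"
    by (intro add_left_mono mult_left_mono A) auto
  also have "ennreal (l powr (1 - real p)) * (ennreal (inverse (r ^ DIM('a))) * ennreal A) =
      ennreal (l powr (1 - real p) * inverse (r ^ DIM('a))) * ennreal A"
    using r by (subst ennreal_mult) (auto simp: mult.assoc)
  finally show ?thesis unfolding pw l_def[symmetric] by (simp add: distrib_left)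
qed

text \<open>Averaging over \<open>y\<close> in the unit ball the representation of \<open>u x\<close> as an integral of the gradient
  along the ray from \<open>x\<close> through \<open>y\<close> avoids polar coordinates.\<close>

lemma test_function_sup_bound:
  assumes "2 < DIM('a::euclidean_space)" "DIM('a) < q"
  obtains C where "C > 0" "\<And>(u :: 'a \<Rightarrow> real) x. u \<in> test_functions \<Longrightarrow>
    (\<integral>\<^sup>+y. ennreal ((norm (gradient u y))\<^sup>2) \<partial>lborel) \<le> ennreal A \<Longrightarrow>
    (\<integral>\<^sup>+y. ennreal (norm (gradient u y) ^ q) \<partial>lborel) \<le> ennreal A \<Longrightarrow> \<bar>u x\<bar> \<le> C"
proof -
  let ?B = "ball 0 1 :: 'a set"
  define w where "w = sobolev_weight (real DIM('a) / real q) (real DIM('a) / 2)"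
  define W where "W = (\<integral>\<^sup>+r. ennreal (w r) * indicator {0<..} r \<partial>lborel)"
  define V where "V = emeasure lborel ?B"
  have Wfin: "W < \<infinity>" unfolding W_def w_def using assms by (intro sobolev_weight_integral) auto
  have V: "V < \<infinity>" "V \<noteq> 0"
  proof -
    have "unit_ball_vol (real DIM('a)) > 0" by simp
    then show "V \<noteq> 0" using emeasure_ball[of 1 "0::'a"] unfolding V_def
      by (metis ennreal_eq_0_iff linorder_not_le mult_1_right power_one zero_le_one)
    show "V < \<infinity>" unfolding V_def using emeasure_bounded_finite[OF bounded_ball] by simp
  qed
  have [measurable]: "?B \<in> sets borel" by simp
  have m[measurable]: "w \<in> borel_measurable borel" unfolding w_def sobolev_weight_def by measurable
  have main: "ennreal \<bar>u x\<bar> * V \<le> W * (V + ennreal A)"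
    if u: "u \<in> test_functions" and A2: "(\<integral>\<^sup>+y. ennreal ((norm (gradient u y))\<^sup>2) \<partial>lborel) \<le> ennreal A"
      and Aq: "(\<integral>\<^sup>+y. ennreal (norm (gradient u y) ^ q) \<partial>lborel) \<le> ennreal A" for u :: "'a \<Rightarrow> real" and x
  proof -
    have [measurable]: "gradient u \<in> borel_measurable borel"
      using continuous_on_gradient[OF u] by (rule borel_measurable_continuous_onI)
    have "ennreal \<bar>u x\<bar> * V = (\<integral>\<^sup>+y. ennreal \<bar>u x\<bar> * indicator ?B y \<partial>lborel)"
      unfolding V_def by (rule nn_integral_cmult_indicator[symmetric]) simp
    also have "\<dots> \<le> (\<integral>\<^sup>+y. (\<integral>\<^sup>+r. ennreal (norm (gradient u (x + r *\<^sub>R y))) * indicator {0<..} r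
        * indicator ?B y \<partial>lborel) \<partial>lborel)"
    proof (rule nn_integral_mono_AE)
      have "AE y in lborel. y \<noteq> (0::'a)" by (rule AE_lborel_singleton)
      then show "AE y in lborel. ennreal \<bar>u x\<bar> * indicator ?B y \<le>
        (\<integral>\<^sup>+r. ennreal (norm (gradient u (x + r *\<^sub>R y))) * indicator {0<..} r * indicator ?B y \<partial>lborel)"
        by (rule AE_mp, intro AE_I2 impI)
          (auto simp: indicator_def[of ?B] nn_integral_multc intro!: test_function_ray_bound[OF u])
    qed
    \<comment> \<open>After the exchange the inner integral, at a fixed radius r, runs over a
      dilated ball centred at x.\<close>
    also have "\<dots> = (\<integral>\<^sup>+r. (\<integral>\<^sup>+y. ennreal (norm (gradient u (x + r *\<^sub>R y))) * indicator {0<..} r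
        * indicator ?B y \<partial>lborel) \<partial>lborel)"
      by (rule lborel_pair.Fubini') measurable
    \<comment> \<open>For r up to 1 the exponent q gives the better power of r, beyond 1 the
      exponent 2 does; this is the case split in the weight.\<close>
    also have "\<dots> \<le> (\<integral>\<^sup>+r. ennreal (w r) * indicator {0<..} r * (V + ennreal A) \<partial>lborel)"
    proof (rule nn_integral_mono)
      fix r :: real
      show "(\<integral>\<^sup>+y. ennreal (norm (gradient u (x + r *\<^sub>R y))) * indicator {0<..} r * indicator ?B y \<partial>lborel)
        \<le> ennreal (w r) * indicator {0<..} r * (V + ennreal A)"
        using test_function_dilated_ball_bound[OF u _ _ A2, of r x]
          test_function_dilated_ball_bound[OF u _ _ Aq, of r x] assms
        by (auto simp: w_def sobolev_weight_def V_def indicator_def[of "{0<..}"])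
    qed
    also have "\<dots> = W * (V + ennreal A)" unfolding W_def by (simp add: nn_integral_multc)
    finally show ?thesis .
  qed
  \<comment> \<open>The quotient is the averaged bound; the summand 1 only makes \<open>C\<close>
    strictly positive.\<close>
  define C where "C = enn2real (W * (V + ennreal A)) / enn2real V + 1"
  have "C > 0" by (simp add: C_def add_nonneg_pos)
  have "\<bar>u x\<bar> \<le> C" if "u \<in> test_functions"
    "(\<integral>\<^sup>+y. ennreal ((norm (gradient u y))\<^sup>2) \<partial>lborel) \<le> ennreal A"
    "(\<integral>\<^sup>+y. ennreal (norm (gradient u y) ^ q) \<partial>lborel) \<le> ennreal A" for u :: "'a \<Rightarrow> real" and x
  proof -
    have fin: "W * (V + ennreal A) < \<infinity>" using Wfin V by (simp add: ennreal_mult_less_top)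
    have "enn2real (ennreal \<bar>u x\<bar> * V) \<le> enn2real (W * (V + ennreal A))"
      using main[OF that] fin by (intro enn2real_mono) auto
    then have "\<bar>u x\<bar> * enn2real V \<le> enn2real (W * (V + ennreal A))"
      by (simp add: enn2real_mult)
    moreover have "enn2real V > 0" using V by (simp add: enn2real_positive_iff zero_less_iff_neq_zero)
    ultimately show ?thesis by (simp add: C_def field_simps)
  qed
  with \<open>C > 0\<close> show thesis by (rule that)
qed

section \<open>The modular\<close>

text \<open>The integrand \<Phi> of the energy. It is the Taylor polynomial of order n, in |v|^2, of
  the Born-Infeld density 1 - sqrt(1 - |v|^2).\<close>

definition modular_density :: "nat \<Rightarrow> 'a::euclidean_space \<Rightarrow> real" where
  "modular_density n v = (\<Sum>h=1..n. alpha h / (2 * real h) * norm v ^ (2 * h))"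

lemma alpha_pos: "alpha h > 0"
proof -
  have "0 < (\<Prod>i=1..h - 1. 2 * real i - 1)"
    by (intro prod_pos) auto
  then show ?thesis by (simp add: alpha_def)
qed

lemma alpha_coeff_nonneg: "0 \<le> alpha h / (2 * real h)"
  using alpha_pos[of h] by simp

lemma modular_density_nonneg: "0 \<le> modular_density n v"
  unfolding modular_density_def by (intro sum_nonneg mult_nonneg_nonneg alpha_coeff_nonneg) auto

lemma modular_density_zero: "modular_density n 0 = 0"
  unfolding modular_density_def by (intro sum.neutral) auto

lemma modular_density_minus: "modular_density n (- v) = modular_density n v"
  unfolding modular_density_def by simp

lemma modular_density_mono: "norm v \<le> norm w \<Longrightarrow> modular_density n v \<le> modular_density n w"
  unfolding modular_density_def
  by (intro sum_mono mult_left_mono power_mono alpha_coeff_nonneg) auto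

lemma power_convex_comb:
  fixes x y :: real
  assumes "0 \<le> x" "0 \<le> y" "0 \<le> t" "t \<le> 1"
  shows "((1 - t) * x + t * y) ^ k \<le> (1 - t) * x ^ k + t * y ^ k"
proof (cases "k = 0")
  case False
  have "convex_on {0..} (\<lambda>x::real. x ^ k)"
    by (cases "even k") (auto intro: convex_power_odd convex_on_subset[OF convex_power_even])
  from convex_onD[OF this, of t x y] show ?thesis using assms by simp
qed simp

lemma modular_density_convex:
  assumes "0 \<le> t" "t \<le> 1"
  shows "modular_density n ((1 - t) *\<^sub>R v + t *\<^sub>R w)
    \<le> (1 - t) * modular_density n v + t * modular_density n w"
proof -
  have "norm ((1 - t) *\<^sub>R v + t *\<^sub>R w) \<le> (1 - t) * norm v + t * norm w"
    using assms by (intro norm_triangle_le) auto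
  then have "norm ((1 - t) *\<^sub>R v + t *\<^sub>R w) ^ (2 * h) \<le> (1 - t) * norm v ^ (2 * h) + t * norm w ^ (2 * h)"
    for h using assms by (intro order.trans[OF power_mono power_convex_comb]) auto
  then have "modular_density n ((1 - t) *\<^sub>R v + t *\<^sub>R w) \<le>
      (\<Sum>h=1..n. alpha h / (2 * real h) * ((1 - t) * norm v ^ (2 * h) + t * norm w ^ (2 * h)))"
    unfolding modular_density_def by (intro sum_mono mult_left_mono alpha_coeff_nonneg)
  also have "\<dots> = (1 - t) * modular_density n v + t * modular_density n w"
    unfolding modular_density_def sum_distrib_left sum.distrib[symmetric]
    by (intro sum.cong refl) (simp only: distrib_left mult.left_commute)
  finally show ?thesis .
qed

lemma power_superadd:
  fixes x y :: real
  assumes "0 \<le> x" "0 \<le> y" "1 \<le> h"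
  shows "x ^ h + y ^ h \<le> (x + y) ^ h"
  using \<open>1 \<le> h\<close>
proof (induction h rule: dec_induct)
  case (step h)
  have "x * x ^ h + y * y ^ h \<le> (x + y) * (x ^ h + y ^ h)"
    using assms by (simp add: algebra_simps)
  also have "\<dots> \<le> (x + y) * (x + y) ^ h"
    using step assms by (intro mult_left_mono) auto
  finally show ?case by simp
qed simp

text \<open>The parallelogram law reduces this to superadditivity and convexity of powers.\<close>

lemma modular_density_Clarkson:
  fixes v w :: "'a::euclidean_space"
  shows "modular_density n ((1/2) *\<^sub>R (v + w)) + modular_density n ((1/2) *\<^sub>R (v - w))
    \<le> (modular_density n v + modular_density n w) / 2"
proof -
  have *: "norm ((1/2) *\<^sub>R (v + w)) ^ (2 * h) + norm ((1/2) *\<^sub>R (v - w)) ^ (2 * h)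
      \<le> (norm v ^ (2 * h) + norm w ^ (2 * h)) / 2" if "h \<ge> 1" for h
  proof -
    have "norm ((1/2) *\<^sub>R (v + w)) ^ (2 * h) + norm ((1/2) *\<^sub>R (v - w)) ^ (2 * h)
      \<le> ((norm ((1/2) *\<^sub>R (v + w)))\<^sup>2 + (norm ((1/2) *\<^sub>R (v - w)))\<^sup>2) ^ h"
      unfolding power_mult using that by (intro power_superadd) auto
    also have "(norm ((1/2) *\<^sub>R (v + w)))\<^sup>2 + (norm ((1/2) *\<^sub>R (v - w)))\<^sup>2
      = (1 - 1/2) * (norm v)\<^sup>2 + 1/2 * (norm w)\<^sup>2"
      by (simp only: power2_norm_eq_inner) (simp add: inner_simps field_simps inner_commute)
    also have "((1 - 1/2) * (norm v)\<^sup>2 + 1/2 * (norm w)\<^sup>2) ^ h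
      \<le> (1 - 1/2) * ((norm v)\<^sup>2) ^ h + 1/2 * ((norm w)\<^sup>2) ^ h"
      by (intro power_convex_comb) auto
    finally show ?thesis by (simp add: power_mult)
  qed
  have "modular_density n ((1/2) *\<^sub>R (v + w)) + modular_density n ((1/2) *\<^sub>R (v - w))
    = (\<Sum>h=1..n. alpha h / (2 * real h) *
        (norm ((1/2) *\<^sub>R (v + w)) ^ (2 * h) + norm ((1/2) *\<^sub>R (v - w)) ^ (2 * h)))"
    unfolding modular_density_def by (simp only: sum.distrib[symmetric] distrib_left)
  also have "\<dots> \<le> (\<Sum>h=1..n. alpha h / (2 * real h) * ((norm v ^ (2 * h) + norm w ^ (2 * h)) / 2))"
    by (intro sum_mono mult_left_mono * alpha_coeff_nonneg) auto
  also have "\<dots> = (modular_density n v + modular_density n w) / 2"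
    unfolding modular_density_def sum.distrib[symmetric] sum_divide_distrib
    by (intro sum.cong) (auto simp: algebra_simps)
  finally show ?thesis .
qed

text \<open>All terms have degree between 2 and 2 n: shrinking by s gains at least s^2, and in
  \<open>modular_density_scale_ge\<close> stretching costs at most s^(2n). These two bounds stand in
  for the homogeneity of a norm.\<close>

lemma modular_density_scale_le:
  assumes "0 \<le> s" "s \<le> 1"
  shows "modular_density n (s *\<^sub>R v) \<le> s\<^sup>2 * modular_density n v"
proof -
  have "norm (s *\<^sub>R v) ^ (2 * h) \<le> s\<^sup>2 * norm v ^ (2 * h)" if "h \<ge> 1" for h
    using assms that by (auto simp: power_mult_distrib intro!: mult_right_mono power_decreasing)
  then show ?thesis unfolding modular_density_def sum_distrib_left
    by (intro sum_mono) (auto simp: mult.left_commute[of "s\<^sup>2"] simp del: norm_scaleR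
        intro!: mult_left_mono alpha_coeff_nonneg divide_right_mono less_imp_le[OF alpha_pos])
qed

lemma modular_density_scale_ge:
  assumes "1 \<le> s"
  shows "modular_density n (s *\<^sub>R v) \<le> s ^ (2 * n) * modular_density n v"
proof -
  have "norm (s *\<^sub>R v) ^ (2 * h) \<le> s ^ (2 * n) * norm v ^ (2 * h)" if "h \<le> n" for h
    using assms that by (auto simp: power_mult_distrib intro!: mult_right_mono power_increasing)
  then show ?thesis unfolding modular_density_def sum_distrib_left
    by (intro sum_mono) (auto simp: mult.left_commute[of "s ^ (2 * n)"] simp del: norm_scaleR
        intro!: mult_left_mono alpha_coeff_nonneg divide_right_mono less_imp_le[OF alpha_pos])
qed

text \<open>Convexity applied to the stretched vectors v/(1-t) and w/t. As t tends to 0 the constant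
  in front of \<open>v\<close> tends to 1, which a fixed constant such as the one for t = 1/2 would
  not give; continuity of the modular depends on this.\<close>

lemma modular_density_add_le:
  fixes v w :: "'a::euclidean_space"
  assumes "0 < t" "t < 1"
  shows "modular_density n (v + w)
    \<le> (1 / (1 - t)) ^ (2 * n) * modular_density n v + (1 / t) ^ (2 * n) * modular_density n w"
proof -
  have "v + w = (1 - t) *\<^sub>R ((1 / (1 - t)) *\<^sub>R v) + t *\<^sub>R ((1 / t) *\<^sub>R w)"
    using assms by simp
  also have "modular_density n \<dots> \<le> (1 - t) * modular_density n ((1 / (1 - t)) *\<^sub>R v)
      + t * modular_density n ((1 / t) *\<^sub>R w)"
    using assms by (intro modular_density_convex) auto
  also have "\<dots> \<le> 1 * modular_density n ((1 / (1 - t)) *\<^sub>R v) + 1 * modular_density n ((1 / t) *\<^sub>R w)"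
    using assms by (intro add_mono mult_right_mono modular_density_nonneg) auto
  also have "\<dots> \<le> (1 / (1 - t)) ^ (2 * n) * modular_density n v + (1 / t) ^ (2 * n) * modular_density n w"
    unfolding mult_1 using assms by (intro add_mono modular_density_scale_ge) auto
  finally show ?thesis .
qed

lemma modular_density_add_le_4:
  fixes v w :: "'a::euclidean_space"
  shows "modular_density n (v + w) \<le> 4 ^ n * (modular_density n v + modular_density n w)"
  using modular_density_add_le[of "1/2" n v w] by (simp add: power_mult distrib_left)

lemma modular_density_term_le:
  assumes "1 \<le> h" "h \<le> n"
  shows "norm v ^ (2 * h) \<le> 2 * real h / alpha h * modular_density n v"
proof -
  have "alpha h / (2 * real h) * norm v ^ (2 * h) \<le> modular_density n v"
    unfolding modular_density_def using assms
    by (intro member_le_sum mult_nonneg_nonneg alpha_coeff_nonneg) auto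
  then show ?thesis using alpha_pos[of h] assms by (simp add: field_simps)
qed

lemma modular_density_upper:
  obtains C where "C > 0" "\<And>v::'a::euclidean_space. modular_density n v \<le> C * ((norm v)\<^sup>2 + norm v ^ (2 * n))"
proof
  let ?C = "(\<Sum>h=1..n. alpha h / (2 * real h)) + 1"
  show "?C > 0" by (intro add_nonneg_pos sum_nonneg alpha_coeff_nonneg) auto
  fix v :: 'a
  have *: "norm v ^ (2 * h) \<le> (norm v)\<^sup>2 + norm v ^ (2 * n)" if "1 \<le> h" "h \<le> n" for h
  proof (cases "norm v \<le> 1")
    case True
    then have "norm v ^ (2 * h) \<le> (norm v)\<^sup>2" using that by (intro power_decreasing) auto
    then show ?thesis by (simp add: add_increasing2)
  next
    case False
    then have "norm v ^ (2 * h) \<le> norm v ^ (2 * n)" using that by (intro power_increasing) auto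
    then show ?thesis by (simp add: add_increasing)
  qed
  have "modular_density n v \<le> (\<Sum>h=1..n. alpha h / (2 * real h) * ((norm v)\<^sup>2 + norm v ^ (2 * n)))"
    unfolding modular_density_def by (intro sum_mono mult_left_mono * alpha_coeff_nonneg) auto
  also have "\<dots> \<le> ?C * ((norm v)\<^sup>2 + norm v ^ (2 * n))"
    unfolding sum_distrib_right[symmetric] by (intro mult_right_mono) auto
  finally show "modular_density n v \<le> ?C * ((norm v)\<^sup>2 + norm v ^ (2 * n))" .
qed

lemma continuous_on_modular_density: "continuous_on A (modular_density n)"
  unfolding modular_density_def[abs_def] by (intro continuous_intros)

lemma borel_measurable_modular_density [measurable]: "modular_density n \<in> borel_measurable borel"
  by (intro borel_measurable_continuous_onI continuous_on_modular_density)

section \<open>Second differences of the modular density\<close>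

lemma modular_density_second_difference_nonneg:
  "0 \<le> modular_density n (v + w) + modular_density n (v - w) - 2 * modular_density n v"
proof -
  have "(1 - 1/2) *\<^sub>R (v + w) + (1/2) *\<^sub>R (v - w) = (1/2) *\<^sub>R v + (1/2) *\<^sub>R v"
    by (simp add: algebra_simps)
  also have "\<dots> = v" by (simp add: scaleR_left_distrib[symmetric])
  finally show ?thesis using modular_density_convex[of "1/2" n "v + w" "v - w"] by simp
qed

text \<open>Convex interpolation between \<open>v\<close> and each of \<open>v + w\<close>,
  \<open>v - w\<close>. After division by t the bound no longer depends on t, so it is a majorant
  for dominated convergence.\<close>

lemma modular_density_second_difference_le:
  assumes "0 \<le> t" "t \<le> 1"
  shows "modular_density n (v + t *\<^sub>R w) + modular_density n (v - t *\<^sub>R w) - 2 * modular_density n v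
    \<le> t * (modular_density n (v + w) + modular_density n (v - w) - 2 * modular_density n v)"
  using modular_density_convex[OF assms, of n v "v + w"] modular_density_convex[OF assms, of n v "v - w"]
  by (simp add: algebra_simps)

text \<open>Along a line the density is a polynomial in t, and in f(t) + f(-t) - 2 f(0) the two
  first-order terms cancel.\<close>

lemma modular_density_second_difference_tendsto:
  fixes v w :: "'a::euclidean_space"
  shows "((\<lambda>t. (modular_density n (v + t *\<^sub>R w) + modular_density n (v - t *\<^sub>R w)
      - 2 * modular_density n v) / t) \<longlongrightarrow> 0) (at 0)"
proof -
  define f where "f t = modular_density n (v + t *\<^sub>R w)" for t :: real
  define D where "D = (\<Sum>h=1..n. alpha h / (2 * real h) * (real h * (v \<bullet> v) ^ (h - 1) * (2 * (v \<bullet> w))))"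
  have f: "f = (\<lambda>t. \<Sum>h=1..n. alpha h / (2 * real h) * (v \<bullet> v + 2 * t * (v \<bullet> w) + t * t * (w \<bullet> w)) ^ h)"
    unfolding f_def modular_density_def power_mult power2_norm_eq_inner
    by (simp add: inner_simps inner_commute algebra_simps)
  have 1: "(f has_real_derivative D) (at 0)"
    unfolding f D_def
    by (rule DERIV_sum) (auto intro!: derivative_eq_intros simp: algebra_simps)
  have "((\<lambda>t. f (- t)) has_real_derivative (- D)) (at 0)"
    using DERIV_chain'[OF DERIV_minus[OF DERIV_ident] , of f D 0] 1 by simp
  from DERIV_diff[OF DERIV_add[OF 1 this] DERIV_const[of "2 * f 0"]]
  have "((\<lambda>t. f t + f (- t) - 2 * f 0) has_real_derivative 0) (at 0)" by simp
  then show ?thesis by (simp add: DERIV_def f_def)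
qed

section \<open>The integral modular on vector fields\<close>

definition modular :: "nat \<Rightarrow> ('a::euclidean_space \<Rightarrow> 'a) \<Rightarrow> real" where
  "modular n G = (LINT x|lborel. modular_density n (G x))"

definition in_modular :: "nat \<Rightarrow> ('a::euclidean_space \<Rightarrow> 'a) \<Rightarrow> bool" where
  "in_modular n G \<longleftrightarrow> G \<in> borel_measurable borel \<and> integrable lborel (\<lambda>x. modular_density n (G x))"

lemma in_modular_measurable [measurable_dest]: "in_modular n G \<Longrightarrow> G \<in> borel_measurable borel"
  by (simp add: in_modular_def)

lemma in_modular_integrable: "in_modular n G \<Longrightarrow> integrable lborel (\<lambda>x. modular_density n (G x))"
  by (simp add: in_modular_def)

lemma modular_nonneg: "0 \<le> modular n G"
  unfolding modular_def by (intro integral_nonneg_AE AE_I2 modular_density_nonneg)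

lemma in_modular_bound:
  assumes [measurable]: "G \<in> borel_measurable borel" and "integrable lborel f"
    and "\<And>x. modular_density n (G x) \<le> f x"
  shows "in_modular n G"
  unfolding in_modular_def
proof (intro conjI assms(1) Bochner_Integration.integrable_bound[OF assms(2)] AE_I2)
  show "norm (modular_density n (G x)) \<le> norm (f x)" for x
    using assms(3)[of x] modular_density_nonneg[of n "G x"] by simp
qed measurable

lemma in_modular_add:
  assumes "in_modular n G" "in_modular n H"
  shows "in_modular n (\<lambda>x. G x + H x)"
proof (rule in_modular_bound)
  note [measurable] = in_modular_measurable[OF assms(1)] in_modular_measurable[OF assms(2)]
  show "(\<lambda>x. G x + H x) \<in> borel_measurable borel" by measurable
  show "integrable lborel (\<lambda>x. 4 ^ n * (modular_density n (G x) + modular_density n (H x)))"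
    using assms by (intro integrable_mult_right Bochner_Integration.integrable_add in_modular_integrable)
qed (rule modular_density_add_le_4)

lemma in_modular_mult:
  assumes "in_modular n G" and [measurable]: "m \<in> borel_measurable borel" and "\<And>x. \<bar>m x\<bar> \<le> c"
  shows "in_modular n (\<lambda>x. m x *\<^sub>R G x)"
proof (rule in_modular_bound)
  note [measurable] = in_modular_measurable[OF assms(1)]
  show "(\<lambda>x. m x *\<^sub>R G x) \<in> borel_measurable borel" by measurable
  show "integrable lborel (\<lambda>x. (1 + c) ^ (2 * n) * modular_density n (G x))"
    using assms by (intro integrable_mult_right in_modular_integrable)
  fix x
  have "modular_density n (m x *\<^sub>R G x) \<le> modular_density n ((1 + c) *\<^sub>R G x)"
    using assms(3)[of x] by (intro modular_density_mono) (auto intro!: mult_right_mono)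
  also have "\<dots> \<le> (1 + c) ^ (2 * n) * modular_density n (G x)"
    using assms(3)[of x] by (intro modular_density_scale_ge) auto
  finally show "modular_density n (m x *\<^sub>R G x) \<le> \<dots>" .
qed

lemma in_modular_scale: "in_modular n G \<Longrightarrow> in_modular n (\<lambda>x. c *\<^sub>R G x)"
  by (rule in_modular_mult[where c = "\<bar>c\<bar>"]) auto

lemma in_modular_diff:
  "in_modular n G \<Longrightarrow> in_modular n H \<Longrightarrow> in_modular n (\<lambda>x. G x - H x)"
  using in_modular_add[OF _ in_modular_scale, of n G H "-1"] by simp

lemma in_modular_gradient:
  assumes u: "u \<in> test_functions"
  shows "in_modular n (gradient u)"
proof -
  obtain R where R: "\<And>x. norm x > R \<Longrightarrow> u x = 0" using test_functions_support[OF u] by blast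
  have "integrable lborel (\<lambda>x. modular_density n (gradient u x))"
  proof (rule integrable_compact_support)
    show "continuous_on UNIV (\<lambda>x. modular_density n (gradient u x))"
      by (intro continuous_on_compose2[OF continuous_on_modular_density continuous_on_gradient[OF u]]) auto
    show "modular_density n (gradient u x) = 0" if "norm x > R" for x
      using gradient_support[of R u, OF R that] by (simp add: modular_density_zero)
  qed
  then show ?thesis unfolding in_modular_def
    using borel_measurable_continuous_onI[OF continuous_on_gradient[OF u]] by simp
qed

lemma modular_mono:
  assumes "in_modular n H" "G \<in> borel_measurable borel" "\<And>x. norm (G x) \<le> norm (H x)"
  shows "modular n G \<le> modular n H"
  unfolding modular_def
  by (intro integral_mono_AE' AE_I2 in_modular_integrable assms modular_density_nonneg modular_density_mono)

lemma modular_minus_commute: "modular n (\<lambda>x. G x - H x) = modular n (\<lambda>x. H x - G x)"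
  unfolding modular_def using modular_density_minus[of n "G x - H x" for x] by simp

lemma modular_add_le:
  assumes "in_modular n G" "in_modular n H" "0 < t" "t < 1"
  shows "modular n (\<lambda>x. G x + H x) \<le> (1 / (1 - t)) ^ (2 * n) * modular n G + (1 / t) ^ (2 * n) * modular n H"
proof -
  have "modular n (\<lambda>x. G x + H x) \<le> (LINT x|lborel. (1 / (1 - t)) ^ (2 * n) * modular_density n (G x)
      + (1 / t) ^ (2 * n) * modular_density n (H x))"
    unfolding modular_def using assms
    by (intro integral_mono in_modular_integrable in_modular_add Bochner_Integration.integrable_add
        integrable_mult_right modular_density_add_le) auto
  also have "\<dots> = (1 / (1 - t)) ^ (2 * n) * modular n G + (1 / t) ^ (2 * n) * modular n H"
    unfolding modular_def using assms by (subst Bochner_Integration.integral_add)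
      (auto intro!: integrable_mult_right in_modular_integrable)
  finally show ?thesis .
qed

lemma modular_add_le_4:
  assumes "in_modular n G" "in_modular n H"
  shows "modular n (\<lambda>x. G x + H x) \<le> 4 ^ n * (modular n G + modular n H)"
  using modular_add_le[OF assms, of "1/2"] by (simp add: power_mult distrib_left)

lemma modular_triangle_4:
  assumes "in_modular n F" "in_modular n G" "in_modular n H"
  shows "modular n (\<lambda>x. F x - H x) \<le> 4 ^ n * (modular n (\<lambda>x. F x - G x) + modular n (\<lambda>x. G x - H x))"
  using modular_add_le_4[OF in_modular_diff[OF assms(1,2)] in_modular_diff[OF assms(2,3)]] by simp

lemma modular_Clarkson:
  assumes "in_modular n G" "in_modular n H"
  shows "modular n (\<lambda>x. (1/2) *\<^sub>R (G x + H x)) + modular n (\<lambda>x. (1/2) *\<^sub>R (G x - H x))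
    \<le> (modular n G + modular n H) / 2"
proof -
  note i = in_modular_integrable[OF in_modular_scale[OF in_modular_add[OF assms], of "1/2"]]
    in_modular_integrable[OF in_modular_scale[OF in_modular_diff[OF assms], of "1/2"]]
    in_modular_integrable[OF assms(1)] in_modular_integrable[OF assms(2)]
  have "modular n (\<lambda>x. (1/2) *\<^sub>R (G x + H x)) + modular n (\<lambda>x. (1/2) *\<^sub>R (G x - H x))
    = (LINT x|lborel. modular_density n ((1/2) *\<^sub>R (G x + H x)) + modular_density n ((1/2) *\<^sub>R (G x - H x)))"
    unfolding modular_def using i by (subst Bochner_Integration.integral_add) auto
  also have "\<dots> \<le> (LINT x|lborel. (modular_density n (G x) + modular_density n (H x)) / 2)"
    using i by (intro integral_mono modular_density_Clarkson) auto
  also have "\<dots> = (modular n G + modular n H) / 2"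
    unfolding modular_def using i by (subst integral_divide_zero) simp
  finally show ?thesis .
qed

lemma modular_scale_le:
  assumes "in_modular n G" "0 \<le> s" "s \<le> 1"
  shows "modular n (\<lambda>x. s *\<^sub>R G x) \<le> s\<^sup>2 * modular n G"
  unfolding modular_def integral_mult_right_zero[symmetric] using assms
  by (intro integral_mono in_modular_integrable in_modular_scale integrable_mult_right
      modular_density_scale_le) auto

lemma modular_scale_ge:
  assumes "in_modular n G" "1 \<le> s"
  shows "modular n (\<lambda>x. s *\<^sub>R G x) \<le> s ^ (2 * n) * modular n G"
  unfolding modular_def integral_mult_right_zero[symmetric] using assms
  by (intro integral_mono in_modular_integrable in_modular_scale integrable_mult_right
      modular_density_scale_ge) auto

text \<open>In \<open>modular_add_le\<close> a parameter t close enough to 0 makes the stretching of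
  a modular bounded by \<open>A\<close> cost less than \<epsilon>; for that t the other coefficient
  (1/t)^(2n) serves as \<open>C\<close>.\<close>

lemma modular_uniformly_continuous:
  fixes A \<epsilon> :: real
  assumes "\<epsilon> > 0" "A \<ge> 0"
  obtains C where "C \<ge> 0" "\<And>G H :: 'a::euclidean_space \<Rightarrow> 'a. in_modular n G \<Longrightarrow> in_modular n H \<Longrightarrow>
    modular n G \<le> A \<Longrightarrow> modular n H \<le> A \<Longrightarrow>
    \<bar>modular n G - modular n H\<bar> \<le> \<epsilon> + C * modular n (\<lambda>x. G x - H x)"
proof -
  have "((\<lambda>t. (1 / (1 - t)) ^ (2 * n) * A) \<longlongrightarrow> (1 / (1 - 0)) ^ (2 * n) * A) (at_right 0)"
    by (intro tendsto_intros) auto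
  then have "\<forall>\<^sub>F t in at_right 0. (1 / (1 - t)) ^ (2 * n) * A < A + \<epsilon>"
    using assms by (intro order_tendstoD) auto
  moreover have "\<forall>\<^sub>F t in at_right 0. 0 < t \<and> t < (1::real)"
    by (auto simp: eventually_at_right_field intro: exI[of _ 1])
  ultimately obtain t where t: "0 < t" "t < 1" "(1 / (1 - t)) ^ (2 * n) * A < A + \<epsilon>"
    using eventually_happens[OF eventually_conj] by force
  have 1: "modular n G - modular n H \<le> \<epsilon> + (1 / t) ^ (2 * n) * modular n (\<lambda>x. G x - H x)"
    if "in_modular n G" "in_modular n H" "modular n H \<le> A" for G H :: "'a \<Rightarrow> 'a"
  proof -
    have "modular n G \<le> (1 / (1 - t)) ^ (2 * n) * modular n H + (1 / t) ^ (2 * n) * modular n (\<lambda>x. G x - H x)"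
      using modular_add_le[OF that(2) in_modular_diff[OF that(1,2)] t(1,2)] by simp
    moreover have "((1 / (1 - t)) ^ (2 * n) - 1) * modular n H \<le> ((1 / (1 - t)) ^ (2 * n) - 1) * A"
      using t that by (intro mult_left_mono) auto
    ultimately show ?thesis using t(3) by (simp add: algebra_simps)
  qed
  show thesis
  proof (rule that[of "(1 / t) ^ (2 * n)"])
    fix G H :: "'a \<Rightarrow> 'a"
    assume "in_modular n G" "in_modular n H" "modular n G \<le> A" "modular n H \<le> A"
    then show "\<bar>modular n G - modular n H\<bar> \<le> \<epsilon> + (1 / t) ^ (2 * n) * modular n (\<lambda>x. G x - H x)"
      using 1[of G H] 1[of H G] modular_minus_commute[of n G H] by auto
  qed (use t in auto)
qed

lemma modular_tendsto:
  assumes G: "\<And>k. in_modular n (G k)" and H: "in_modular n H"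
    and lim: "(\<lambda>k. modular n (\<lambda>x. G k x - H x)) \<longlonglongrightarrow> 0"
  shows "(\<lambda>k. modular n (G k)) \<longlonglongrightarrow> modular n H"
proof (rule LIMSEQ_I)
  fix e :: real assume "e > 0"
  \<comment> \<open>Once the modular distance to \<open>H\<close> is below 1,
    \<open>modular_add_le_4\<close> bounds the modular of \<open>G k\<close> by this number.\<close>
  define A where "A = 4 ^ n * (1 + modular n H)"
  have "1 * (1 + modular n H) \<le> A" unfolding A_def
    using modular_nonneg[of n H] by (intro mult_right_mono) auto
  then have HA: "modular n H \<le> A" "A \<ge> 0" using modular_nonneg[of n H] by auto
  obtain C where C: "C \<ge> 0" "\<And>G H :: 'a \<Rightarrow> 'a. in_modular n G \<Longrightarrow> in_modular n H \<Longrightarrow>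
    modular n G \<le> A \<Longrightarrow> modular n H \<le> A \<Longrightarrow>
    \<bar>modular n G - modular n H\<bar> \<le> e / 2 + C * modular n (\<lambda>x. G x - H x)"
    using modular_uniformly_continuous[of "e / 2" A n] \<open>e > 0\<close> HA by auto
  have "\<forall>\<^sub>F k in sequentially. modular n (\<lambda>x. G k x - H x) < min 1 (e / 2 / (C + 1))"
    using lim \<open>e > 0\<close> C(1) by (intro order_tendstoD) auto
  then have "\<forall>\<^sub>F k in sequentially. norm (modular n (G k) - modular n H) < e"
  proof (rule eventually_mono)
    fix k assume k: "modular n (\<lambda>x. G k x - H x) < min 1 (e / 2 / (C + 1))"
    have "modular n (G k) \<le> 4 ^ n * (modular n (\<lambda>x. G k x - H x) + modular n H)"
      using modular_add_le_4[OF in_modular_diff[OF G[of k] H] H] by simp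
    also have "\<dots> \<le> A" unfolding A_def using k by (intro mult_left_mono) auto
    finally have "\<bar>modular n (G k) - modular n H\<bar> \<le> e / 2 + C * modular n (\<lambda>x. G k x - H x)"
      using C(2)[OF G H _ HA(1)] by simp
    also have "\<dots> < e / 2 + e / 2"
    proof -
      have "C * modular n (\<lambda>x. G k x - H x) \<le> C * (e / 2 / (C + 1))"
        using k C(1) by (intro mult_left_mono) auto
      also have "\<dots> < e / 2" using C(1) \<open>e > 0\<close> by (simp add: field_simps)
      finally show ?thesis by simp
    qed
    finally show "norm (modular n (G k) - modular n H) < e" by simp
  qed
  then show "\<exists>K. \<forall>k\<ge>K. norm (modular n (G k) - modular n H) < e"
    by (simp add: eventually_sequentially)
qed

lemma nn_integral_modular:
  "in_modular n G \<Longrightarrow> (\<integral>\<^sup>+x. ennreal (modular_density n (G x)) \<partial>lborel) = ennreal (modular n G)"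
  unfolding modular_def
  by (intro nn_integral_eq_integral in_modular_integrable AE_I2 modular_density_nonneg)

text \<open>The Riesz-Fischer argument: a rapidly converging subsequence converges almost
  everywhere, and Fatou's lemma carries the Cauchy estimate to its limit.\<close>

lemma modular_complete:
  fixes G :: "nat \<Rightarrow> 'a::euclidean_space \<Rightarrow> 'a"
  assumes n: "n \<ge> 1" and G: "\<And>k. in_modular n (G k)"
    and Cauchy: "\<And>e. e > 0 \<Longrightarrow> \<exists>M. \<forall>j\<ge>M. \<forall>k\<ge>M. modular n (\<lambda>x. G j x - G k x) < e"
  obtains H where "in_modular n H" "(\<lambda>k. modular n (\<lambda>x. G k x - H x)) \<longlonglongrightarrow> 0"
proof -
  note [measurable] = in_modular_measurable[OF G]
  \<comment> \<open>The rate 1/8 leaves room for a weight 4^j whose weighted sum is still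
    integrable. Where that sum is a finite S, the squared increments are at most 2 S / 4^j, so the
    increments are dominated by a geometric series of ratio 1/2.\<close>
  have "\<forall>i. \<exists>M. \<forall>j\<ge>M. \<forall>k\<ge>M. modular n (\<lambda>x. G j x - G k x) < (1/8) ^ i"
    using Cauchy by simp
  then obtain M where M: "\<And>i j k. j \<ge> M i \<Longrightarrow> k \<ge> M i \<Longrightarrow> modular n (\<lambda>x. G j x - G k x) < (1/8) ^ i"
    by metis
  \<comment> \<open>Summing the thresholds makes \<open>r j\<close> exceed every \<open>M i\<close>
    with i \<le> j, whether or not \<open>M\<close> is monotone.\<close>
  define r where "r i = (\<Sum>j\<le>i. M j) + i" for i
  have rM: "r j \<ge> M i" if "i \<le> j" for i j
    using that unfolding r_def by (intro trans_le_add1 member_le_sum) auto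
  have rr: "r i \<ge> i" for i unfolding r_def by simp
  define d where "d j x = modular_density n (G (r (Suc j)) x - G (r j) x)" for j x
  have [measurable]: "d j \<in> borel_measurable borel" for j unfolding d_def by measurable
  have d0: "d j x \<ge> 0" for j x unfolding d_def by (rule modular_density_nonneg)
  have nd: "(\<integral>\<^sup>+x. ennreal (4 ^ j * d j x) \<partial>lborel) \<le> ennreal ((1/2) ^ j)" for j
  proof -
    have "(\<integral>\<^sup>+x. ennreal (4 ^ j * d j x) \<partial>lborel) = ennreal (4 ^ j) * ennreal (modular n (\<lambda>x. G (r (Suc j)) x - G (r j) x))"
      unfolding d_def using d0
      by (subst nn_integral_modular[OF in_modular_diff[OF G G], symmetric])
        (simp add: nn_integral_cmult ennreal_mult modular_density_nonneg)
    also have "\<dots> \<le> ennreal (4 ^ j) * ennreal ((1/8) ^ j)"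
      using M[of j "r (Suc j)" "r j"] rM[of j] by (intro mult_left_mono ennreal_leI) auto
    also have "\<dots> = ennreal ((1/2) ^ j)"
      by (simp add: ennreal_mult[symmetric] power_mult_distrib[symmetric])
    finally show ?thesis .
  qed
  have "(\<integral>\<^sup>+x. (\<Sum>j. ennreal (4 ^ j * d j x)) \<partial>lborel) = (\<Sum>j. \<integral>\<^sup>+x. ennreal (4 ^ j * d j x) \<partial>lborel)"
    by (rule nn_integral_suminf) measurable
  also have "\<dots> \<le> (\<Sum>j. ennreal ((1/2) ^ j))" by (intro suminf_le nd summableI)
  also have "\<dots> = ennreal (\<Sum>j. (1/2) ^ j)" by (intro suminf_ennreal2 summable_geometric) auto
  also have "\<dots> < \<infinity>" by simp
  finally have "AE x in lborel. (\<Sum>j. ennreal (4 ^ j * d j x)) \<noteq> \<infinity>"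
    by (intro nn_integral_PInf_AE) auto
  then have conv: "AE x in lborel. (\<lambda>j. G (r j) x) \<longlonglongrightarrow> lim (\<lambda>j. G (r j) x)"
  proof (rule AE_mp, intro AE_I2 impI)
    fix x assume fin: "(\<Sum>j. ennreal (4 ^ j * d j x)) \<noteq> \<infinity>"
    define S where "S = enn2real (\<Sum>j. ennreal (4 ^ j * d j x))"
    have "ennreal (4 ^ j * d j x) \<le> ennreal S" for j
      unfolding S_def using fin sum_le_suminf[of "\<lambda>j. ennreal (4 ^ j * d j x)" "{j}"]
      by (simp add: less_top)
    then have S: "4 ^ j * d j x \<le> S" for j by (simp add: S_def)
    have "norm (G (r (Suc j)) x - G (r j) x) \<le> sqrt (2 * S) * (1/2) ^ j" for j
    proof (rule power2_le_imp_le)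
      have "(norm (G (r (Suc j)) x - G (r j) x))\<^sup>2 \<le> 2 * d j x"
        using modular_density_term_le[of 1 n "G (r (Suc j)) x - G (r j) x"] n
        by (simp add: d_def alpha_def)
      also have "\<dots> \<le> 2 * (S / 4 ^ j)" using S[of j] by (simp add: field_simps)
      also have "\<dots> = (sqrt (2 * S) * (1/2) ^ j)\<^sup>2"
      proof -
        have "((1/2) ^ j)\<^sup>2 = (1 / 4 ^ j :: real)"
          by (simp add: power2_eq_square power_mult_distrib[symmetric] power_divide)
        moreover have "S \<ge> 0" by (simp add: S_def)
        ultimately show ?thesis by (simp add: power_mult_distrib)
      qed
      finally show "(norm (G (r (Suc j)) x - G (r j) x))\<^sup>2 \<le> (sqrt (2 * S) * (1/2) ^ j)\<^sup>2" .
    qed (simp add: S_def)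
    then have "summable (\<lambda>j. G (r (Suc j)) x - G (r j) x)"
    proof (rule summable_comparison_test'[rotated])
      show "summable (\<lambda>j. sqrt (2 * S) * (1/2) ^ j)" by (intro summable_mult summable_geometric) simp
    qed
    then have "convergent (\<lambda>k. \<Sum>j<k. G (r (Suc j)) x - G (r j) x)" by (rule summable_iff_convergent[THEN iffD1])
    then have "convergent (\<lambda>k. G (r k) x - G (r 0) x)"
      by (simp only: sum_lessThan_telescope[of "\<lambda>j. G (r j) x"])
    then have "convergent (\<lambda>k. (G (r k) x - G (r 0) x) + G (r 0) x)"
      by (intro convergent_add convergent_const)
    then have "convergent (\<lambda>j. G (r j) x)" by simp
    then show "(\<lambda>j. G (r j) x) \<longlonglongrightarrow> lim (\<lambda>j. G (r j) x)" by (simp add: convergent_LIMSEQ_iff)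
  qed
  define H where "H x = lim (\<lambda>j. G (r j) x)" for x
  have [measurable]: "H \<in> borel_measurable borel" unfolding H_def[abs_def] by measurable
  \<comment> \<open>Fatou's lemma with \<open>k\<close> fixed and the second index running through
    the subsequence.\<close>
  have bd: "(\<integral>\<^sup>+x. ennreal (modular_density n (G k x - H x)) \<partial>lborel) \<le> ennreal ((1/8) ^ i)" if k: "k \<ge> M i" for k i
  proof -
    have "(\<integral>\<^sup>+x. ennreal (modular_density n (G k x - H x)) \<partial>lborel) =
        (\<integral>\<^sup>+x. liminf (\<lambda>j. ennreal (modular_density n (G k x - G (r j) x))) \<partial>lborel)"
    proof (rule nn_integral_cong_AE, rule AE_mp[OF conv], intro AE_I2 impI)
      fix x assume "(\<lambda>j. G (r j) x) \<longlonglongrightarrow> lim (\<lambda>j. G (r j) x)"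
      then have "(\<lambda>j. G k x - G (r j) x) \<longlonglongrightarrow> G k x - H x" unfolding H_def by (intro tendsto_intros)
      then have "(\<lambda>j. modular_density n (G k x - G (r j) x)) \<longlonglongrightarrow> modular_density n (G k x - H x)"
        by (rule continuous_on_tendsto_compose[OF continuous_on_modular_density[of UNIV]]) auto
      then have "(\<lambda>j. ennreal (modular_density n (G k x - G (r j) x))) \<longlonglongrightarrow> ennreal (modular_density n (G k x - H x))"
        by (rule tendsto_ennrealI)
      then show "ennreal (modular_density n (G k x - H x)) = liminf (\<lambda>j. ennreal (modular_density n (G k x - G (r j) x)))"
        by (simp add: lim_imp_Liminf)
    qed
    also have "\<dots> \<le> liminf (\<lambda>j. \<integral>\<^sup>+x. ennreal (modular_density n (G k x - G (r j) x)) \<partial>lborel)"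
      by (rule nn_integral_liminf) measurable
    also have "\<dots> = liminf (\<lambda>j. ennreal (modular n (\<lambda>x. G k x - G (r j) x)))"
      by (subst nn_integral_modular[OF in_modular_diff[OF G G]]) simp
    also have "\<dots> \<le> ennreal ((1/8) ^ i)"
    proof (rule order.trans[OF Liminf_le_Limsup Limsup_bounded])
      show "\<forall>\<^sub>F j in sequentially. ennreal (modular n (\<lambda>x. G k x - G (r j) x)) \<le> ennreal ((1/8) ^ i)"
        using M[OF k rM[of i]] by (intro eventually_sequentiallyI[of i] ennreal_leI less_imp_le)
    qed simp
    finally show ?thesis .
  qed
  have dH: "in_modular n (\<lambda>x. G k x - H x)" if "k \<ge> M i" for k i
    unfolding in_modular_def integrable_iff_bounded
    using le_less_trans[OF bd[OF that] ennreal_less_top]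
    by (auto simp: abs_of_nonneg[OF modular_density_nonneg])
  have HH: "in_modular n H"
    using in_modular_diff[OF G[of "M 0"] dH[of 0 "M 0"]] by simp
  have "(\<lambda>k. modular n (\<lambda>x. G k x - H x)) \<longlonglongrightarrow> 0"
  proof (rule LIMSEQ_I)
    fix e :: real assume "e > 0"
    then obtain i where i: "(1/8) ^ i < e" using real_arch_pow_inv[of e "1/8"] by auto
    have "modular n (\<lambda>x. G k x - H x) < e" if "k \<ge> M i" for k
    proof -
      have "ennreal (modular n (\<lambda>x. G k x - H x)) \<le> ennreal ((1/8) ^ i)"
        using bd[OF that] nn_integral_modular[OF dH[OF that]] by simp
      then have "modular n (\<lambda>x. G k x - H x) \<le> (1/8) ^ i" by simp
      then show ?thesis using i by simp
    qed
    then show "\<exists>K. \<forall>k\<ge>K. norm (modular n (\<lambda>x. G k x - H x) - 0) < e"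
      by (intro exI[of _ "M i"]) (simp add: abs_of_nonneg[OF modular_nonneg])
  qed
  with HH show thesis by (rule that)
qed

section \<open>Weak gradients and the space\<close>

text \<open>Difference quotients integrate to 0 because Lebesgue measure is translation invariant,
  and they converge to the directional derivative under a common bound.\<close>

lemma integral_gradient_zero:
  fixes f :: "'a::euclidean_space \<Rightarrow> real"
  assumes f: "f \<in> test_functions"
  shows "(LINT x|lborel. gradient f x) = 0"
proof (rule euclidean_eqI)
  fix b :: 'a assume b: "b \<in> Basis"
  obtain R where R: "R > 0" "\<And>x. norm x > R \<Longrightarrow> f x = 0" using test_functions_support[OF f] by blast
  have g0: "gradient f x = 0" if "norm x > R" for x by (rule gradient_support[OF R(2) that])
  obtain B where B: "B > 0" "\<And>x. norm (gradient f x) \<le> B"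
    using bounded_compact_support[OF continuous_on_gradient[OF f] g0] by blast
  have i: "integrable lborel (gradient f)" by (rule integrable_compact_support[OF continuous_on_gradient[OF f] g0])
  have fi: "integrable lborel f" by (rule integrable_compact_support[OF test_functions_continuous[OF f] R(2)])
  have [measurable]: "f \<in> borel_measurable borel" "gradient f \<in> borel_measurable borel"
    by (auto intro: borel_measurable_continuous_onI test_functions_continuous[OF f] continuous_on_gradient[OF f])
  define h where "h k = inverse (real (Suc k))" for k
  have h: "h k > 0" "h k \<le> 1" for k by (auto simp: h_def field_simps)
  define s where "s k x = (f (x + h k *\<^sub>R b) - f x) / h k" for k x
  have lip: "\<bar>f (x + t *\<^sub>R b) - f x\<bar> \<le> B * t" if "t > 0" for x t
  proof -
    have "norm (f (x + t *\<^sub>R b) - f x) \<le> B * norm (x + t *\<^sub>R b - x)"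
    proof (rule differentiable_bound[of UNIV f "\<lambda>x h. h \<bullet> gradient f x"])
      show "(f has_derivative (\<lambda>h. h \<bullet> gradient f x)) (at x within UNIV)" for x
        using test_functions_GDERIV[OF f] unfolding gderiv_def .
      show "onorm (\<lambda>h. h \<bullet> gradient f x) \<le> B" for x
      proof (rule onorm_le)
        show "norm (h \<bullet> gradient f x) \<le> B * norm h" for h
          using Cauchy_Schwarz_ineq2[of h "gradient f x"] mult_right_mono[OF B(2)[of x] norm_ge_zero[of h]]
          by (simp add: mult.commute)
      qed
    qed auto
    then show ?thesis using b that by simp
  qed
  have "(\<lambda>k. LINT x|lborel. s k x) \<longlonglongrightarrow> (LINT x|lborel. gradient f x \<bullet> b)"
  \<comment> \<open>The steps \<open>h k\<close> are at most 1, so all quotients live in the ball of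
    radius R + 1; the gradient bound \<open>B\<close> is a Lipschitz constant.\<close>
  proof (rule integral_dominated_convergence[where w = "\<lambda>x. B * indicator (cball 0 (R + 1)) x"])
    show "integrable lborel (\<lambda>x. B * indicator (cball 0 (R + 1)) x :: real)"
      by (intro integrable_mult_right integrable_real_indicator) (use emeasure_bounded_finite[OF bounded_cball] in auto)
    show "AE x in lborel. (\<lambda>k. s k x) \<longlonglongrightarrow> gradient f x \<bullet> b"
    proof (rule AE_I2)
      fix x
      have 1: "((\<lambda>t. x + t *\<^sub>R b) has_derivative (\<lambda>h. h *\<^sub>R b)) (at 0)"
        by (auto intro!: derivative_eq_intros)
      have 2: "(f has_derivative (\<lambda>h. h \<bullet> gradient f x)) (at (x + 0 *\<^sub>R b))"
        using test_functions_GDERIV[OF f] unfolding gderiv_def by simp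
      have "((\<lambda>t. f (x + t *\<^sub>R b)) has_real_derivative (gradient f x \<bullet> b)) (at 0)"
        using has_derivative_compose[OF 1 2] unfolding has_field_derivative_def
        by (rule has_derivative_eq_rhs) (simp add: fun_eq_iff inner_commute)
      then have "((\<lambda>t. (f (x + t *\<^sub>R b) - f x) / t) \<longlongrightarrow> gradient f x \<bullet> b) (at 0)"
        by (simp add: DERIV_def)
      moreover have "filterlim h (at 0) sequentially"
        unfolding filterlim_at using h(1) less_imp_neq[OF h(1)] LIMSEQ_inverse_real_of_nat
        by (auto simp: h_def[abs_def])
      ultimately show "(\<lambda>k. s k x) \<longlonglongrightarrow> gradient f x \<bullet> b"
        unfolding s_def by (rule filterlim_compose)
    qed
    show "AE x in lborel. norm (s k x) \<le> B * indicator (cball 0 (R + 1)) x" for k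
    proof (rule AE_I2)
      fix x
      show "norm (s k x) \<le> B * indicator (cball 0 (R + 1)) x"
      proof (cases "norm x \<le> R + 1")
        case True
        then show ?thesis using lip[OF h(1), of x k] h(1)[of k] by (simp add: s_def field_simps)
      next
        case False
        have "norm x \<le> norm (x + h k *\<^sub>R b) + norm (h k *\<^sub>R b)"
          using norm_triangle_ineq4[of "x + h k *\<^sub>R b" "h k *\<^sub>R b"] by simp
        then have "norm (x + h k *\<^sub>R b) > R" using False h[of k] b by simp
        then show ?thesis using False R by (simp add: s_def)
      qed
    qed
  qed (unfold s_def, measurable)
  moreover have "(LINT x|lborel. s k x) = 0" for k
  proof -
    have d: "lborel = distr lborel borel (\<lambda>x. x + h k *\<^sub>R b)"
    proof -
      have "(\<lambda>x. x + h k *\<^sub>R b) = (+) (h k *\<^sub>R b)" by (rule ext) (rule add.commute)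
      then show ?thesis using lborel_distr_plus[of "h k *\<^sub>R b"] by simp
    qed
    have "(LINT x|distr lborel borel (\<lambda>x. x + h k *\<^sub>R b). f x) = (LINT x|lborel. f (x + h k *\<^sub>R b))"
      by (rule integral_distr) auto
    moreover have "integrable (distr lborel borel (\<lambda>x. x + h k *\<^sub>R b)) f = integrable lborel (\<lambda>x. f (x + h k *\<^sub>R b))"
      by (rule integrable_distr_eq) auto
    ultimately show ?thesis unfolding s_def d[symmetric] using fi
      by (simp add: Bochner_Integration.integral_diff)
  qed
  ultimately have "(LINT x|lborel. gradient f x \<bullet> b) = 0" by (simp add: LIMSEQ_const_iff)
  then show "(LINT x|lborel. gradient f x) \<bullet> b = 0 \<bullet> b" using i by simp
qed

lemma test_functions_mult:
  assumes "f \<in> test_functions" "g \<in> test_functions"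
  shows "(\<lambda>x. f x * g x) \<in> test_functions"
proof -
  obtain R where "\<And>x. norm x > R \<Longrightarrow> f x = 0" using assms test_functions_support by metis
  then show ?thesis using assms test_functions_smooth
    by (intro test_functionsI[of _ R] times_cont_diff_mult) auto
qed

lemma integrable_test_scaleR_gradient:
  assumes "f \<in> test_functions" "g \<in> test_functions"
  shows "integrable lborel (\<lambda>x. f x *\<^sub>R gradient g x)"
proof -
  obtain R where "\<And>x. norm x > R \<Longrightarrow> f x = 0" using assms test_functions_support by metis
  then show ?thesis
    by (intro integrable_compact_support[of _ R] continuous_intros test_functions_continuous[OF assms(1)]
        continuous_on_gradient[OF assms(2)]) auto
qed

lemma integration_by_parts:
  assumes f: "f \<in> test_functions" and g: "g \<in> test_functions"
  shows "(LINT x|lborel. f x *\<^sub>R gradient g x) = - (LINT x|lborel. g x *\<^sub>R gradient f x)"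
proof -
  have "gradient (\<lambda>x. f x * g x) x = f x *\<^sub>R gradient g x + g x *\<^sub>R gradient f x" for x
    by (intro GDERIV_unique GDERIV_mult test_functions_GDERIV f g)
  then have "0 = (LINT x|lborel. f x *\<^sub>R gradient g x + g x *\<^sub>R gradient f x)"
    using integral_gradient_zero[OF test_functions_mult[OF f g]] by simp
  also have "\<dots> = (LINT x|lborel. f x *\<^sub>R gradient g x) + (LINT x|lborel. g x *\<^sub>R gradient f x)"
    by (intro Bochner_Integration.integral_add integrable_test_scaleR_gradient f g)
  finally show ?thesis by (simp add: eq_neg_iff_add_eq_0)
qed

lemma gradient_diff_fun:
  "f \<in> test_functions \<Longrightarrow> g \<in> test_functions \<Longrightarrow>
    gradient (\<lambda>x. f x - g x) = (\<lambda>x. gradient f x - gradient g x)"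
  by (rule ext) (rule gradient_diff)

text \<open>Keeps the modular limit \<open>G\<close> of the gradients next to the uniform limit of
  the functions. Facts about the space are proved for such triples, so that sums, multiples and
  truncations act on both limits at once; \<open>G\<close> is a weak gradient only by a later
  lemma.\<close>

definition approximates ::
    "nat \<Rightarrow> (nat \<Rightarrow> 'a::euclidean_space \<Rightarrow> real) \<Rightarrow> ('a \<Rightarrow> real) \<Rightarrow> ('a \<Rightarrow> 'a) \<Rightarrow> bool" where
  "approximates n u \<phi> G \<longleftrightarrow> (\<forall>k. u k \<in> test_functions) \<and> uniform_limit UNIV u \<phi> sequentially \<and>
     in_modular n G \<and> (\<lambda>k. modular n (\<lambda>x. gradient (u k) x - G x)) \<longlonglongrightarrow> 0"

lemma approximatesD:
  assumes "approximates n u \<phi> G"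
  shows "u k \<in> test_functions" "uniform_limit UNIV u \<phi> sequentially" "in_modular n G"
    "(\<lambda>k. modular n (\<lambda>x. gradient (u k) x - G x)) \<longlonglongrightarrow> 0"
  using assms by (auto simp: approximates_def)

lemma approximates_continuous: "approximates n u \<phi> G \<Longrightarrow> continuous_on UNIV \<phi>"
  by (rule uniform_limit_theorem[OF _ approximatesD(2)]) (auto simp: approximates_def test_functions_continuous)

lemma approximates_bounded:
  assumes "approximates n u \<phi> G"
  obtains B where "B > 0" "\<And>x. \<bar>\<phi> x\<bar> \<le> B"
proof -
  have "\<forall>\<^sub>F k in sequentially. \<forall>x. dist (u k x) (\<phi> x) < 1"
    using uniform_limitD[OF approximatesD(2)[OF assms], of 1] by simp
  then obtain k where k: "\<And>x. dist (u k x) (\<phi> x) < 1" by (auto simp: eventually_sequentially)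
  have uk: "u k \<in> test_functions" by (rule approximatesD(1)[OF assms])
  obtain R where "\<And>x. norm x > R \<Longrightarrow> u k x = 0" using test_functions_support[OF uk] by blast
  then obtain B where B: "B > 0" "\<And>x. norm (u k x) \<le> B"
    using bounded_compact_support[OF test_functions_continuous[OF uk]] by metis
  have "\<bar>\<phi> x\<bar> \<le> B + 1" for x using k[of x] B(2)[of x] by (auto simp: dist_real_def)
  with B(1) show thesis by (intro that[of "B + 1"]) auto
qed

lemma approximates_add:
  assumes "approximates n u \<phi> G" "approximates n v \<psi> H"
  shows "approximates n (\<lambda>k x. u k x + v k x) (\<lambda>x. \<phi> x + \<psi> x) (\<lambda>x. G x + H x)"
  unfolding approximates_def
proof (intro conjI allI)
  note u = approximatesD[OF assms(1)] and v = approximatesD[OF assms(2)]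
  show "(\<lambda>x. u k x + v k x) \<in> test_functions" for k by (intro test_functions_add u v)
  show "uniform_limit UNIV (\<lambda>k x. u k x + v k x) (\<lambda>x. \<phi> x + \<psi> x) sequentially"
    by (intro uniform_limit_add u v)
  show "in_modular n (\<lambda>x. G x + H x)" by (intro in_modular_add u v)
  show "(\<lambda>k. modular n (\<lambda>x. gradient (\<lambda>x. u k x + v k x) x - (G x + H x))) \<longlonglongrightarrow> 0"
  proof (rule real_tendsto_sandwich[OF _ _ tendsto_const])
    have "modular n (\<lambda>x. gradient (\<lambda>x. u k x + v k x) x - (G x + H x)) \<le>
        4 ^ n * (modular n (\<lambda>x. gradient (u k) x - G x) + modular n (\<lambda>x. gradient (v k) x - H x))" for k
      using modular_add_le_4[OF in_modular_diff[OF in_modular_gradient[OF u(1)] u(3)]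
          in_modular_diff[OF in_modular_gradient[OF v(1)] v(3)], of k k]
      by (simp add: gradient_add u v algebra_simps)
    then show "\<forall>\<^sub>F k in sequentially. modular n (\<lambda>x. gradient (\<lambda>x. u k x + v k x) x - (G x + H x)) \<le>
        4 ^ n * (modular n (\<lambda>x. gradient (u k) x - G x) + modular n (\<lambda>x. gradient (v k) x - H x))" by simp
    show "(\<lambda>k. 4 ^ n * (modular n (\<lambda>x. gradient (u k) x - G x) + modular n (\<lambda>x. gradient (v k) x - H x))) \<longlonglongrightarrow> 0"
      by (auto intro!: tendsto_eq_intros u v)
  qed (simp add: modular_nonneg)
qed

lemma modular_scale_bound:
  assumes "in_modular n G"
  shows "modular n (\<lambda>x. c *\<^sub>R G x) \<le> (1 + \<bar>c\<bar>) ^ (2 * n) * modular n G"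
proof -
  note [measurable] = in_modular_measurable[OF assms]
  have "modular n (\<lambda>x. c *\<^sub>R G x) \<le> modular n (\<lambda>x. (1 + \<bar>c\<bar>) *\<^sub>R G x)"
    by (intro modular_mono in_modular_scale assms) (auto intro!: mult_right_mono)
  also have "\<dots> \<le> (1 + \<bar>c\<bar>) ^ (2 * n) * modular n G" by (intro modular_scale_ge assms) auto
  finally show ?thesis .
qed

lemma approximates_scale:
  assumes "approximates n u \<phi> G"
  shows "approximates n (\<lambda>k x. c * u k x) (\<lambda>x. c * \<phi> x) (\<lambda>x. c *\<^sub>R G x)"
  unfolding approximates_def
proof (intro conjI allI)
  note u = approximatesD[OF assms]
  show "(\<lambda>x. c * u k x) \<in> test_functions" for k by (intro test_functions_cmult u)
  show "uniform_limit UNIV (\<lambda>k x. c * u k x) (\<lambda>x. c * \<phi> x) sequentially"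
    using bounded_linear.uniform_limit[OF bounded_linear_mult_right u(2)] .
  show "in_modular n (\<lambda>x. c *\<^sub>R G x)" by (intro in_modular_scale u)
  show "(\<lambda>k. modular n (\<lambda>x. gradient (\<lambda>x. c * u k x) x - c *\<^sub>R G x)) \<longlonglongrightarrow> 0"
  proof (rule real_tendsto_sandwich[OF _ _ tendsto_const])
    have "modular n (\<lambda>x. gradient (\<lambda>x. c * u k x) x - c *\<^sub>R G x) \<le>
        (1 + \<bar>c\<bar>) ^ (2 * n) * modular n (\<lambda>x. gradient (u k) x - G x)" for k
      using modular_scale_bound[OF in_modular_diff[OF in_modular_gradient[OF u(1)] u(3)], of c k]
      by (simp add: gradient_cmult u scaleR_diff_right)
    then show "\<forall>\<^sub>F k in sequentially. modular n (\<lambda>x. gradient (\<lambda>x. c * u k x) x - c *\<^sub>R G x) \<le>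
        (1 + \<bar>c\<bar>) ^ (2 * n) * modular n (\<lambda>x. gradient (u k) x - G x)" by simp
    show "(\<lambda>k. (1 + \<bar>c\<bar>) ^ (2 * n) * modular n (\<lambda>x. gradient (u k) x - G x)) \<longlonglongrightarrow> 0"
      by (auto intro!: tendsto_eq_intros u)
  qed (simp add: modular_nonneg)
qed

lemma approximates_diff:
  assumes "approximates n u \<phi> G" "approximates n v \<psi> H"
  shows "approximates n (\<lambda>k x. u k x - v k x) (\<lambda>x. \<phi> x - \<psi> x) (\<lambda>x. G x - H x)"
  using approximates_add[OF assms(1) approximates_scale[OF assms(2), of "-1"]] by simp

lemma approximates_test:
  assumes "u \<in> test_functions"
  shows "approximates n (\<lambda>k. u) u (gradient u)"
  unfolding approximates_def
  by (simp add: assms in_modular_gradient modular_def modular_density_zero uniform_limit_const)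

section \<open>Comparison of the modular with the norms\<close>

lemma integrable_norm_power:
  assumes "in_modular n G" "1 \<le> h" "h \<le> n"
  shows "integrable lborel (\<lambda>x. norm (G x) ^ (2 * h))"
proof (rule Bochner_Integration.integrable_bound)
  note [measurable] = in_modular_measurable[OF assms(1)]
  show "integrable lborel (\<lambda>x. 2 * real h / alpha h * modular_density n (G x))"
    by (intro integrable_mult_right in_modular_integrable assms)
  show "AE x in lborel. norm (norm (G x) ^ (2 * h)) \<le> norm (2 * real h / alpha h * modular_density n (G x))"
  proof (rule AE_I2)
    show "norm (norm (G x) ^ (2 * h)) \<le> norm (2 * real h / alpha h * modular_density n (G x))" for x
      using order.trans[OF modular_density_term_le[OF assms(2,3), of "G x"] abs_ge_self] by simp
  qed
qed (use in_modular_measurable[OF assms(1)] in measurable)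

lemma integral_norm_power_le:
  assumes "in_modular n G" "1 \<le> h" "h \<le> n"
  shows "(LINT x|lborel. norm (G x) ^ (2 * h)) \<le> 2 * real h / alpha h * modular n G"
  unfolding modular_def integral_mult_right_zero[symmetric]
  by (intro integral_mono integrable_norm_power[OF assms] integrable_mult_right
      in_modular_integrable[OF assms(1)] modular_density_term_le assms)

lemma modular_eq_sum:
  assumes "in_modular n G"
  shows "modular n G = (\<Sum>h=1..n. alpha h / (2 * real h) * (LINT x|lborel. norm (G x) ^ (2 * h)))"
  unfolding modular_def modular_density_def using integrable_norm_power[OF assms]
  by (subst Bochner_Integration.integral_sum) auto

lemma Lp_norm_power: "p > 0 \<Longrightarrow> Lp_norm p G ^ p = (LINT x|lborel. norm (G x) ^ p)"
  unfolding Lp_norm_def by (intro real_root_pow_pos2 integral_nonneg_AE) auto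

lemma Lp_norm_nonneg: "0 \<le> Lp_norm p G"
  unfolding Lp_norm_def by (cases "p = 0") (auto intro!: real_root_ge_zero integral_nonneg_AE)

text \<open>Together with \<open>X_norm_less\<close> this gives modular and norm the same Cauchy
  sequences of test functions. For norms at most 1 the powers 2 and 2 n are bounded by the norm
  itself.\<close>

lemma modular_le_X_norm:
  assumes n: "n \<ge> 1"
  obtains C where "C > 0" "\<And>w :: 'a::euclidean_space \<Rightarrow> real. w \<in> test_functions \<Longrightarrow> X_norm n w \<le> 1 \<Longrightarrow>
    modular n (gradient w) \<le> C * X_norm n w"
proof -
  obtain C where C: "C > 0" "\<And>v::'a. modular_density n v \<le> C * ((norm v)\<^sup>2 + norm v ^ (2 * n))"
    using modular_density_upper by blast
  have "modular n (gradient w) \<le> (2 * C) * X_norm n w"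
    if w: "w \<in> test_functions" "X_norm n w \<le> 1" for w :: "'a \<Rightarrow> real"
  proof -
    note im = in_modular_gradient[OF w(1), of n]
    have i: "integrable lborel (\<lambda>x. (norm (gradient w x))\<^sup>2)" "integrable lborel (\<lambda>x. norm (gradient w x) ^ (2 * n))"
      using integrable_norm_power[OF im, of 1] integrable_norm_power[OF im, of n] n by auto
    have "modular n (gradient w) \<le> (LINT x|lborel. C * ((norm (gradient w x))\<^sup>2 + norm (gradient w x) ^ (2 * n)))"
      unfolding modular_def using i C(2)
      by (intro integral_mono in_modular_integrable im integrable_mult_right Bochner_Integration.integrable_add)
    also have "\<dots> = C * (Lp_norm 2 (gradient w) ^ 2 + Lp_norm (2 * n) (gradient w) ^ (2 * n))"
      using i n by (simp add: Lp_norm_power)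
    also have "\<dots> \<le> C * (X_norm n w + X_norm n w)"
    proof -
      have X: "Lp_norm 2 (gradient w) \<le> X_norm n w" "Lp_norm (2 * n) (gradient w) \<le> X_norm n w"
        unfolding X_norm_def using Lp_norm_nonneg by (auto simp: add_increasing add_increasing2)
      have "Lp_norm 2 (gradient w) ^ 2 \<le> Lp_norm 2 (gradient w) ^ 1"
        "Lp_norm (2 * n) (gradient w) ^ (2 * n) \<le> Lp_norm (2 * n) (gradient w) ^ 1"
        using order.trans[OF X(1) w(2)] order.trans[OF X(2) w(2)] n
        by (intro power_decreasing Lp_norm_nonneg; simp)+
      then show ?thesis using X C(1) by (intro mult_left_mono add_mono) auto
    qed
    finally show ?thesis by simp
  qed
  then show thesis using C(1) by (intro that[of "2 * C"]) auto
qed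

lemma X_norm_less:
  assumes n: "n \<ge> 1" and "e > 0"
  obtains d where "d > 0" "\<And>w :: 'a::euclidean_space \<Rightarrow> real. w \<in> test_functions \<Longrightarrow>
    modular n (gradient w) < d \<Longrightarrow> X_norm n w < e"
proof -
  define K where "K h = 2 * real h / alpha h" for h
  have K: "K h > 0" if "h \<ge> 1" for h using that alpha_pos[of h] by (simp add: K_def)
  \<comment> \<open>\<open>K h\<close> is the constant of \<open>integral_norm_power_le\<close>; the
    two entries push the L^2 and the L^(2n) norm below e/2 each.\<close>
  define d where "d = min ((e / 2) ^ 2 / K 1) ((e / 2) ^ (2 * n) / K n)"
  have "d > 0" using K n \<open>e > 0\<close> by (simp add: d_def)
  moreover have "X_norm n w < e" if w: "w \<in> test_functions" "modular n (gradient w) < d" for w :: "'a \<Rightarrow> real"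
  proof -
    have "Lp_norm (2 * h) (gradient w) < e / 2" if h: "1 \<le> h" "h \<le> n" "d \<le> (e / 2) ^ (2 * h) / K h" for h
    proof -
      have "Lp_norm (2 * h) (gradient w) ^ (2 * h) \<le> K h * modular n (gradient w)"
        using integral_norm_power_le[OF in_modular_gradient[OF w(1)] h(1,2)] h by (simp add: Lp_norm_power K_def)
      also have "\<dots> < K h * d" using K[OF h(1)] w by simp
      also have "\<dots> \<le> (e / 2) ^ (2 * h)" using h(3) K[OF h(1)] by (simp add: field_simps)
      finally have "Lp_norm (2 * h) (gradient w) ^ (2 * h) < (e / 2) ^ (2 * h)" .
      from power_less_imp_less_base[OF this] show ?thesis using \<open>e > 0\<close> by simp
    qed
    from this[of 1] this[of n] show ?thesis using n by (simp add: X_norm_def d_def)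
  qed
  ultimately show thesis by (rule that)
qed

lemma modular_Cauchy_of_tendsto:
  assumes G: "\<And>k. in_modular n (G k)" and H: "in_modular n H"
    and lim: "(\<lambda>k. modular n (\<lambda>x. G k x - H x)) \<longlonglongrightarrow> 0" and "e > 0"
  shows "\<exists>M. \<forall>j\<ge>M. \<forall>k\<ge>M. modular n (\<lambda>x. G j x - G k x) < e"
proof -
  have "\<forall>\<^sub>F k in sequentially. modular n (\<lambda>x. G k x - H x) < e / (2 * 4 ^ n)"
    using lim \<open>e > 0\<close> by (intro order_tendstoD) auto
  then obtain M where M: "\<And>k. k \<ge> M \<Longrightarrow> modular n (\<lambda>x. G k x - H x) < e / (2 * 4 ^ n)"
    by (auto simp: eventually_sequentially)
  have "modular n (\<lambda>x. G j x - G k x) < e" if "j \<ge> M" "k \<ge> M" for j k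
  proof -
    have "modular n (\<lambda>x. G j x - G k x) \<le> 4 ^ n * (modular n (\<lambda>x. G j x - H x) + modular n (\<lambda>x. G k x - H x))"
      using modular_triangle_4[OF G[of j] H G[of k]] modular_minus_commute[of n H "G k"] by simp
    also have "\<dots> < 4 ^ n * (e / (2 * 4 ^ n) + e / (2 * 4 ^ n))"
      using M that by (intro mult_strict_left_mono add_strict_mono) auto
    finally show ?thesis by (simp add: field_simps)
  qed
  then show ?thesis by blast
qed

lemma X_space_iff:
  assumes n: "n \<ge> 1"
  shows "\<phi> \<in> X_space n \<longleftrightarrow> (\<exists>u G. approximates n u \<phi> G)"
proof
  assume "\<phi> \<in> X_space n"
  then obtain u where u: "\<And>k. u k \<in> test_functions" "uniform_limit UNIV u \<phi> sequentially"
    and C: "\<And>e. e > 0 \<Longrightarrow> \<exists>M. \<forall>j\<ge>M. \<forall>k\<ge>M. X_norm n (\<lambda>x. u j x - u k x) < e"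
    unfolding X_space_def by blast
  obtain C where C': "C > 0" "\<And>w :: 'a \<Rightarrow> real. w \<in> test_functions \<Longrightarrow> X_norm n w \<le> 1 \<Longrightarrow>
    modular n (gradient w) \<le> C * X_norm n w"
    using modular_le_X_norm[OF n] by blast
  have "\<exists>M. \<forall>j\<ge>M. \<forall>k\<ge>M. modular n (\<lambda>x. gradient (u j) x - gradient (u k) x) < e" if "e > 0" for e
  proof -
    have "min 1 (e / C) > 0" using that C'(1) by simp
    from C[OF this] obtain M where
      M: "\<And>j k. j \<ge> M \<Longrightarrow> k \<ge> M \<Longrightarrow> X_norm n (\<lambda>x. u j x - u k x) < min 1 (e / C)"
      by blast
    have "modular n (\<lambda>x. gradient (u j) x - gradient (u k) x) < e" if jk: "j \<ge> M" "k \<ge> M" for j k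
    proof -
      have "modular n (gradient (\<lambda>x. u j x - u k x)) \<le> C * X_norm n (\<lambda>x. u j x - u k x)"
        using M[OF jk] by (intro C' test_functions_diff u) auto
      also have "\<dots> < C * (e / C)" using M[OF jk] C'(1) by (intro mult_strict_left_mono) auto
      finally show ?thesis using C'(1) u by (simp add: gradient_diff_fun)
    qed
    then show ?thesis by blast
  qed
  then obtain H where "in_modular n H" "(\<lambda>k. modular n (\<lambda>x. gradient (u k) x - H x)) \<longlonglongrightarrow> 0"
    using modular_complete[OF n, of "\<lambda>k. gradient (u k)"] in_modular_gradient u by blast
  then show "\<exists>u G. approximates n u \<phi> G" using u unfolding approximates_def by blast
next
  assume "\<exists>u G. approximates n u \<phi> G"
  then obtain u G where "approximates n u \<phi> G" by blast
  note u = approximatesD[OF this]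
  have "\<exists>M. \<forall>j\<ge>M. \<forall>k\<ge>M. X_norm n (\<lambda>x. u j x - u k x) < e" if e: "e > 0" for e
  proof -
    obtain d where d: "d > 0" "\<And>w :: 'a \<Rightarrow> real. w \<in> test_functions \<Longrightarrow>
      modular n (gradient w) < d \<Longrightarrow> X_norm n w < e" using X_norm_less[OF n e] by blast
    obtain M where "\<forall>j\<ge>M. \<forall>k\<ge>M. modular n (\<lambda>x. gradient (u j) x - gradient (u k) x) < d"
      using modular_Cauchy_of_tendsto[OF in_modular_gradient[OF u(1)] u(3,4) d(1)] by blast
    then show ?thesis
      by (intro exI[of _ M] allI impI d(2) test_functions_diff u(1)) (simp add: gradient_diff_fun u(1))
  qed
  then show "\<phi> \<in> X_space n" unfolding X_space_def using u by blast
qed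

lemma norm_le_modular_density:
  assumes "n \<ge> 1"
  shows "(norm v)\<^sup>2 \<le> 2 * modular_density n v"
  using modular_density_term_le[of 1 n v] assms by (simp add: alpha_def)

text \<open>Integration by parts for the approximants passes to the limit: on one side uniform
  convergence acts against an integrable gradient, on the other modular convergence acts against a
  square-integrable test function.\<close>

lemma approximates_weak_gradient:
  fixes \<phi> :: "'a::euclidean_space \<Rightarrow> real"
  assumes n: "n \<ge> 1" and a: "approximates n u \<phi> G"
  shows "has_weak_gradient \<phi> G"
  unfolding has_weak_gradient_def
proof (intro conjI allI impI ballI)
  note u = approximatesD[OF a]
  have [measurable]: "G \<in> borel_measurable borel" by (rule in_modular_measurable[OF u(3)])
  then show "G \<in> borel_measurable lborel" by simp
  have [measurable]: "gradient (u k) \<in> borel_measurable borel" for k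
    using in_modular_gradient[OF u(1)] in_modular_measurable by blast
  show "set_integrable lborel C G" if "compact C" for C
    unfolding set_integrable_def
  proof (rule Bochner_Integration.integrable_bound)
    have [measurable]: "C \<in> sets borel" using that by (simp add: compact_imp_closed)
    show "integrable lborel (\<lambda>x. indicator C x + 2 * modular_density n (G x) :: real)"
      using that by (intro Bochner_Integration.integrable_add integrable_mult_right in_modular_integrable u
          integrable_real_indicator) (use emeasure_bounded_finite[OF compact_imp_bounded] in \<open>auto simp: compact_imp_closed\<close>)
    show "AE x in lborel. norm (indicator C x *\<^sub>R G x) \<le> norm (indicator C x + 2 * modular_density n (G x) :: real)"
    proof (rule AE_I2)
      fix x
      have "norm (G x) \<le> 1 + (norm (G x))\<^sup>2"
        using zero_le_power2[of "norm (G x) - 1/2"] by (simp add: power2_eq_square algebra_simps)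
      also have "\<dots> \<le> 1 + 2 * modular_density n (G x)" using norm_le_modular_density[OF n] by simp
      finally show "norm (indicator C x *\<^sub>R G x) \<le> norm (indicator C x + 2 * modular_density n (G x) :: real)"
        using modular_density_nonneg[of n "G x"] by (auto simp: indicator_def)
    qed
    show "(\<lambda>x. indicator C x *\<^sub>R G x) \<in> borel_measurable lborel" by measurable
  qed
  fix \<psi> :: "'a \<Rightarrow> real" assume \<psi>: "\<psi> \<in> test_functions"
  obtain R where R: "\<And>x. norm x > R \<Longrightarrow> \<psi> x = 0" using test_functions_support[OF \<psi>] by blast
  have g0: "gradient \<psi> x = 0" if "norm x > R" for x by (rule gradient_support[OF R that])
  have [measurable]: "\<psi> \<in> borel_measurable borel"
    by (intro borel_measurable_continuous_onI test_functions_continuous \<psi>)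
  have ig: "integrable lborel (gradient \<psi>)"
    by (rule integrable_compact_support[OF continuous_on_gradient[OF \<psi>] g0])
  have i2: "integrable lborel (\<lambda>x. (\<psi> x)\<^sup>2)"
    by (rule integrable_compact_support[OF continuous_on_power[OF test_functions_continuous[OF \<psi>]], where R=R])
      (simp add: R)
  have iphi: "integrable lborel (\<lambda>x. \<phi> x *\<^sub>R gradient \<psi> x)"
    by (rule integrable_compact_support[where R=R])
      (auto intro!: continuous_intros continuous_on_gradient \<psi> approximates_continuous[OF a] simp: g0)
  have L: "(\<lambda>k. LINT x|lborel. u k x *\<^sub>R gradient \<psi> x) \<longlonglongrightarrow> (LINT x|lborel. \<phi> x *\<^sub>R gradient \<psi> x)"
  proof (rule LIMSEQ_I)
    fix e :: real assume "e > 0"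
    define A where "A = (LINT x|lborel. norm (gradient \<psi> x)) + 1"
    have A: "A > 0" unfolding A_def by (intro add_nonneg_pos integral_nonneg_AE) auto
    have "\<forall>\<^sub>F k in sequentially. \<forall>x. dist (u k x) (\<phi> x) < e / A"
      using uniform_limitD[OF u(2), of "e / A"] \<open>e > 0\<close> A by simp
    then obtain K where K: "\<And>k x. k \<ge> K \<Longrightarrow> dist (u k x) (\<phi> x) < e / A" by (auto simp: eventually_sequentially)
    have "norm ((LINT x|lborel. u k x *\<^sub>R gradient \<psi> x) - (LINT x|lborel. \<phi> x *\<^sub>R gradient \<psi> x)) < e" if "k \<ge> K" for k
    proof -
      have "(LINT x|lborel. u k x *\<^sub>R gradient \<psi> x) - (LINT x|lborel. \<phi> x *\<^sub>R gradient \<psi> x)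
        = (LINT x|lborel. (u k x - \<phi> x) *\<^sub>R gradient \<psi> x)"
        using integrable_test_scaleR_gradient[OF u(1) \<psi>, of k] iphi
        by (subst Bochner_Integration.integral_diff[symmetric]) (auto simp: scaleR_diff_left)
      also have "norm \<dots> \<le> (LINT x|lborel. e / A * norm (gradient \<psi> x))"
      proof (rule Bochner_Integration.integral_norm_bound_integral)
        show "integrable lborel (\<lambda>x. (u k x - \<phi> x) *\<^sub>R gradient \<psi> x)"
          using Bochner_Integration.integrable_diff[OF integrable_test_scaleR_gradient[OF u(1) \<psi>, of k] iphi]
          by (simp add: scaleR_diff_left)
        show "norm ((u k x - \<phi> x) *\<^sub>R gradient \<psi> x) \<le> e / A * norm (gradient \<psi> x)" for x
          unfolding norm_scaleR using K[OF that, of x] by (intro mult_right_mono) (auto simp: dist_real_def)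
      qed (use ig in auto)
      also have "\<dots> = e / A * (A - 1)" by (simp add: A_def)
      also have "\<dots> < e" using A \<open>e > 0\<close> by (simp add: field_simps)
      finally show ?thesis .
    qed
    then show "\<exists>K. \<forall>k\<ge>K. norm ((LINT x|lborel. u k x *\<^sub>R gradient \<psi> x) - (LINT x|lborel. \<phi> x *\<^sub>R gradient \<psi> x)) < e"
      by blast
  qed
  \<comment> \<open>Young's inequality with a free weight \<open>s\<close>. Later \<open>s\<close>
    is fixed first, to make the \<psi> term small, and only then \<open>k\<close>, to make the
    modular term small.\<close>
  have dom: "integrable lborel (\<lambda>x. \<psi> x *\<^sub>R H x)"
    "norm (LINT x|lborel. \<psi> x *\<^sub>R H x) \<le> s * (LINT x|lborel. (\<psi> x)\<^sup>2) + 1 / s * (2 * modular n H)"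
    if H: "in_modular n H" and s: "s > 0" for H s
  proof -
    note [measurable] = in_modular_measurable[OF H]
    have b: "norm (\<psi> x *\<^sub>R H x) \<le> s * (\<psi> x)\<^sup>2 + 1 / s * (2 * modular_density n (H x))" for x
    proof -
      have "0 \<le> (s * \<bar>\<psi> x\<bar> - norm (H x))\<^sup>2" by simp
      then have "2 * s * (\<bar>\<psi> x\<bar> * norm (H x)) \<le> s\<^sup>2 * (\<psi> x)\<^sup>2 + (norm (H x))\<^sup>2"
        by (simp add: power2_diff power_mult_distrib algebra_simps)
      moreover have "s * (\<bar>\<psi> x\<bar> * norm (H x)) \<ge> 0" using s by simp
      ultimately have "s * (\<bar>\<psi> x\<bar> * norm (H x)) \<le> s\<^sup>2 * (\<psi> x)\<^sup>2 + 2 * modular_density n (H x)"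
        using norm_le_modular_density[OF n, of "H x"] by linarith
      then show ?thesis using s by (simp add: field_simps power2_eq_square)
    qed
    have ib: "integrable lborel (\<lambda>x. s * (\<psi> x)\<^sup>2 + 1 / s * (2 * modular_density n (H x)))"
      by (intro Bochner_Integration.integrable_add integrable_mult_right i2 in_modular_integrable H)
    show i: "integrable lborel (\<lambda>x. \<psi> x *\<^sub>R H x)"
      by (rule Bochner_Integration.integrable_bound[OF ib]) (use order.trans[OF b abs_ge_self] in auto)
    have "norm (LINT x|lborel. \<psi> x *\<^sub>R H x) \<le> (LINT x|lborel. s * (\<psi> x)\<^sup>2 + 1 / s * (2 * modular_density n (H x)))"
      by (rule Bochner_Integration.integral_norm_bound_integral[OF i ib]) (rule b)
    also have "\<dots> = s * (LINT x|lborel. (\<psi> x)\<^sup>2) + 1 / s * (2 * modular n H)"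
      unfolding modular_def
      by (subst Bochner_Integration.integral_add) (auto intro!: i2 in_modular_integrable H)
    finally show "norm (LINT x|lborel. \<psi> x *\<^sub>R H x) \<le> s * (LINT x|lborel. (\<psi> x)\<^sup>2) + 1 / s * (2 * modular n H)" .
  qed
  have Rt: "(\<lambda>k. LINT x|lborel. \<psi> x *\<^sub>R gradient (u k) x) \<longlonglongrightarrow> (LINT x|lborel. \<psi> x *\<^sub>R G x)"
  proof (rule LIMSEQ_I)
    fix e :: real assume e: "e > 0"
    define Q where "Q = (LINT x|lborel. (\<psi> x)\<^sup>2) + 1"
    have Q: "Q > 0" unfolding Q_def by (intro add_nonneg_pos integral_nonneg_AE) auto
    define s where "s = e / (2 * Q)"
    have s: "s > 0" using e Q by (simp add: s_def)
    have "\<forall>\<^sub>F k in sequentially. modular n (\<lambda>x. gradient (u k) x - G x) < s * e / 4"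
      using u(4) s e by (intro order_tendstoD) auto
    then obtain K where K: "\<And>k. k \<ge> K \<Longrightarrow> modular n (\<lambda>x. gradient (u k) x - G x) < s * e / 4"
      by (auto simp: eventually_sequentially)
    have "norm ((LINT x|lborel. \<psi> x *\<^sub>R gradient (u k) x) - (LINT x|lborel. \<psi> x *\<^sub>R G x)) < e" if "k \<ge> K" for k
    proof -
      have d: "in_modular n (\<lambda>x. gradient (u k) x - G x)"
        by (intro in_modular_diff in_modular_gradient u)
      have "(LINT x|lborel. \<psi> x *\<^sub>R gradient (u k) x) - (LINT x|lborel. \<psi> x *\<^sub>R G x)
          = (LINT x|lborel. \<psi> x *\<^sub>R (gradient (u k) x - G x))"
        using dom(1)[OF in_modular_gradient[OF u(1)] s] dom(1)[OF u(3) s]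
        by (subst Bochner_Integration.integral_diff[symmetric]) (auto simp: scaleR_diff_right)
      also have "norm \<dots> \<le> s * (LINT x|lborel. (\<psi> x)\<^sup>2) + 1 / s * (2 * modular n (\<lambda>x. gradient (u k) x - G x))"
        by (rule dom(2)[OF d s])
      also have "\<dots> < e / 2 + e / 2"
      proof (rule add_less_le_mono)
        show "s * (LINT x|lborel. (\<psi> x)\<^sup>2) < e / 2" using Q e by (simp add: s_def Q_def field_simps)
        show "1 / s * (2 * modular n (\<lambda>x. gradient (u k) x - G x)) \<le> e / 2"
          using K[OF that] s by (simp add: field_simps)
      qed
      finally show ?thesis by simp
    qed
    then show "\<exists>K. \<forall>k\<ge>K. norm ((LINT x|lborel. \<psi> x *\<^sub>R gradient (u k) x) - (LINT x|lborel. \<psi> x *\<^sub>R G x)) < e"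
      by blast
  qed
  have "(\<lambda>k. LINT x|lborel. u k x *\<^sub>R gradient \<psi> x) \<longlonglongrightarrow> - (LINT x|lborel. \<psi> x *\<^sub>R G x)"
    unfolding integration_by_parts[OF u(1) \<psi>] by (intro tendsto_minus Rt)
  then show "(LINT x|lborel. \<phi> x *\<^sub>R gradient \<psi> x) = - (LINT x|lborel. \<psi> x *\<^sub>R G x)"
    using L LIMSEQ_unique by blast
qed

lemma weak_gradient_unique:
  assumes "has_weak_gradient \<phi> G" "has_weak_gradient \<phi> H"
  shows "AE x in lborel. G x = H x"
proof -
  have GH[measurable]: "G \<in> borel_measurable borel" "H \<in> borel_measurable borel"
    and int: "\<And>C. compact C \<Longrightarrow> set_integrable lborel C G" "\<And>C. compact C \<Longrightarrow> set_integrable lborel C H"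
    and eq: "\<And>\<psi>. \<psi> \<in> test_functions \<Longrightarrow> (LINT x|lborel. \<psi> x *\<^sub>R G x) = (LINT x|lborel. \<psi> x *\<^sub>R H x)"
    using assms by (auto simp: has_weak_gradient_def)
  have i: "integrable lborel (\<lambda>x. \<psi> x *\<^sub>R F x)"
    if \<psi>: "\<psi> \<in> test_functions" and F: "F \<in> borel_measurable borel" "\<And>C. compact C \<Longrightarrow> set_integrable lborel C F"
    for \<psi> and F :: "'a \<Rightarrow> 'a"
  proof -
    obtain R where R: "\<And>x. norm x > R \<Longrightarrow> \<psi> x = 0" using test_functions_support[OF \<psi>] by blast
    obtain B where B: "B > 0" "\<And>x. norm (\<psi> x) \<le> B"
      using bounded_compact_support[OF test_functions_continuous[OF \<psi>] R] by blast
    have [measurable]: "\<psi> \<in> borel_measurable borel"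
      by (intro borel_measurable_continuous_onI test_functions_continuous \<psi>)
    show ?thesis
    proof (rule Bochner_Integration.integrable_bound)
      show "integrable lborel (\<lambda>x. B *\<^sub>R (indicator (cball 0 R) x *\<^sub>R F x))"
        using F(2)[of "cball 0 R"] unfolding set_integrable_def by (intro integrable_scaleR_right) auto
      show "AE x in lborel. norm (\<psi> x *\<^sub>R F x) \<le> norm (B *\<^sub>R (indicator (cball 0 R) x *\<^sub>R F x))"
      proof (rule AE_I2)
        fix x
        show "norm (\<psi> x *\<^sub>R F x) \<le> norm (B *\<^sub>R (indicator (cball 0 R) x *\<^sub>R F x))"
          using R[of x] B(1) B(2)[of x] by (cases "norm x \<le> R") (simp_all add: mult_right_mono)
      qed
    qed (use F(1) in measurable)
  qed
  have "AE x in lborel. G x - H x = 0"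
  proof (rule AE_zero_test_functions)
    show "(\<lambda>x. G x - H x) \<in> borel_measurable lborel" by measurable
    show "set_integrable lborel C (\<lambda>x. G x - H x)" if "compact C" for C
      using int[OF that] by (rule set_integral_diff)
    show "(LINT x|lborel. \<psi> x *\<^sub>R (G x - H x)) = 0" if "\<psi> \<in> test_functions" for \<psi>
      using i[OF that GH(1) int(1)] i[OF that GH(2) int(2)] eq[OF that] by (simp add: scaleR_diff_right)
  qed
  then show ?thesis by simp
qed

text \<open>Makes the choice in \<open>weak_gradient\<close> harmless: weak gradients agree almost
  everywhere, so norms and energy can be computed from the limit \<open>G\<close>.\<close>

lemma approximates_weak_gradient_AE:
  assumes "n \<ge> 1" "approximates n u \<phi> G"
  shows "AE x in lborel. weak_gradient \<phi> x = G x" "weak_gradient \<phi> \<in> borel_measurable borel"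
proof -
  have G: "has_weak_gradient \<phi> G" by (rule approximates_weak_gradient[OF assms])
  then have w: "has_weak_gradient \<phi> (weak_gradient \<phi>)" unfolding weak_gradient_def by (rule someI[of "has_weak_gradient \<phi>"])
  show "AE x in lborel. weak_gradient \<phi> x = G x" by (rule weak_gradient_unique[OF w G])
  show "weak_gradient \<phi> \<in> borel_measurable borel" using w by (simp add: has_weak_gradient_def)
qed

lemma approximates_Lp_norm:
  assumes "n \<ge> 1" "approximates n u \<phi> G"
  shows "Lp_norm p (weak_gradient \<phi>) = Lp_norm p G"
proof -
  note w = approximates_weak_gradient_AE[OF assms]
  have [measurable]: "G \<in> borel_measurable borel" by (rule in_modular_measurable[OF approximatesD(3)[OF assms(2)]])
  have "(LINT x|lborel. norm (weak_gradient \<phi> x) ^ p) = (LINT x|lborel. norm (G x) ^ p)"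
  proof (rule integral_cong_AE)
    show "AE x in lborel. norm (weak_gradient \<phi> x) ^ p = norm (G x) ^ p" using w(1) by (rule AE_mp) simp
  qed (use w(2) in measurable)
  then show ?thesis by (simp add: Lp_norm_def)
qed

definition energy :: "nat \<Rightarrow> ('a::euclidean_space \<Rightarrow> real) \<Rightarrow> real" where
  "energy n \<phi> = (\<Sum>h=1..n. alpha h / (2 * real h) * Lp_norm (2 * h) (weak_gradient \<phi>) ^ (2 * h))"

lemma I_functional_eq: "I_functional n \<rho> \<phi> = energy n \<phi> - pairing \<rho> \<phi>"
  by (simp add: I_functional_def energy_def)

lemma approximates_energy:
  assumes "n \<ge> 1" "approximates n u \<phi> G"
  shows "energy n \<phi> = modular n G"
  unfolding energy_def modular_eq_sum[OF approximatesD(3)[OF assms(2)]] approximates_Lp_norm[OF assms]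
  by (intro sum.cong refl) (simp add: Lp_norm_power)

section \<open>The function space for exponents with 2 < N < 2 n\<close>

locale sobolev_exponent =
  fixes n :: nat and type :: "'a::euclidean_space itself"
  assumes dim: "2 < DIM('a)" and exponent: "DIM('a) < 2 * n"
begin

lemma n_pos: "1 \<le> n"
  using dim exponent by simp

lemma test_sup_bound_unit:
  "\<exists>C>0. \<forall>(u :: 'a \<Rightarrow> real) x. u \<in> test_functions \<longrightarrow> modular n (gradient u) \<le> 1 \<longrightarrow> \<bar>u x\<bar> \<le> C"
proof -
  define K where "K h = 2 * real h / alpha h" for h
  have K: "K h > 0" if "h \<ge> 1" for h using that alpha_pos[of h] by (simp add: K_def)
  obtain C where C: "C > 0" "\<And>(u :: 'a \<Rightarrow> real) x. u \<in> test_functions \<Longrightarrow>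
    (\<integral>\<^sup>+y. ennreal ((norm (gradient u y))\<^sup>2) \<partial>lborel) \<le> ennreal (max (K 1) (K n)) \<Longrightarrow>
    (\<integral>\<^sup>+y. ennreal (norm (gradient u y) ^ (2 * n)) \<partial>lborel) \<le> ennreal (max (K 1) (K n)) \<Longrightarrow> \<bar>u x\<bar> \<le> C"
    using test_function_sup_bound[OF dim exponent] by blast
  have "\<bar>u x\<bar> \<le> C" if u: "u \<in> test_functions" "modular n (gradient u) \<le> 1" for u :: "'a \<Rightarrow> real" and x
  proof -
    have b: "(\<integral>\<^sup>+y. ennreal (norm (gradient u y) ^ (2 * h)) \<partial>lborel) \<le> ennreal (K h)" if h: "1 \<le> h" "h \<le> n" for h
    proof -
      have "(\<integral>\<^sup>+y. ennreal (norm (gradient u y) ^ (2 * h)) \<partial>lborel) = ennreal (LINT y|lborel. norm (gradient u y) ^ (2 * h))"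
        by (intro nn_integral_eq_integral integrable_norm_power[OF in_modular_gradient[OF u(1)] h]) auto
      also have "\<dots> \<le> ennreal (K h * modular n (gradient u))"
        using integral_norm_power_le[OF in_modular_gradient[OF u(1)] h] by (intro ennreal_leI) (simp add: K_def)
      also have "\<dots> \<le> ennreal (K h)" using u(2) K[OF h(1)] by (intro ennreal_leI) simp
      finally show ?thesis .
    qed
    show ?thesis
    proof (rule C(2)[OF u(1)])
      show "(\<integral>\<^sup>+y. ennreal ((norm (gradient u y))\<^sup>2) \<partial>lborel) \<le> ennreal (max (K 1) (K n))"
        using order.trans[OF b[of 1] ennreal_leI[of "K 1" "max (K 1) (K n)"]] n_pos by simp
      show "(\<integral>\<^sup>+y. ennreal (norm (gradient u y) ^ (2 * n)) \<partial>lborel) \<le> ennreal (max (K 1) (K n))"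
        using order.trans[OF b[of n] ennreal_leI[of "K n" "max (K 1) (K n)"]] n_pos by simp
    qed
  qed
  with C(1) show ?thesis by blast
qed

text \<open>Fixed once by choice, so that one constant, depending on \<open>n\<close> and the
  underlying space only, runs through all estimates.\<close>

definition sup_const :: real where
  "sup_const = (SOME C. C > 0 \<and> (\<forall>(u :: 'a \<Rightarrow> real) x. u \<in> test_functions \<longrightarrow>
     modular n (gradient u) \<le> 1 \<longrightarrow> \<bar>u x\<bar> \<le> C))"

lemma sup_const: "sup_const > 0"
  "u \<in> test_functions \<Longrightarrow> modular n (gradient u) \<le> 1 \<Longrightarrow> \<bar>u (x::'a)\<bar> \<le> sup_const"
  using someI_ex[OF test_sup_bound_unit] unfolding sup_const_def[symmetric] by blast+

text \<open>The function u/s has modular at most 1. Dividing by \<open>s\<close> costs (1/s)^(2n)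
  when s \<le> 1 and gains (1/s)^2 otherwise, whence the minimum of the two powers.\<close>

lemma test_sup_bound:
  fixes u :: "'a \<Rightarrow> real"
  assumes u: "u \<in> test_functions" and s: "s > 0" "modular n (gradient u) \<le> min (s\<^sup>2) (s ^ (2 * n))"
  shows "\<bar>u x\<bar> \<le> sup_const * s"
proof -
  have im: "in_modular n (gradient u)" by (rule in_modular_gradient[OF u])
  have "modular n (gradient (\<lambda>x. 1 / s * u x)) = modular n (\<lambda>x. (1 / s) *\<^sub>R gradient u x)"
    unfolding modular_def by (simp only: gradient_cmult[OF u])
  also have "\<dots> \<le> 1"
  proof (cases "s \<le> 1")
    case True
    have "modular n (\<lambda>x. (1 / s) *\<^sub>R gradient u x) \<le> (1 / s) ^ (2 * n) * modular n (gradient u)"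
      using True s by (intro modular_scale_ge im) auto
    also have "\<dots> \<le> (1 / s) ^ (2 * n) * s ^ (2 * n)" using s by (intro mult_left_mono) auto
    also have "\<dots> = 1" using s by (simp add: power_divide)
    finally show ?thesis .
  next
    case False
    have "modular n (\<lambda>x. (1 / s) *\<^sub>R gradient u x) \<le> (1 / s)\<^sup>2 * modular n (gradient u)"
      using False s by (intro modular_scale_le im) auto
    also have "\<dots> \<le> (1 / s)\<^sup>2 * s\<^sup>2" using s by (intro mult_left_mono) auto
    also have "\<dots> = 1" using s by (simp add: power_divide)
    finally show ?thesis .
  qed
  finally have "\<bar>1 / s * u x\<bar> \<le> sup_const" by (rule sup_const(2)[OF test_functions_cmult[OF u]])
  then show ?thesis using s by (simp add: abs_mult field_simps)
qed

abbreviation X :: "('a \<Rightarrow> real) set" where "X \<equiv> X_space n"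

lemma X_iff: "\<phi> \<in> X \<longleftrightarrow> (\<exists>u G. approximates n u \<phi> G)"
  by (rule X_space_iff[OF n_pos])

lemmas appr_energy = approximates_energy[OF n_pos]

text \<open>The energy bound is strict so that the approximating test functions, whose modulars
  converge to the energy, eventually satisfy it as well.\<close>

lemma X_sup_bound:
  assumes \<phi>: "\<phi> \<in> X" and s: "s > 0" "energy n \<phi> < min (s\<^sup>2) (s ^ (2 * n))"
  shows "\<bar>\<phi> x\<bar> \<le> sup_const * s"
proof -
  obtain u G where a: "approximates n u \<phi> G" using \<phi> X_iff by blast
  note u = approximatesD[OF a]
  have "(\<lambda>k. modular n (gradient (u k))) \<longlonglongrightarrow> modular n G"
    by (intro modular_tendsto in_modular_gradient u)
  then have "\<forall>\<^sub>F k in sequentially. modular n (gradient (u k)) < min (s\<^sup>2) (s ^ (2 * n))"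
    using s(2) unfolding appr_energy[OF a] by (rule order_tendstoD)
  then have "\<forall>\<^sub>F k in sequentially. \<bar>u k x\<bar> \<le> sup_const * s"
    by (rule eventually_mono) (intro test_sup_bound u s, simp)
  moreover have "(\<lambda>k. \<bar>u k x\<bar>) \<longlonglongrightarrow> \<bar>\<phi> x\<bar>"
    by (intro tendsto_rabs tendsto_uniform_limitI[OF u(2)]) simp
  ultimately show ?thesis by (intro tendsto_upperbound) auto
qed

text \<open>The sup bound applied to differences makes a modularly Cauchy sequence uniformly Cauchy.
  A minimising sequence obtains its limit function in this way.\<close>

lemma test_complete:
  fixes u :: "nat \<Rightarrow> 'a \<Rightarrow> real"
  assumes u: "\<And>k. u k \<in> test_functions"
    and Cauchy: "\<And>e. e > 0 \<Longrightarrow> \<exists>M. \<forall>j\<ge>M. \<forall>k\<ge>M. modular n (\<lambda>x. gradient (u j) x - gradient (u k) x) < e"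
  obtains \<phi> G where "approximates n u \<phi> G"
proof -
  obtain G where G: "in_modular n G" "(\<lambda>k. modular n (\<lambda>x. gradient (u k) x - G x)) \<longlonglongrightarrow> 0"
    using modular_complete[OF n_pos, of "\<lambda>k. gradient (u k)"] Cauchy in_modular_gradient[OF u] by blast
  have "uniformly_Cauchy_on UNIV u"
  proof (rule uniformly_Cauchy_onI)
    fix e :: real assume e: "e > 0"
    define s where "s = e / (2 * sup_const)"
    have s: "s > 0" using e sup_const(1) by (simp add: s_def)
    then have "min (s\<^sup>2) (s ^ (2 * n)) > 0" by simp
    from Cauchy[OF this] obtain M where M: "\<And>j k. j \<ge> M \<Longrightarrow> k \<ge> M \<Longrightarrow>
        modular n (\<lambda>x. gradient (u j) x - gradient (u k) x) < min (s\<^sup>2) (s ^ (2 * n))" by blast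
    have "dist (u j x) (u k x) < e" if "j \<ge> M" "k \<ge> M" for x j k
    proof -
      have "\<bar>u j x - u k x\<bar> \<le> sup_const * s"
        using M[OF that] s
        by (intro test_sup_bound[of "\<lambda>x. u j x - u k x"] test_functions_diff u) (auto simp: gradient_diff_fun u)
      also have "\<dots> < e" using sup_const(1) e by (simp add: s_def)
      finally show ?thesis by (simp add: dist_real_def)
    qed
    then show "\<exists>M. \<forall>x\<in>UNIV. \<forall>m\<ge>M. \<forall>k\<ge>M. dist (u m x) (u k x) < e" by blast
  qed
  then have "uniformly_convergent_on UNIV u" by (rule Cauchy_uniformly_convergent)
  then obtain \<phi> where "uniform_limit UNIV u \<phi> sequentially" by (auto simp: uniformly_convergent_on_def)
  then show thesis using u G that unfolding approximates_def by blast
qed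

lemma X_add: "\<phi> \<in> X \<Longrightarrow> \<psi> \<in> X \<Longrightarrow> (\<lambda>x. \<phi> x + \<psi> x) \<in> X"
  unfolding X_iff by (blast intro: approximates_add)

lemma X_scale: "\<phi> \<in> X \<Longrightarrow> (\<lambda>x. c * \<phi> x) \<in> X"
  unfolding X_iff by (blast intro: approximates_scale)

lemma X_diff: "\<phi> \<in> X \<Longrightarrow> \<psi> \<in> X \<Longrightarrow> (\<lambda>x. \<phi> x - \<psi> x) \<in> X"
  unfolding X_iff by (blast intro: approximates_diff)

lemma X_test: "u \<in> test_functions \<Longrightarrow> u \<in> X"
  unfolding X_iff by (blast intro: approximates_test)

lemma X_continuous: "\<phi> \<in> X \<Longrightarrow> continuous_on UNIV \<phi>"
  unfolding X_iff by (blast intro: approximates_continuous)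

lemma X_bounded: "\<phi> \<in> X \<Longrightarrow> \<exists>B>0. \<forall>x. \<bar>\<phi> x\<bar> \<le> B"
proof -
  assume "\<phi> \<in> X"
  then obtain u G where "approximates n u \<phi> G" unfolding X_iff by blast
  then show ?thesis
  proof (rule approximates_bounded)
    fix B :: real assume "B > 0" "\<And>x. \<bar>\<phi> x\<bar> \<le> B"
    then show ?thesis by blast
  qed
qed

lemma energy_nonneg: "\<phi> \<in> X \<Longrightarrow> 0 \<le> energy n \<phi>"
proof -
  assume "\<phi> \<in> X"
  then obtain u G where "approximates n u \<phi> G" unfolding X_iff by blast
  from appr_energy[OF this] show ?thesis by (simp add: modular_nonneg)
qed

lemma energy_test: "u \<in> test_functions \<Longrightarrow> energy n (u :: 'a \<Rightarrow> real) = modular n (gradient u)"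
  by (rule appr_energy[OF approximates_test])

lemma energy_Clarkson:
  assumes "\<phi> \<in> X" "\<psi> \<in> X"
  shows "energy n (\<lambda>x. 1/2 * (\<phi> x + \<psi> x)) + energy n (\<lambda>x. 1/2 * (\<phi> x - \<psi> x))
    \<le> (energy n \<phi> + energy n \<psi>) / 2"
proof -
  obtain u G v H where a: "approximates n u \<phi> G" "approximates n v \<psi> H" using assms unfolding X_iff by blast
  show ?thesis
    unfolding appr_energy[OF a(1)] appr_energy[OF a(2)]
      appr_energy[OF approximates_scale[OF approximates_add[OF a]]]
      appr_energy[OF approximates_scale[OF approximates_diff[OF a]]]
    by (intro modular_Clarkson approximatesD(3)[OF a(1)] approximatesD(3)[OF a(2)])
qed

lemma energy_scale:
  assumes "\<phi> \<in> X"
  shows "energy n (\<lambda>x. t * \<phi> x) =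
    (\<Sum>h=1..n. alpha h / (2 * real h) * (t ^ (2 * h) * Lp_norm (2 * h) (weak_gradient \<phi>) ^ (2 * h)))"
proof -
  obtain u G where a: "approximates n u \<phi> G" using assms unfolding X_iff by blast
  have im: "in_modular n G" by (rule approximatesD(3)[OF a])
  show ?thesis
    unfolding appr_energy[OF approximates_scale[OF a]] modular_eq_sum[OF in_modular_scale[OF im]]
      approximates_Lp_norm[OF n_pos a]
  proof (intro sum.cong refl)
    fix h assume "h \<in> {1..n}"
    have "norm (t *\<^sub>R G x) ^ (2 * h) = t ^ (2 * h) * norm (G x) ^ (2 * h)" for x
      by (simp add: power_mult_distrib power_even_abs)
    then show "alpha h / (2 * real h) * (LINT x|lborel. norm (t *\<^sub>R G x) ^ (2 * h)) =
        alpha h / (2 * real h) * (t ^ (2 * h) * Lp_norm (2 * h) G ^ (2 * h))"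
      using \<open>h \<in> {1..n}\<close> by (simp add: Lp_norm_power)
  qed
qed

text \<open>Differentiability of the energy in the only form needed later: the symmetric second
  difference is o(h). Dominated convergence applies with the second difference at step 1 as
  majorant.\<close>

lemma energy_double_difference:
  assumes "\<phi> \<in> X" "\<psi> \<in> X"
  shows "(\<lambda>k. (energy n (\<lambda>x. \<phi> x + inverse (real (Suc k)) * \<psi> x)
      + energy n (\<lambda>x. \<phi> x - inverse (real (Suc k)) * \<psi> x) - 2 * energy n \<phi>)
      / inverse (real (Suc k))) \<longlonglongrightarrow> 0"
proof -
  obtain u G v H where a: "approximates n u \<phi> G" "approximates n v \<psi> H" using assms unfolding X_iff by blast
  have G: "in_modular n G" and H: "in_modular n H" using a approximatesD(3) by blast+
  note [measurable] = in_modular_measurable[OF G] in_modular_measurable[OF H]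
  define h where "h k = inverse (real (Suc k))" for k
  have h: "h k > 0" "h k \<le> 1" for k by (auto simp: h_def field_simps)
  define q where "q t x = modular_density n (G x + t *\<^sub>R H x) + modular_density n (G x - t *\<^sub>R H x)
    - 2 * modular_density n (G x)" for t x
  have i: "integrable lborel (\<lambda>x. modular_density n (G x + t *\<^sub>R H x))"
    "integrable lborel (\<lambda>x. modular_density n (G x - t *\<^sub>R H x))" "integrable lborel (\<lambda>x. modular_density n (G x))" for t
    by (intro in_modular_integrable in_modular_add in_modular_diff in_modular_scale G H)+
  have iq: "integrable lborel (q t)" for t unfolding q_def[abs_def] using i by auto
  have "(\<lambda>k. LINT x|lborel. q (h k) x / h k) \<longlonglongrightarrow> (LINT x|(lborel :: 'a measure). (0::real))"
  proof (rule integral_dominated_convergence[where w = "q 1"])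
    show "AE x in lborel. (\<lambda>k. q (h k) x / h k) \<longlonglongrightarrow> 0"
    proof (rule AE_I2)
      fix x
      have "filterlim h (at 0) sequentially"
        unfolding filterlim_at using h(1) less_imp_neq[OF h(1)] LIMSEQ_inverse_real_of_nat
        by (auto simp: h_def[abs_def])
      then show "(\<lambda>k. q (h k) x / h k) \<longlonglongrightarrow> 0"
        unfolding q_def using filterlim_compose[OF modular_density_second_difference_tendsto[of n "G x" "H x"]]
        by blast
    qed
    show "AE x in lborel. norm (q (h k) x / h k) \<le> q 1 x" for k
    proof (rule AE_I2)
      fix x
      have "0 \<le> q (h k) x" unfolding q_def by (rule modular_density_second_difference_nonneg)
      moreover have "q (h k) x \<le> h k * q 1 x"
        unfolding q_def using modular_density_second_difference_le[of "h k" n "G x" "H x"] h[of k] by simp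
      ultimately show "norm (q (h k) x / h k) \<le> q 1 x" using h(1)[of k] by (simp add: field_simps)
    qed
  qed (use iq in \<open>auto intro: borel_measurable_integrable\<close>)
  moreover have "(LINT x|lborel. q (h k) x / h k) =
    (energy n (\<lambda>x. \<phi> x + h k * \<psi> x) + energy n (\<lambda>x. \<phi> x - h k * \<psi> x) - 2 * energy n \<phi>) / h k" for k
    unfolding appr_energy[OF approximates_add[OF a(1) approximates_scale[OF a(2)]]]
      appr_energy[OF approximates_diff[OF a(1) approximates_scale[OF a(2)]]] appr_energy[OF a(1)]
      modular_def q_def using i by simp
  ultimately show ?thesis unfolding h_def by simp
qed

text \<open>The common core of both truncations, which multiply gradients by factors between 0 and
  1. The factors depend on the approximant, hence their pointwise limit \<open>m'\<close> and a
  dominated convergence argument to see that \<open>m' G\<close> is the limit gradient.\<close>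

lemma approximates_contract:
  assumes a: "approximates n u \<phi> G" and v: "\<And>k. v k \<in> test_functions"
    and m: "\<And>k. m k \<in> borel_measurable borel" "\<And>k x. 0 \<le> m k x" "\<And>k x. m k x \<le> (1::real)"
    and grad: "\<And>k x. gradient (v k) x = m k x *\<^sub>R gradient (u k) x"
    and lim: "\<And>x. (\<lambda>k. m k x) \<longlonglongrightarrow> m' x" and unif: "uniform_limit UNIV v \<psi> sequentially"
  shows "\<psi> \<in> X" "energy n \<psi> \<le> energy n \<phi>"
proof -
  note u = approximatesD[OF a]
  note [measurable] = in_modular_measurable[OF u(3)] m(1)
  have [measurable]: "m' \<in> borel_measurable borel" using borel_measurable_LIMSEQ_real[OF lim m(1)] .
  have m': "0 \<le> m' x" "m' x \<le> 1" for x
    using LIMSEQ_le_const[OF lim] LIMSEQ_le_const2[OF lim] m(2,3) by blast+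
  have bd: "\<bar>m k x - m' x\<bar> \<le> 1" "\<bar>m k x\<bar> \<le> 1" "\<bar>m' x\<bar> \<le> 1" for k x
    using m(2)[of k x] m(3)[of k x] m'[of x] by auto
  have im: "in_modular n (\<lambda>x. m' x *\<^sub>R G x)" by (rule in_modular_mult[OF u(3) _ bd(3)]) measurable
  have "(\<lambda>k. LINT x|lborel. modular_density n ((m k x - m' x) *\<^sub>R G x)) \<longlonglongrightarrow> (LINT x|(lborel :: 'a measure). (0::real))"
  proof (rule integral_dominated_convergence[where w = "\<lambda>x. modular_density n (G x)"])
    show "AE x in lborel. (\<lambda>k. modular_density n ((m k x - m' x) *\<^sub>R G x)) \<longlonglongrightarrow> 0"
    proof (rule AE_I2)
      fix x
      have "(\<lambda>k. (m k x - m' x) *\<^sub>R G x) \<longlonglongrightarrow> (m' x - m' x) *\<^sub>R G x" by (intro tendsto_intros lim)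
      then have "(\<lambda>k. modular_density n ((m k x - m' x) *\<^sub>R G x)) \<longlonglongrightarrow> modular_density n ((m' x - m' x) *\<^sub>R G x)"
        by (rule continuous_on_tendsto_compose[OF continuous_on_modular_density[of UNIV]]) auto
      then show "(\<lambda>k. modular_density n ((m k x - m' x) *\<^sub>R G x)) \<longlonglongrightarrow> 0" by (simp add: modular_density_zero)
    qed
    show "AE x in lborel. norm (modular_density n ((m k x - m' x) *\<^sub>R G x)) \<le> modular_density n (G x)" for k
    proof (rule AE_I2)
      fix x
      have "norm ((m k x - m' x) *\<^sub>R G x) \<le> norm (G x)"
        using bd(1)[of k x] by (simp add: mult_left_le_one_le)
      from modular_density_mono[OF this, of n]
      show "norm (modular_density n ((m k x - m' x) *\<^sub>R G x)) \<le> modular_density n (G x)"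
        using modular_density_nonneg[of n "(m k x - m' x) *\<^sub>R G x"] by simp
    qed
  qed (use in_modular_integrable[OF u(3)] in auto)
  then have z: "(\<lambda>k. modular n (\<lambda>x. (m k x - m' x) *\<^sub>R G x)) \<longlonglongrightarrow> 0" by (simp add: modular_def)
  have "approximates n v \<psi> (\<lambda>x. m' x *\<^sub>R G x)"
    unfolding approximates_def
  proof (intro conjI allI v unif im)
    show "(\<lambda>k. modular n (\<lambda>x. gradient (v k) x - m' x *\<^sub>R G x)) \<longlonglongrightarrow> 0"
    proof (rule real_tendsto_sandwich[OF _ _ tendsto_const])
      have "modular n (\<lambda>x. gradient (v k) x - m' x *\<^sub>R G x) \<le>
          4 ^ n * (modular n (\<lambda>x. gradient (u k) x - G x) + modular n (\<lambda>x. (m k x - m' x) *\<^sub>R G x))" for k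
      proof -
        have d: "in_modular n (\<lambda>x. gradient (u k) x - G x)"
          by (intro in_modular_diff in_modular_gradient u)
        note [measurable] = in_modular_measurable[OF d]
        have d1: "in_modular n (\<lambda>x. m k x *\<^sub>R (gradient (u k) x - G x))" by (rule in_modular_mult[OF d _ bd(2)]) measurable
        have d2: "in_modular n (\<lambda>x. (m k x - m' x) *\<^sub>R G x)" by (rule in_modular_mult[OF u(3) _ bd(1)]) measurable
        \<comment> \<open>The first summand is small because |m k| \<le> 1 contracts the gradient
          error, the second by dominated convergence.\<close>
        have "gradient (v k) x - m' x *\<^sub>R G x = m k x *\<^sub>R (gradient (u k) x - G x) + (m k x - m' x) *\<^sub>R G x" for x
          by (simp add: grad algebra_simps)
        then have "modular n (\<lambda>x. gradient (v k) x - m' x *\<^sub>R G x) \<le>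
          4 ^ n * (modular n (\<lambda>x. m k x *\<^sub>R (gradient (u k) x - G x)) + modular n (\<lambda>x. (m k x - m' x) *\<^sub>R G x))"
          using modular_add_le_4[OF d1 d2] by simp
        moreover have "modular n (\<lambda>x. m k x *\<^sub>R (gradient (u k) x - G x)) \<le> modular n (\<lambda>x. gradient (u k) x - G x)"
          using bd(2) in_modular_measurable[OF d1] by (intro modular_mono d) (auto simp: mult_left_le_one_le)
        ultimately show ?thesis by (smt (verit) mult_left_mono zero_le_power)
      qed
      then show "\<forall>\<^sub>F k in sequentially. modular n (\<lambda>x. gradient (v k) x - m' x *\<^sub>R G x) \<le>
          4 ^ n * (modular n (\<lambda>x. gradient (u k) x - G x) + modular n (\<lambda>x. (m k x - m' x) *\<^sub>R G x))" by simp
      show "(\<lambda>k. 4 ^ n * (modular n (\<lambda>x. gradient (u k) x - G x) + modular n (\<lambda>x. (m k x - m' x) *\<^sub>R G x))) \<longlonglongrightarrow> 0"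
        by (auto intro!: tendsto_eq_intros u z)
    qed (simp add: modular_nonneg)
  qed
  then show "\<psi> \<in> X" "energy n \<psi> \<le> energy n \<phi>"
    using X_iff appr_energy[OF a] appr_energy[of v \<psi>] modular_mono[OF u(3) in_modular_measurable[OF im], of] bd(3)
    by (auto simp: mult_left_le_one_le)
qed

end

section \<open>Truncation, mixtures and minimisers\<close>

text \<open>A smooth substitute for the positive part, so that truncating a test function gives a test
  function; the factor 1/4 keeps the derivative below 1.\<close>

definition ramp :: "real \<Rightarrow> real" where
  "ramp = flat [:1/4:]"

definition ramp_deriv :: "real \<Rightarrow> real" where
  "ramp_deriv = flat (flat_step [:1/4:])"

lemma DERIV_ramp: "(ramp has_real_derivative ramp_deriv t) (at t)"
  unfolding ramp_def ramp_deriv_def by (rule DERIV_flat)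

lemma ramp_eq_0_iff: "ramp t = 0 \<longleftrightarrow> t \<le> 0"
  by (simp add: ramp_def flat_def)

lemma ramp_deriv_eq: "ramp_deriv t = (if t > 0 then (inverse t)\<^sup>2 / 4 * exp (- inverse t) else 0)"
  by (simp add: ramp_deriv_def flat_def flat_step_def poly_monom)

text \<open>With x = 1/t the derivative is (x/2)^2 exp(-x), and x/2 \<le> exp(x/2).\<close>

lemma ramp_deriv_bounds: "0 \<le> ramp_deriv t" "ramp_deriv t \<le> 1"
proof -
  show "0 \<le> ramp_deriv t" by (simp add: ramp_deriv_eq)
  show "ramp_deriv t \<le> 1"
  proof (cases "t > 0")
    case True
    define x where "x = inverse t"
    have x: "x > 0" using True by (simp add: x_def)
    have "x\<^sup>2 / 4 = (x / 2)\<^sup>2" by (simp add: power2_eq_square)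
    also have "\<dots> \<le> (exp (x / 2))\<^sup>2"
      using exp_ge_add_one_self[of "x / 2"] x by (intro power_mono) linarith+
    also have "\<dots> = exp x" by (simp add: power2_eq_square exp_add[symmetric])
    finally have "x\<^sup>2 / 4 * exp (- x) \<le> exp x * exp (- x)" by (intro mult_right_mono) auto
    then show ?thesis using True by (simp add: ramp_deriv_eq x_def exp_add[symmetric])
  qed (simp add: ramp_deriv_eq)
qed

lemma continuous_on_ramp_deriv: "continuous_on A ramp_deriv"
  unfolding ramp_deriv_def by (rule continuous_on_flat)

lemma ramp_lipschitz: "\<bar>ramp s - ramp t\<bar> \<le> \<bar>s - t\<bar>"
proof -
  have *: "\<bar>ramp b - ramp a\<bar> \<le> \<bar>b - a\<bar>" if ab: "a < b" for a b
  proof -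
    obtain z where "ramp b - ramp a = (b - a) * ramp_deriv z"
      using MVT2[OF ab, of ramp ramp_deriv] DERIV_ramp by blast
    then show ?thesis using ramp_deriv_bounds[of z] ab by (simp add: abs_mult mult_left_le)
  qed
  show ?thesis using *[of s t] *[of t s] by (cases s t rule: linorder_cases) (auto simp: abs_minus_commute)
qed

lemma uniform_limit_ramp:
  assumes "uniform_limit S f l F"
  shows "uniform_limit S (\<lambda>k x. ramp (f k x)) (\<lambda>x. ramp (l x)) F"
proof (rule uniform_limitI)
  fix e :: real assume "e > 0"
  from uniform_limitD[OF assms this] show "\<forall>\<^sub>F k in F. \<forall>x\<in>S. dist (ramp (f k x)) (ramp (l x)) < e"
    by (rule eventually_mono) (auto simp: dist_real_def intro: le_less_trans[OF ramp_lipschitz])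
qed

lemma times_cont_diff_ramp: "times_cont_diff k u \<Longrightarrow> times_cont_diff k (\<lambda>x. ramp (u x))"
  unfolding ramp_def by (rule times_cont_diff_flat)

lemma GDERIV_ramp:
  assumes "GDERIV u x :> D"
  shows "GDERIV (\<lambda>x. ramp (u x)) x :> ramp_deriv (u x) *\<^sub>R D"
  by (rule GDERIV_DERIV_compose[OF assms DERIV_ramp])

section \<open>Probability measures, pairings and mixtures\<close>

definition borel_prob :: "'a::euclidean_space measure \<Rightarrow> bool" where
  "borel_prob \<rho> \<longleftrightarrow> prob_space \<rho> \<and> sets \<rho> = sets borel"

lemma borel_prob_integrable:
  fixes f :: "'a::euclidean_space \<Rightarrow> real"
  assumes "borel_prob \<rho>" "continuous_on UNIV f" "\<And>x. \<bar>f x\<bar> \<le> B"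
  shows "integrable \<rho> f"
proof -
  interpret prob_space \<rho> using assms(1) by (simp add: borel_prob_def)
  have "f \<in> borel_measurable borel" by (rule borel_measurable_continuous_onI[OF assms(2)])
  moreover have "sets \<rho> = sets borel" using assms(1) by (simp add: borel_prob_def)
  then have "borel_measurable \<rho> = (borel_measurable borel :: ('a \<Rightarrow> real) set)"
    by (rule measurable_cong_sets) (rule refl)
  ultimately have "f \<in> borel_measurable \<rho>" by blast
  then show ?thesis using assms(3) by (intro integrable_const_bound[of _ B]) auto
qed

lemma pairing_abs_le:
  fixes f :: "'a::euclidean_space \<Rightarrow> real"
  assumes "borel_prob \<rho>" "continuous_on UNIV f" "\<And>x. \<bar>f x\<bar> \<le> B"
  shows "\<bar>pairing \<rho> f\<bar> \<le> B"
proof -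
  interpret prob_space \<rho> using assms(1) by (simp add: borel_prob_def)
  have "norm (LINT x|\<rho>. f x) \<le> (LINT x|\<rho>. B)"
    using assms(3) by (intro Bochner_Integration.integral_norm_bound_integral borel_prob_integrable[OF assms]) auto
  then show ?thesis by (simp add: pairing_def prob_space)
qed

text \<open>A two-stage experiment whose Bernoulli draw picks \<open>\<mu>\<close> with probability
  t. In this form total mass and measurability come from the bind of the probability monad.\<close>

definition mixture :: "real \<Rightarrow> 'a measure \<Rightarrow> 'a measure \<Rightarrow> 'a measure" where
  "mixture t \<rho> \<mu> = measure_pmf (bernoulli_pmf t) \<bind> (\<lambda>b. if b then \<mu> else \<rho>)"

context
  fixes \<rho> \<mu> :: "'a::euclidean_space measure" and t :: real
  assumes pm: "borel_prob \<rho>" "borel_prob \<mu>" and t: "0 \<le> t" "t \<le> 1"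
begin

lemma mixture_kernel:
  "(\<lambda>b. if b then \<mu> else \<rho>) \<in> measurable (measure_pmf (bernoulli_pmf t)) (subprob_algebra borel)"
  using pm by (auto simp: borel_prob_def space_subprob_algebra prob_space_imp_subprob_space)

lemma borel_prob_mixture: "borel_prob (mixture t \<rho> \<mu>)"
  unfolding borel_prob_def mixture_def
proof
  show "prob_space (measure_pmf (bernoulli_pmf t) \<bind> (\<lambda>b. if b then \<mu> else \<rho>))"
    using pm by (intro prob_space.prob_space_bind[OF prob_space_measure_pmf _ mixture_kernel])
      (auto simp: borel_prob_def)
  show "sets (measure_pmf (bernoulli_pmf t) \<bind> (\<lambda>b. if b then \<mu> else \<rho>)) = sets borel"
    using pm by (intro sets_bind) (auto simp: borel_prob_def)
qed

lemma nn_integral_mixture: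
  assumes "f \<in> borel_measurable borel"
  shows "(\<integral>\<^sup>+x. f x \<partial>mixture t \<rho> \<mu>) = ennreal t * (\<integral>\<^sup>+x. f x \<partial>\<mu>) + ennreal (1 - t) * (\<integral>\<^sup>+x. f x \<partial>\<rho>)"
  unfolding mixture_def nn_integral_bind[OF assms mixture_kernel]
  using t by (simp add: nn_integral_bernoulli_pmf mult.commute)

lemma pairing_mixture:
  assumes f: "continuous_on UNIV f" "\<And>x. \<bar>f x\<bar> \<le> B"
  shows "pairing (mixture t \<rho> \<mu>) f = t * pairing \<mu> f + (1 - t) * pairing \<rho> f"
proof -
  \<comment> \<open>Shifting by the bound makes the integrand nonnegative, so the formula for
    nonnegative integrals applies; the shift cancels because all masses are 1.\<close>
  define g where "g x = f x + B" for x
  have g0: "0 \<le> g x" for x using f(2)[of x] by (simp add: g_def)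
  have gc: "continuous_on UNIV g" unfolding g_def[abs_def] by (intro continuous_intros f(1))
  have gb: "\<bar>g x\<bar> \<le> 2 * B" for x using f(2)[of x] by (simp add: g_def)
  have nn: "(\<integral>\<^sup>+x. ennreal (g x) \<partial>\<sigma>) = ennreal (pairing \<sigma> f + B)" if s: "borel_prob \<sigma>" for \<sigma>
  proof -
    interpret prob_space \<sigma> using s by (simp add: borel_prob_def)
    have "(LINT x|\<sigma>. g x) = pairing \<sigma> f + B"
      unfolding g_def pairing_def using borel_prob_integrable[OF s f] by (simp add: prob_space)
    then show ?thesis using nn_integral_eq_integral[OF borel_prob_integrable[OF s gc gb]] g0 by simp
  qed
  have pB: "0 \<le> pairing \<sigma> f + B" if "borel_prob \<sigma>" for \<sigma>
    using pairing_abs_le[OF that f] by linarith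
  have "ennreal (pairing (mixture t \<rho> \<mu>) f + B) =
      ennreal t * ennreal (pairing \<mu> f + B) + ennreal (1 - t) * ennreal (pairing \<rho> f + B)"
    unfolding nn[OF borel_prob_mixture, symmetric] nn[OF pm(1), symmetric] nn[OF pm(2), symmetric]
    using borel_measurable_continuous_onI[OF gc] by (intro nn_integral_mixture) measurable
  also have "\<dots> = ennreal (t * (pairing \<mu> f + B) + (1 - t) * (pairing \<rho> f + B))"
    using t pB[OF pm(1)] pB[OF pm(2)] by (simp add: ennreal_mult ennreal_plus)
  finally have "ennreal (pairing (mixture t \<rho> \<mu>) f + B) =
      ennreal (t * (pairing \<mu> f + B) + (1 - t) * (pairing \<rho> f + B))" .
  moreover have "0 \<le> t * (pairing \<mu> f + B) + (1 - t) * (pairing \<rho> f + B)"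
    using t pB[OF pm(1)] pB[OF pm(2)] by simp
  ultimately have "pairing (mixture t \<rho> \<mu>) f + B = t * (pairing \<mu> f + B) + (1 - t) * (pairing \<rho> f + B)"
    using pB[OF borel_prob_mixture] by (simp only: ennreal_inj)
  then show ?thesis by (simp add: algebra_simps)
qed

lemma emeasure_mixture_null:
  assumes "A \<in> sets borel" "emeasure \<rho> A = 0" "emeasure \<mu> A = 0"
  shows "emeasure (mixture t \<rho> \<mu>) A = 0"
proof -
  have "emeasure (mixture t \<rho> \<mu>) A = (\<integral>\<^sup>+x. indicator A x \<partial>mixture t \<rho> \<mu>)"
    using assms(1) borel_prob_mixture by (simp add: borel_prob_def)
  then show ?thesis using assms pm by (simp add: nn_integral_mixture borel_prob_def)
qed

end

section \<open>Smooth truncations of elements of the space\<close>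

context sobolev_exponent
begin

text \<open>The map t - ramp(t - c) has derivative in [0, 1], so gradients contract. A level
  \<open>c \<ge> 0\<close> makes it fix 0, so truncated test functions keep compact support.\<close>

lemma X_truncate_above:
  assumes \<phi>: "\<phi> \<in> X" and c: "c \<ge> 0"
  shows "(\<lambda>x. \<phi> x - ramp (\<phi> x - c)) \<in> X" "energy n (\<lambda>x. \<phi> x - ramp (\<phi> x - c)) \<le> energy n \<phi>"
proof -
  obtain u G where a: "approximates n u \<phi> G" using \<phi> X_iff by blast
  note u = approximatesD[OF a]
  define v where "v k x = u k x - ramp (u k x - c)" for k x
  define m where "m k x = 1 - ramp_deriv (u k x - c)" for k x
  have sub: "times_cont_diff j (\<lambda>x. u k x - c)" for j k
    using times_cont_diff_add[OF test_functions_smooth[OF u(1)] times_cont_diff_const, of j k "-c"] by simp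
  have v: "v k \<in> test_functions" for k
  proof -
    obtain R where R: "\<And>x. norm x > R \<Longrightarrow> u k x = 0" using test_functions_support[OF u(1)] by blast
    show ?thesis
    proof (rule test_functionsI)
      show "v k x = 0" if "norm x > R" for x using R[OF that] c ramp_eq_0_iff[of "-c"] by (simp add: v_def)
      have "times_cont_diff j (\<lambda>x. u k x + (-1) * ramp (u k x - c))" for j
        by (intro times_cont_diff_add times_cont_diff_mult times_cont_diff_const times_cont_diff_ramp sub
            test_functions_smooth u)
      then show "times_cont_diff j (v k)" for j unfolding v_def[abs_def] by simp
    qed
  qed
  have grad: "gradient (v k) x = m k x *\<^sub>R gradient (u k) x" for k x
  proof (rule GDERIV_unique)
    have "GDERIV (\<lambda>x. u k x - c) x :> gradient (u k) x"
      using GDERIV_diff[OF test_functions_GDERIV[OF u(1)] GDERIV_const[of c x], of k] by simp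
    from GDERIV_diff[OF test_functions_GDERIV[OF u(1)] GDERIV_ramp[OF this]]
    show "GDERIV (v k) x :> m k x *\<^sub>R gradient (u k) x"
      unfolding v_def[abs_def] m_def by (simp add: scaleR_diff_left)
  qed
  have lim: "(\<lambda>k. m k x) \<longlonglongrightarrow> 1 - ramp_deriv (\<phi> x - c)" for x
    unfolding m_def
    by (intro tendsto_intros continuous_on_tendsto_compose[OF continuous_on_ramp_deriv[of UNIV]]
        tendsto_uniform_limitI[OF u(2)]) auto
  have unif: "uniform_limit UNIV v (\<lambda>x. \<phi> x - ramp (\<phi> x - c)) sequentially"
    unfolding v_def[abs_def] by (intro uniform_limit_minus uniform_limit_ramp uniform_limit_const u)
  have mm: "m k \<in> borel_measurable borel" for k
    unfolding m_def[abs_def]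
    by (intro borel_measurable_continuous_onI continuous_intros
        continuous_on_compose2[OF continuous_on_ramp_deriv[of UNIV]] test_functions_continuous u) auto
  have m01: "0 \<le> m k x" "m k x \<le> 1" for k x using ramp_deriv_bounds by (simp_all add: m_def)
  show "(\<lambda>x. \<phi> x - ramp (\<phi> x - c)) \<in> X" "energy n (\<lambda>x. \<phi> x - ramp (\<phi> x - c)) \<le> energy n \<phi>"
    using approximates_contract[OF a v mm m01 grad lim unif] by blast+
qed

lemma approximates_shift:
  assumes "approximates n u \<phi> G"
  shows "approximates n (\<lambda>k. u (k + K)) \<phi> G"
  unfolding approximates_def
proof (intro conjI allI)
  note u = approximatesD[OF assms]
  show "uniform_limit UNIV (\<lambda>k. u (k + K)) \<phi> sequentially"
    by (rule filterlim_compose[OF u(2) filterlim_add_const_nat_at_top])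
  show "(\<lambda>k. modular n (\<lambda>x. gradient (u (k + K)) x - G x)) \<longlonglongrightarrow> 0"
    using LIMSEQ_ignore_initial_segment[OF u(4)] .
qed (use approximatesD[OF assms] in auto)

text \<open>The strict inequality on the compact frontier passes to late approximants by uniform
  convergence. For these, the part of the closure of \<Omega> where the approximant is at most
  \<open>c\<close> is a closed subset of \<Omega>, so the correction vanishes near the frontier and
  extends smoothly by 0.\<close>

lemma X_truncate_below_inside:
  fixes \<Omega> :: "'a set"
  assumes \<phi>: "\<phi> \<in> X" and \<Omega>: "open \<Omega>" "bounded \<Omega>" and c: "\<And>x. x \<in> frontier \<Omega> \<Longrightarrow> \<phi> x > c"
  shows "(\<lambda>x. \<phi> x + (if x \<in> \<Omega> then ramp (c - \<phi> x) else 0)) \<in> X"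
    "energy n (\<lambda>x. \<phi> x + (if x \<in> \<Omega> then ramp (c - \<phi> x) else 0)) \<le> energy n \<phi>"
proof -
  obtain w G where w: "approximates n w \<phi> G" using \<phi> X_iff by blast
  have "\<exists>K. \<forall>k\<ge>K. \<forall>x\<in>frontier \<Omega>. w k x > c"
  proof (cases "frontier \<Omega> = {}")
    case False
    obtain y where y: "y \<in> frontier \<Omega>" "\<And>x. x \<in> frontier \<Omega> \<Longrightarrow> \<phi> y \<le> \<phi> x"
      using continuous_attains_inf[OF compact_frontier_bounded[OF \<Omega>(2)] False
          continuous_on_subset[OF X_continuous[OF \<phi>]]] by auto
    have "\<forall>\<^sub>F k in sequentially. \<forall>x. dist (w k x) (\<phi> x) < \<phi> y - c"
      using uniform_limitD[OF approximatesD(2)[OF w], of "\<phi> y - c"] c[OF y(1)] by simp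
    then obtain K where K: "\<And>k x. k \<ge> K \<Longrightarrow> dist (w k x) (\<phi> x) < \<phi> y - c"
      by (auto simp: eventually_sequentially)
    have "w k x > c" if "k \<ge> K" "x \<in> frontier \<Omega>" for k x
      using K[OF that(1), of x] y(2)[OF that(2)] by (simp add: dist_real_def)
    then show ?thesis by blast
  qed auto
  then obtain K where K: "\<And>k x. k \<ge> K \<Longrightarrow> x \<in> frontier \<Omega> \<Longrightarrow> w k x > c" by blast
  \<comment> \<open>Dropping the first \<open>K\<close> terms makes every approximant exceed
    \<open>c\<close> on the frontier.\<close>
  define u where "u k = w (k + K)" for k
  have a: "approximates n u \<phi> G" using approximates_shift[OF w] unfolding u_def .
  note u = approximatesD[OF a]
  have uc: "u k x > c" if "x \<in> frontier \<Omega>" for k x using K that by (simp add: u_def)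
  define z where "z k x = (if x \<in> \<Omega> then ramp (c - u k x) else 0)" for k x
  define v where "v k x = u k x + z k x" for k x
  define m where "m k x = 1 - indicator \<Omega> x * ramp_deriv (c - u k x)" for k x
  define Q where "Q k = closure \<Omega> \<inter> {x. u k x \<le> c}" for k
  have cu: "continuous_on UNIV (u k)" for k by (intro test_functions_continuous u)
  have Q: "closed (Q k)" "Q k \<subseteq> \<Omega>" for k
  proof -
    show "closed (Q k)" unfolding Q_def by (intro closed_Int closed_closure closed_Collect_le cu continuous_intros)
    show "Q k \<subseteq> \<Omega>"
    proof
      fix x assume x: "x \<in> Q k"
      then have "x \<notin> frontier \<Omega>" using uc[of x k] by (auto simp: Q_def)
      then show "x \<in> \<Omega>" using x \<Omega>(1) by (auto simp: Q_def frontier_def interior_open)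
    qed
  qed
  have zQ: "z k x = 0" if "x \<notin> Q k" for k x
    using that closure_subset[of \<Omega>] by (auto simp: z_def Q_def ramp_eq_0_iff)
  have sub: "times_cont_diff j (\<lambda>x. c - u k x)" for j k
    using times_cont_diff_add[OF times_cont_diff_const times_cont_diff_mult[OF times_cont_diff_const
        test_functions_smooth[OF u(1)]], of j c "-1" k] by simp
  have z: "z k \<in> test_functions" for k
  proof -
    obtain R where R: "\<And>x. x \<in> \<Omega> \<Longrightarrow> norm x \<le> R" using \<Omega>(2) bounded_iff by blast
    show ?thesis
    proof (rule test_functionsI)
      show "z k x = 0" if "norm x > R" for x using R[of x] that by (auto simp: z_def)
      show "times_cont_diff j (z k)" for j
        by (rule times_cont_diff_glue[OF \<Omega>(1) Q times_cont_diff_ramp[OF sub] _ zQ]) (simp add: z_def)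
    qed
  qed
  have v: "v k \<in> test_functions" for k unfolding v_def[abs_def] by (intro test_functions_add z u)
  have grad: "gradient (v k) x = m k x *\<^sub>R gradient (u k) x" for k x
  proof -
    have "GDERIV (z k) x :> (- (indicator \<Omega> x * ramp_deriv (c - u k x))) *\<^sub>R gradient (u k) x"
    proof (cases "x \<in> \<Omega>")
      case True
      have "GDERIV (\<lambda>x. c - u k x) x :> - gradient (u k) x"
        using GDERIV_diff[OF GDERIV_const[of c x] test_functions_GDERIV[OF u(1)], of k] by simp
      from GDERIV_ramp[OF this]
      have g: "((\<lambda>x. ramp (c - u k x)) has_derivative (\<lambda>h. h \<bullet> (ramp_deriv (c - u k x) *\<^sub>R - gradient (u k) x))) (at x)"
        unfolding gderiv_def .
      have "(z k has_derivative (\<lambda>h. h \<bullet> (ramp_deriv (c - u k x) *\<^sub>R - gradient (u k) x))) (at x)"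
        by (rule has_derivative_transform_within_open[OF g \<Omega>(1) True]) (simp add: z_def)
      then show ?thesis using True by (simp add: gderiv_def)
    next
      case False
      have x: "x \<in> - Q k" "open (- Q k)" using False Q by auto
      have "(z k has_derivative (\<lambda>h. h \<bullet> 0)) (at x)"
        by (rule has_derivative_transform_within_open[OF _ x(2,1), of "\<lambda>_. 0"]) (auto simp: zQ)
      then show ?thesis using False by (simp add: gderiv_def)
    qed
    then have "GDERIV (v k) x :> gradient (u k) x + (- (indicator \<Omega> x * ramp_deriv (c - u k x))) *\<^sub>R gradient (u k) x"
      unfolding v_def[abs_def] by (intro GDERIV_add test_functions_GDERIV u)
    then show ?thesis by (intro GDERIV_unique) (simp add: m_def scaleR_diff_left)
  qed
  have lim: "(\<lambda>k. m k x) \<longlonglongrightarrow> 1 - indicator \<Omega> x * ramp_deriv (c - \<phi> x)" for x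
    unfolding m_def
    by (intro tendsto_intros continuous_on_tendsto_compose[OF continuous_on_ramp_deriv[of UNIV]]
        tendsto_uniform_limitI[OF u(2)]) auto
  have uz: "uniform_limit UNIV (\<lambda>k x. ramp (c - u k x)) (\<lambda>x. ramp (c - \<phi> x)) sequentially"
    by (intro uniform_limit_minus uniform_limit_ramp uniform_limit_const u)
  have "uniform_limit UNIV z (\<lambda>x. if x \<in> \<Omega> then ramp (c - \<phi> x) else 0) sequentially"
  proof (rule uniform_limitI)
    fix e :: real assume "e > 0"
    from uniform_limitD[OF uz this]
    show "\<forall>\<^sub>F k in sequentially. \<forall>x\<in>UNIV. dist (z k x) (if x \<in> \<Omega> then ramp (c - \<phi> x) else 0) < e"
      by (rule eventually_mono) (use \<open>e > 0\<close> in \<open>auto simp: z_def\<close>)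
  qed
  then have unif: "uniform_limit UNIV v (\<lambda>x. \<phi> x + (if x \<in> \<Omega> then ramp (c - \<phi> x) else 0)) sequentially"
    unfolding v_def[abs_def] by (intro uniform_limit_add u)
  have mm: "m k \<in> borel_measurable borel" for k
  proof -
    have "(\<lambda>x. ramp_deriv (c - u k x)) \<in> borel_measurable borel"
      by (intro borel_measurable_continuous_onI continuous_on_compose2[OF continuous_on_ramp_deriv[of UNIV]]
          continuous_intros cu) auto
    then show ?thesis unfolding m_def[abs_def] using \<Omega>(1)
      by (intro borel_measurable_diff borel_measurable_times borel_measurable_indicator) auto
  qed
  have m01: "0 \<le> m k x" "m k x \<le> 1" for k x
    using ramp_deriv_bounds[of "c - u k x"] by (auto simp: m_def indicator_def)
  show "(\<lambda>x. \<phi> x + (if x \<in> \<Omega> then ramp (c - \<phi> x) else 0)) \<in> X"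
    "energy n (\<lambda>x. \<phi> x + (if x \<in> \<Omega> then ramp (c - \<phi> x) else 0)) \<le> energy n \<phi>"
    using approximates_contract[OF a v mm m01 grad lim unif] by blast+
qed

section \<open>Minimisers of the functional and their potentials\<close>

lemma pairing_X:
  assumes "borel_prob \<rho>" "\<phi> \<in> X"
  shows "integrable \<rho> \<phi>"
  using X_bounded[OF assms(2)] borel_prob_integrable[OF assms(1) X_continuous[OF assms(2)]] by blast

lemma pairing_X_add: "borel_prob \<rho> \<Longrightarrow> \<phi> \<in> X \<Longrightarrow> \<psi> \<in> X \<Longrightarrow>
    pairing \<rho> (\<lambda>x. \<phi> x + \<psi> x) = pairing \<rho> \<phi> + pairing \<rho> \<psi>"
  unfolding pairing_def by (intro Bochner_Integration.integral_add pairing_X)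

lemma pairing_X_diff: "borel_prob \<rho> \<Longrightarrow> \<phi> \<in> X \<Longrightarrow> \<psi> \<in> X \<Longrightarrow>
    pairing \<rho> (\<lambda>x. \<phi> x - \<psi> x) = pairing \<rho> \<phi> - pairing \<rho> \<psi>"
  unfolding pairing_def by (intro Bochner_Integration.integral_diff pairing_X)

lemma pairing_scale: "pairing \<rho> (\<lambda>x. c * \<phi> x) = c * pairing \<rho> \<phi>"
  unfolding pairing_def by simp

text \<open>The linear term drops out of Clarkson's inequality, so the midpoint gap of the
  functional controls the energy of the half difference. Both existence and uniqueness of minimisers
  rest on this.\<close>

lemma I_Clarkson:
  assumes \<rho>: "borel_prob \<rho>" and "\<phi> \<in> X" "\<psi> \<in> X"
  shows "energy n (\<lambda>x. 1/2 * (\<phi> x - \<psi> x)) \<le> (I_functional n \<rho> \<phi> + I_functional n \<rho> \<psi>) / 2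
    - I_functional n \<rho> (\<lambda>x. 1/2 * (\<phi> x + \<psi> x))"
proof -
  have *: "b \<le> ((c - q) + (d - r)) / 2 - (a - 1/2 * (q + r))" if "a + b \<le> (c + d) / 2" for a b c d q r :: real
    using that by (simp add: field_simps)
  show ?thesis
    unfolding I_functional_eq pairing_scale pairing_X_add[OF assms]
    by (rule *[OF energy_Clarkson[OF assms(2,3)]])
qed

text \<open>The summand 1 makes the energy bound strict and the root at least 1, so the minimum in
  \<open>X_sup_bound\<close> is the square. Growth like the root of the energy keeps the linear term
  from outweighing the energy.\<close>

lemma X_sup_bound_sqrt:
  assumes \<phi>: "\<phi> \<in> X"
  shows "\<bar>\<phi> x\<bar> \<le> sup_const * sqrt (energy n \<phi> + 1)"
proof (rule X_sup_bound[OF \<phi>])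
  have e: "energy n \<phi> \<ge> 0" by (rule energy_nonneg[OF \<phi>])
  then have s: "sqrt (energy n \<phi> + 1) \<ge> 1" by simp
  have "(sqrt (energy n \<phi> + 1))\<^sup>2 \<le> sqrt (energy n \<phi> + 1) ^ (2 * n)"
    using s n_pos by (intro power_increasing) auto
  moreover have "energy n \<phi> < (sqrt (energy n \<phi> + 1))\<^sup>2" using e by simp
  ultimately show "energy n \<phi> < min ((sqrt (energy n \<phi> + 1))\<^sup>2) (sqrt (energy n \<phi> + 1) ^ (2 * n))" by simp
qed (use energy_nonneg[OF \<phi>] in simp)

lemma I_bounded_below:
  assumes "borel_prob \<rho>" "\<phi> \<in> X"
  shows "I_functional n \<rho> \<phi> \<ge> - 1 - sup_const\<^sup>2 / 4"
proof -
  define s where "s = sqrt (energy n \<phi> + 1)"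
  have s: "s\<^sup>2 = energy n \<phi> + 1" using energy_nonneg[OF assms(2)] by (simp add: s_def)
  have "\<bar>pairing \<rho> \<phi>\<bar> \<le> sup_const * s"
    unfolding s_def by (intro pairing_abs_le assms X_continuous X_sup_bound_sqrt)
  moreover have "0 \<le> (s - sup_const / 2)\<^sup>2" by simp
  ultimately show ?thesis using s unfolding I_functional_eq by (simp add: power2_diff field_simps)
qed

lemma I_minimizer_exists:
  assumes \<rho>: "borel_prob \<rho>"
  obtains \<phi> where "\<phi> \<in> X" "\<And>\<xi>. \<xi> \<in> X \<Longrightarrow> I_functional n \<rho> \<phi> \<le> I_functional n \<rho> \<xi>"
proof -
  let ?I = "I_functional n \<rho>"
  \<comment> \<open>The infimum runs over test functions only, so that a minimising sequence is
    itself an approximating sequence. Continuity along approximations, \<open>conv\<close> below,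
    shows it to be a lower bound on the whole space.\<close>
  define mm where "mm = Inf (?I ` test_functions)"
  have bdd: "bdd_below (?I ` (test_functions :: ('a \<Rightarrow> real) set))"
    by (rule bdd_belowI2) (rule I_bounded_below[OF \<rho> X_test])
  have ne: "(test_functions :: ('a \<Rightarrow> real) set) \<noteq> {}" using test_functions_zero by blast
  have mm: "mm \<le> ?I u" if "u \<in> test_functions" for u
    unfolding mm_def using that by (intro cInf_lower bdd) auto
  have "\<exists>u\<in>test_functions. ?I u < mm + inverse (real (Suc k))" for k
  proof -
    have "Inf (?I ` test_functions) < mm + inverse (real (Suc k))" by (simp add: mm_def[symmetric])
    from cInf_lessD[OF _ this] ne show ?thesis by auto
  qed
  then obtain u where u: "\<And>k. u k \<in> test_functions" "\<And>k. ?I (u k) < mm + inverse (real (Suc k))" by metis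
  have half: "modular n (\<lambda>x. gradient (u j) x - gradient (u k) x) \<le>
      2 ^ (2 * n) * ((inverse (real (Suc j)) + inverse (real (Suc k))) / 2)" for j k
  proof -
    have "(\<lambda>x. 1/2 * (u j x + u k x)) \<in> test_functions"
      by (intro test_functions_cmult test_functions_add u)
    then have "mm \<le> ?I (\<lambda>x. 1/2 * (u j x + u k x))" by (rule mm)
    moreover have "e \<le> (r + s) / 2" if "e \<le> (a + b) / 2 - c" "a < m + r" "b < m + s" "m \<le> c"
      for a b c e m r s :: real
      using that by (simp add: field_simps)
    ultimately have e: "energy n (\<lambda>x. 1/2 * (u j x - u k x)) \<le> (inverse (real (Suc j)) + inverse (real (Suc k))) / 2"
      using I_Clarkson[OF \<rho> X_test[OF u(1)] X_test[OF u(1)], of j k] u(2)[of j] u(2)[of k] by blast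
    define w where "w x = 1/2 * (u j x - u k x)" for x
    have w: "w \<in> test_functions" unfolding w_def[abs_def] by (intro test_functions_cmult test_functions_diff u)
    have gw: "gradient w x = (1/2) *\<^sub>R (gradient (u j) x - gradient (u k) x)" for x
      unfolding w_def[abs_def] by (simp only: gradient_cmult[OF test_functions_diff[OF u(1) u(1)]] gradient_diff[OF u(1) u(1)])
    have "modular n (\<lambda>x. gradient (u j) x - gradient (u k) x) = modular n (\<lambda>x. 2 *\<^sub>R gradient w x)"
      by (simp add: gw)
    also have "\<dots> \<le> 2 ^ (2 * n) * modular n (gradient w)"
      by (intro modular_scale_ge in_modular_gradient w) simp
    also have "\<dots> \<le> 2 ^ (2 * n) * ((inverse (real (Suc j)) + inverse (real (Suc k))) / 2)"
      using e unfolding w_def[symmetric] energy_test[OF w] by (intro mult_left_mono) auto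
    finally show ?thesis .
  qed
  have "\<exists>M. \<forall>j\<ge>M. \<forall>k\<ge>M. modular n (\<lambda>x. gradient (u j) x - gradient (u k) x) < e" if "e > 0" for e
  proof -
    have "(\<lambda>k. 2 ^ (2 * n) * inverse (real (Suc k))) \<longlonglongrightarrow> 2 ^ (2 * n) * 0"
      by (intro tendsto_mult tendsto_const LIMSEQ_inverse_real_of_nat)
    then have "\<forall>\<^sub>F k in sequentially. 2 ^ (2 * n) * inverse (real (Suc k)) < e"
      using that by (intro order_tendstoD) auto
    then obtain M where M: "\<And>k. k \<ge> M \<Longrightarrow> 2 ^ (2 * n) * inverse (real (Suc k)) < e"
      by (auto simp: eventually_sequentially)
    have "modular n (\<lambda>x. gradient (u j) x - gradient (u k) x) < e" if "j \<ge> M" "k \<ge> M" for j k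
      using half[of j k] M[OF that(1)] M[OF that(2)] by (simp add: distrib_left)
    then show ?thesis by blast
  qed
  then obtain \<phi> G where a: "approximates n u \<phi> G" by (rule test_complete[of u, OF u(1)])
  have conv: "(\<lambda>k. ?I (v k)) \<longlonglongrightarrow> ?I \<xi>" if a: "approximates n v \<xi> H" for v \<xi> H
  proof -
    note v = approximatesD[OF a]
    have "(\<lambda>k. energy n (v k)) \<longlonglongrightarrow> energy n \<xi>"
      unfolding energy_test[OF v(1)] appr_energy[OF a] by (intro modular_tendsto in_modular_gradient v)
    moreover have "(\<lambda>k. pairing \<rho> (v k)) \<longlonglongrightarrow> pairing \<rho> \<xi>"
    proof (rule LIMSEQ_I)
      fix e :: real assume "e > 0"
      then have "\<forall>\<^sub>F k in sequentially. \<forall>x. dist (v k x) (\<xi> x) < e / 2"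
        using uniform_limitD[OF v(2), of "e / 2"] by simp
      then obtain K where K: "\<And>k x. k \<ge> K \<Longrightarrow> dist (v k x) (\<xi> x) < e / 2" by (auto simp: eventually_sequentially)
      have \<xi>: "\<xi> \<in> X" using a X_iff by blast
      have "norm (pairing \<rho> (v k) - pairing \<rho> \<xi>) < e" if "k \<ge> K" for k
      proof -
        have "\<bar>pairing \<rho> (\<lambda>x. v k x - \<xi> x)\<bar> \<le> e / 2"
          using K[OF that] by (intro pairing_abs_le \<rho> X_continuous X_diff X_test v \<xi>)
            (auto simp: dist_real_def intro: less_imp_le)
        then show ?thesis using \<open>e > 0\<close> pairing_X_diff[OF \<rho> X_test[OF v(1)] \<xi>] by simp
      qed
      then show "\<exists>K. \<forall>k\<ge>K. norm (pairing \<rho> (v k) - pairing \<rho> \<xi>) < e" by blast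
    qed
    ultimately show ?thesis unfolding I_functional_eq by (rule tendsto_diff)
  qed
  have "?I \<phi> \<le> mm"
  proof (rule LIMSEQ_le[OF conv[OF a]])
    show "(\<lambda>k. mm + inverse (real (Suc k))) \<longlonglongrightarrow> mm"
      using LIMSEQ_inverse_real_of_nat_add[of mm] .
    show "\<exists>N. \<forall>k\<ge>N. ?I (u k) \<le> mm + inverse (real (Suc k))" using u(2) less_imp_le by blast
  qed
  moreover have "mm \<le> ?I \<xi>" if "\<xi> \<in> X" for \<xi>
  proof -
    obtain v H where b: "approximates n v \<xi> H" using \<open>\<xi> \<in> X\<close> X_iff by blast
    show ?thesis by (rule LIMSEQ_le_const[OF conv[OF b]]) (use mm approximatesD(1)[OF b] in blast)
  qed
  moreover have "\<phi> \<in> X" using a X_iff by blast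
  ultimately show thesis by (intro that) (auto intro: order.trans)
qed

text \<open>The midpoint is no better than the minimum, so the half difference has energy 0; the sup
  bound with arbitrarily small scale then makes it vanish at every point, not just almost
  everywhere.\<close>

lemma I_minimizer_unique:
  assumes \<rho>: "borel_prob \<rho>" and \<phi>: "\<phi> \<in> X" "\<And>\<xi>. \<xi> \<in> X \<Longrightarrow> I_functional n \<rho> \<phi> \<le> I_functional n \<rho> \<xi>"
    and \<psi>: "\<psi> \<in> X" "I_functional n \<rho> \<psi> \<le> I_functional n \<rho> \<phi>"
  shows "\<psi> = \<phi>"
proof
  fix x
  define w where "w x = 1/2 * (\<psi> x - \<phi> x)" for x
  have w: "w \<in> X" unfolding w_def[abs_def] by (intro X_scale X_diff \<phi> \<psi>)
  have "I_functional n \<rho> \<phi> \<le> I_functional n \<rho> (\<lambda>x. 1/2 * (\<psi> x + \<phi> x))"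
    by (intro \<phi> X_scale X_add \<psi>)
  moreover have "e \<le> 0" if "i \<le> m" "e \<le> (j + i) / 2 - m" "j \<le> i" for e i j m :: real
    using that by (simp add: field_simps)
  ultimately have e: "energy n w \<le> 0"
    using I_Clarkson[OF \<rho> \<psi>(1) \<phi>(1)] \<psi>(2) unfolding w_def[symmetric] by blast
  have "\<bar>w x\<bar> \<le> 0 + d" if "d > 0" for d
  proof -
    have "\<bar>w x\<bar> \<le> sup_const * (d / sup_const)"
      using that sup_const(1) e by (intro X_sup_bound w) (auto intro: le_less_trans)
    then show ?thesis using sup_const(1) by simp
  qed
  then have "\<bar>w x\<bar> \<le> 0" by (rule field_le_epsilon)
  then show "\<psi> x = \<phi> x" by (simp add: w_def)
qed

lemma potential_minimizes:
  fixes \<rho> :: "'a measure"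
  assumes \<rho>: "borel_prob \<rho>"
  shows "potential n \<rho> \<in> X" "\<And>\<xi>. \<xi> \<in> X \<Longrightarrow> I_functional n \<rho> (potential n \<rho>) \<le> I_functional n \<rho> \<xi>"
proof -
  obtain \<phi> where \<phi>: "\<phi> \<in> X" "\<And>\<xi>. \<xi> \<in> X \<Longrightarrow> I_functional n \<rho> \<phi> \<le> I_functional n \<rho> \<xi>"
    using I_minimizer_exists[OF \<rho>] by blast
  have "potential n \<rho> = \<phi>" unfolding potential_def
  proof (rule the_equality)
    show "is_arg_min (I_functional n \<rho>) (\<lambda>\<psi>. \<psi> \<in> X) \<phi>" using \<phi> by (simp add: is_arg_min_linorder)
    fix \<psi> assume "is_arg_min (I_functional n \<rho>) (\<lambda>\<psi>. \<psi> \<in> X) \<psi>"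
    then show "\<psi> = \<phi>" using I_minimizer_unique[OF \<rho> \<phi>] \<phi>(1) by (simp add: is_arg_min_linorder)
  qed
  with \<phi> show "potential n \<rho> \<in> X" "\<And>\<xi>. \<xi> \<in> X \<Longrightarrow> I_functional n \<rho> (potential n \<rho>) \<le> I_functional n \<rho> \<xi>"
    by auto
qed

lemma potential_eqI:
  assumes "borel_prob \<rho>" "\<psi> \<in> X" "I_functional n \<rho> \<psi> \<le> I_functional n \<rho> (potential n \<rho>)"
  shows "\<psi> = potential n \<rho>"
  using I_minimizer_unique[OF assms(1) potential_minimizes(1)[OF assms(1)]
      potential_minimizes(2)[OF assms(1)] assms(2,3)] .

text \<open>The polynomial t -> I(t \<phi>) is minimal at t = 1. Its vanishing derivative there
  equates the sum of the terms \<alpha>_h |grad \<phi>|^(2h), integrated, with the pairing, and (2h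
  - 1)/(2h) = 1 - 1/(2h) does the rest.\<close>

lemma K_potential:
  fixes \<rho> :: "'a measure"
  assumes \<rho>: "borel_prob \<rho>"
  shows "K_functional n (potential n \<rho>) = - I_functional n \<rho> (potential n \<rho>)"
proof -
  define \<phi> where "\<phi> = potential n \<rho>"
  note \<phi> = potential_minimizes[OF \<rho>, folded \<phi>_def]
  define A where "A h = Lp_norm (2 * h) (weak_gradient \<phi>) ^ (2 * h)" for h
  define p where "p = pairing \<rho> \<phi>"
  define f where "f t = (\<Sum>h=1..n. alpha h / (2 * real h) * (t ^ (2 * h) * A h)) - t * p" for t
  have f: "f t = I_functional n \<rho> (\<lambda>x. t * \<phi> x)" for t
    unfolding f_def I_functional_eq energy_scale[OF \<phi>(1)] pairing_scale A_def p_def ..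
  have "(f has_real_derivative (\<Sum>h=1..n. alpha h * A h) - p) (at 1)"
    unfolding f_def
  proof (intro DERIV_diff DERIV_sum)
    show "((\<lambda>t. alpha h / (2 * real h) * (t ^ (2 * h) * A h)) has_real_derivative alpha h * A h) (at 1)"
      if "h \<in> {1..n}" for h
      using that by (auto intro!: derivative_eq_intros)
  qed (auto intro!: derivative_eq_intros)
  moreover have "\<forall>t. \<bar>1 - t\<bar> < 1 \<longrightarrow> f 1 \<le> f t"
    unfolding f using \<phi>(2)[OF X_scale[OF \<phi>(1)]] by simp
  ultimately have "(\<Sum>h=1..n. alpha h * A h) - p = 0"
    by (rule DERIV_local_min[OF _ zero_less_one])
  moreover have "K_functional n \<phi> = (\<Sum>h=1..n. alpha h * A h) - energy n \<phi>"
    unfolding K_functional_def energy_def A_def[symmetric] sum_subtractf[symmetric]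
    by (intro sum.cong refl) (auto simp: field_simps)
  ultimately show ?thesis unfolding I_functional_eq \<phi>_def[symmetric] p_def[symmetric] by simp
qed

lemma K_potential_ge:
  assumes "borel_prob \<rho>" "\<phi> \<in> X"
  shows "pairing \<rho> \<phi> - energy n \<phi> \<le> K_functional n (potential n \<rho>)"
  using potential_minimizes(2)[OF assms] unfolding K_potential[OF assms(1)] I_functional_eq by simp

lemma K_potential_eq:
  fixes \<rho> :: "'a measure"
  assumes "borel_prob \<rho>"
  shows "K_functional n (potential n \<rho>) = pairing \<rho> (potential n \<rho>) - energy n (potential n \<rho>)"
  unfolding K_potential[OF assms] I_functional_eq by simp

end

section \<open>Weak compactness of probability measures\<close>

text \<open>Base 3 with digits 0 and 1 leaves a gap: all digits after a given one together weigh at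
  most half of it, so nearby codes share their leading digits. In base 2 two digit sequences can
  have the same value.\<close>

definition ternary_code :: "(nat \<Rightarrow> 'a set) \<Rightarrow> 'a \<Rightarrow> real" where
  "ternary_code E x = (\<Sum>m. indicator (E m) x * (1/3) ^ m)"

lemma summable_ternary:
  fixes d :: "nat \<Rightarrow> real"
  assumes "\<And>m. \<bar>d m\<bar> \<le> 1"
  shows "summable (\<lambda>m. d m * (1/3) ^ m)"
  by (rule summable_comparison_test'[of "\<lambda>m. (1/3) ^ m" 0])
    (use assms in \<open>auto simp: abs_mult power_abs intro!: mult_left_le_one_le\<close>)

lemma ternary_code_bounds: "0 \<le> ternary_code E x" "ternary_code E x \<le> 2"
proof -
  have s: "summable (\<lambda>m. indicator (E m) x * (1/3) ^ m :: real)"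
    by (rule summable_ternary) (simp add: indicator_def)
  show "0 \<le> ternary_code E x" unfolding ternary_code_def by (intro suminf_nonneg s) auto
  have "ternary_code E x \<le> (\<Sum>m. (1/3) ^ m)"
    unfolding ternary_code_def by (intro suminf_le s) (auto simp: indicator_def)
  also have "\<dots> = 3/2" by (simp add: suminf_geometric)
  finally show "ternary_code E x \<le> 2" by simp
qed

text \<open>If the first differing digit is the k-th, it separates the codes by 3^(-k), and the
  later digits can undo at most half of that.\<close>

lemma ternary_code_digit:
  assumes close: "\<bar>ternary_code E x - ternary_code E y\<bar> < (1/3) ^ M / 2" and "m \<le> M"
  shows "x \<in> E m \<longleftrightarrow> y \<in> E m"
proof (rule ccontr)
  define d :: "nat \<Rightarrow> real" where "d m = indicator (E m) x - indicator (E m) y" for m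
  assume "\<not> ?thesis"
  then have ex: "d m \<noteq> 0" by (auto simp: d_def indicator_def)
  define k where "k = (LEAST m. d m \<noteq> 0)"
  have k: "d k \<noteq> 0" "k \<le> m" "\<And>j. j < k \<Longrightarrow> d j = 0"
    using LeastI[of "\<lambda>m. d m \<noteq> 0", OF ex] Least_le[of "\<lambda>m. d m \<noteq> 0", OF ex]
      not_less_Least[of _ "\<lambda>m. d m \<noteq> 0"] unfolding k_def by blast+
  have d1: "\<bar>d m\<bar> \<le> 1" for m by (simp add: d_def indicator_def)
  have dk: "\<bar>d k\<bar> = 1" using k(1) by (auto simp: d_def indicator_def split: if_splits)
  have s: "summable (\<lambda>m. d m * (1/3) ^ m)" by (rule summable_ternary[OF d1])
  have "ternary_code E x - ternary_code E y = (\<Sum>m. d m * (1/3) ^ m)"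
    unfolding ternary_code_def d_def left_diff_distrib
    by (rule suminf_diff) (rule summable_ternary; simp add: indicator_def)+
  also have "\<dots> = (\<Sum>m. d (m + Suc k) * (1/3) ^ (m + Suc k)) + (\<Sum>m<Suc k. d m * (1/3) ^ m)"
    by (rule suminf_split_initial_segment[OF s])
  also have "(\<Sum>m<Suc k. d m * (1/3) ^ m) = d k * (1/3) ^ k"
    using k(3) by simp
  finally have eq: "ternary_code E x - ternary_code E y =
    (\<Sum>m. d (m + Suc k) * (1/3) ^ (m + Suc k)) + d k * (1/3) ^ k" .
  have "\<bar>\<Sum>m. d (m + Suc k) * (1/3) ^ (m + Suc k)\<bar> \<le> (\<Sum>m. (1/3) ^ m * (1/3) ^ Suc k)"
  proof (rule order.trans[OF summable_rabs suminf_le])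
    have b: "\<bar>d (m + Suc k) * (1/3) ^ (m + Suc k)\<bar> \<le> (1/3) ^ m * (1/3) ^ Suc k" for m
      using d1[of "m + Suc k"]
      by (simp add: abs_mult power_abs power_add mult_left_le_one_le)
    then show "\<bar>d (m + Suc k) * (1/3) ^ (m + Suc k)\<bar> \<le> (1/3) ^ m * (1/3) ^ Suc k" for m .
    show g: "summable (\<lambda>m. (1/3) ^ m * (1/3::real) ^ Suc k)"
      by (intro summable_mult2 summable_geometric) simp
    show "summable (\<lambda>m. \<bar>d (m + Suc k) * (1/3) ^ (m + Suc k)\<bar>)"
      by (rule summable_comparison_test'[OF g, of 0]) (use b in auto)
    then show "summable (\<lambda>m. \<bar>d (m + Suc k) * (1/3) ^ (m + Suc k)\<bar>)" .
  qed
  also have "\<dots> = (1/3) ^ k / 2"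
    by (subst suminf_mult2[symmetric]) (auto simp: suminf_geometric)
  finally have "\<bar>ternary_code E x - ternary_code E y\<bar> \<ge> \<bar>d k * (1/3) ^ k\<bar> - (1/3) ^ k / 2"
    unfolding eq by linarith
  moreover have "\<bar>d k * (1/3) ^ k\<bar> = (1/3) ^ k" using dk by (simp add: abs_mult)
  moreover have "(1/3::real) ^ k \<ge> (1/3) ^ M"
    using k(2) \<open>m \<le> M\<close> by (intro power_decreasing) auto
  ultimately show False using close by linarith
qed

text \<open>Coding \<open>x\<close> by its membership in the sets of a countable base embeds a compact set into a Cantor
  set on the line; the inverse is uniformly continuous, so it extends to the whole line.\<close>

lemma compact_real_code:
  fixes K :: "'a::euclidean_space set"
  assumes "compact K"
  obtains c :: "'a \<Rightarrow> real" and g :: "real \<Rightarrow> 'a" where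
    "c \<in> borel_measurable borel" "\<And>x. 0 \<le> c x" "\<And>x. c x \<le> 2"
    "continuous_on UNIV g" "\<And>x. x \<in> K \<Longrightarrow> g (c x) = x"
proof -
  obtain B :: "'a set set" where B: "countable B" "topological_basis B"
    using ex_countable_basis by blast
  have "B \<noteq> {}" using topological_basisE[OF B(2) open_UNIV UNIV_I] by blast
  define E where "E = from_nat_into B"
  have E: "range E = B" unfolding E_def using \<open>B \<noteq> {}\<close> B(1) by (rule range_from_nat_into)
  let ?c = "ternary_code E"
  have "open (E m)" for m using E B(2) topological_basis_open by blast
  then have [measurable]: "E m \<in> sets borel" for m by simp
  have c: "?c \<in> borel_measurable borel" unfolding ternary_code_def[abs_def] by measurable
  have uc: "\<exists>\<delta>>0. \<forall>x\<in>K. \<forall>y\<in>K. \<bar>?c x - ?c y\<bar> < \<delta> \<longrightarrow> dist x y < \<epsilon>" if "\<epsilon> > 0" for \<epsilon>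
  proof -
    define C where "C = {b \<in> B. \<exists>z. b \<subseteq> ball z (\<epsilon> / 2)}"
    have "K \<subseteq> \<Union>C"
    proof
      fix x assume "x \<in> K"
      have "x \<in> ball x (\<epsilon> / 2)" using that by simp
      then obtain b where "b \<in> B" "x \<in> b" "b \<subseteq> ball x (\<epsilon> / 2)"
        by (rule topological_basisE[OF B(2) open_ball])
      then show "x \<in> \<Union>C" by (auto simp: C_def)
    qed
    moreover have "open b" if "b \<in> C" for b
      using that B(2) topological_basis_open unfolding C_def by blast
    ultimately obtain D where D: "D \<subseteq> C" "finite D" "K \<subseteq> \<Union>D"
      by (rule compactE[OF assms])
    \<comment> \<open>The largest index of a set in the finite subcover, with 0 inserted for an
      empty one. Codes closer than 3^(-M)/2 agree on membership in all these sets, each contained in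
      a ball of radius \<epsilon>/2.\<close>
    define M where "M = Max (insert 0 (to_nat_on B ` D))"
    show ?thesis
    proof (intro exI[of _ "(1/3) ^ M / 2"] conjI ballI impI)
      fix x y assume xy: "x \<in> K" "y \<in> K" "\<bar>?c x - ?c y\<bar> < (1/3) ^ M / 2"
      obtain b where b: "b \<in> D" "x \<in> b" using xy D by blast
      have "b \<in> B" using b D by (auto simp: C_def)
      then have "E (to_nat_on B b) = b" unfolding E_def using B(1) by simp
      moreover have "to_nat_on B b \<le> M" unfolding M_def using D b by (intro Max_ge) auto
      ultimately have "y \<in> b" using ternary_code_digit[OF xy(3)] b by metis
      moreover obtain z where "b \<subseteq> ball z (\<epsilon> / 2)" using b D by (auto simp: C_def)
      ultimately have "dist z x < \<epsilon> / 2" "dist z y < \<epsilon> / 2" using b by auto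
      then show "dist x y < \<epsilon>" using dist_triangle_half_r by blast
    qed simp
  qed
  have inj: "inj_on ?c K"
  proof (rule inj_onI, rule ccontr)
    fix x y assume xy: "x \<in> K" "y \<in> K" "?c x = ?c y" "x \<noteq> y"
    then obtain \<delta> where "\<delta> > 0" "\<forall>x'\<in>K. \<forall>y'\<in>K. \<bar>?c x' - ?c y'\<bar> < \<delta> \<longrightarrow> dist x' y' < dist x y"
      using uc[of "dist x y"] by auto
    then have "dist x y < dist x y" using xy(1-3) by (metis abs_zero cancel_comm_monoid_add_class.diff_cancel)
    then show False by simp
  qed
  have "uniformly_continuous_on (?c ` K) (inv_into K ?c)"
    unfolding uniformly_continuous_on_def
  proof (intro allI impI)
    fix \<epsilon> :: real assume "\<epsilon> > 0"
    from uc[OF this] obtain \<delta> where \<delta>: "\<delta> > 0" "\<And>x y. x \<in> K \<Longrightarrow> y \<in> K \<Longrightarrow> \<bar>?c x - ?c y\<bar> < \<delta> \<Longrightarrow> dist x y < \<epsilon>"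
      by blast
    show "\<exists>d>0. \<forall>x\<in>?c ` K. \<forall>x'\<in>?c ` K. dist x' x < d \<longrightarrow> dist (inv_into K ?c x') (inv_into K ?c x) < \<epsilon>"
      using \<delta> inj by (intro exI[of _ \<delta>]) (auto simp: dist_real_def)
  qed
  \<comment> \<open>The code is only Borel, so the image of \<open>K\<close> need not be closed,
    while Tietze's theorem extends from closed sets; uniform continuity first carries the inverse to
    the closure.\<close>
  then obtain g0 where g0: "uniformly_continuous_on (closure (?c ` K)) g0"
    "\<And>t. t \<in> ?c ` K \<Longrightarrow> inv_into K ?c t = g0 t"
    using uniformly_continuous_on_extension_on_closure by metis
  obtain g where g: "continuous_on UNIV g" "\<And>t. t \<in> closure (?c ` K) \<Longrightarrow> g t = g0 t"
    using Tietze_unbounded[OF uniformly_continuous_imp_continuous[OF g0(1)], of UNIV] by auto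
  have "g (?c x) = x" if "x \<in> K" for x
    using g(2)[of "?c x"] g0(2)[of "?c x"] inj that closure_subset[of "?c ` K"] by auto
  with c ternary_code_bounds g(1) show thesis by (rule that)
qed

text \<open>The images under the code are tight on the line, so Helly's selection theorem gives a
  limit there, which \<open>g\<close> carries back. The code itself may be discontinuous: a
  continuous \<open>f\<close> is tested on the line as f o g, and g(c x) = x almost
  everywhere.\<close>

theorem weak_compactness:
  fixes \<rho> :: "nat \<Rightarrow> 'a::euclidean_space measure"
  assumes K: "compact K" and P: "\<And>k. prob_space (\<rho> k)" and sets: "\<And>k. sets (\<rho> k) = sets borel"
    and supp: "\<And>k. emeasure (\<rho> k) (- K) = 0"
  obtains r :: "nat \<Rightarrow> nat" and \<nu> where "strict_mono r" "prob_space \<nu>" "sets \<nu> = sets borel"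
    "emeasure \<nu> (- K) = 0"
    "\<And>f B. continuous_on UNIV f \<Longrightarrow> (\<And>x. \<bar>f x\<bar> \<le> (B::real)) \<Longrightarrow> (\<lambda>k. LINT x|\<rho> (r k). f x) \<longlonglongrightarrow> (LINT x|\<nu>. f x)"
proof -
  obtain c :: "'a \<Rightarrow> real" and g :: "real \<Rightarrow> 'a" where
    c: "c \<in> borel_measurable borel" and cb: "\<And>x. 0 \<le> c x" "\<And>x. c x \<le> 2"
    and g: "continuous_on UNIV g" and gc: "\<And>x. x \<in> K \<Longrightarrow> g (c x) = x"
    using compact_real_code[OF K] by blast
  have Kc: "K \<in> sets borel" using K by (simp add: compact_imp_closed)
  have c'[measurable]: "c \<in> borel_measurable (\<rho> k)" for k
    using c by (simp add: measurable_cong_sets[OF sets refl])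
  have [measurable]: "g \<in> borel_measurable borel" using g by (rule borel_measurable_continuous_onI)
  define \<mu> where "\<mu> k = distr (\<rho> k) borel c" for k
  have rd: "real_distribution (\<mu> k)" for k
    unfolding \<mu>_def using P prob_space.real_distribution_distr c' by blast
  \<comment> \<open>Tightness uses half-open intervals, so the left end must lie below the smallest
    possible code 0.\<close>
  have "measure (\<mu> k) {-1<..2} = 1" for k
  proof -
    interpret prob_space "\<rho> k" by (rule P)
    have "-1 < c x" for x using cb(1)[of x] by simp
    then have "c -` {-1<..2} \<inter> space (\<rho> k) = space (\<rho> k)"
      using cb(2) by auto
    then show ?thesis unfolding \<mu>_def by (simp add: measure_distr prob_space)
  qed
  then have "\<exists>a b::real. a < b \<and> (\<forall>n. measure (\<mu> n) {a<..b} > 1 - \<epsilon>)" if "\<epsilon> > 0" for \<epsilon> :: real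
    using that by (intro exI[of _ "-1::real"] exI[of _ "2::real"]) simp
  then have "tight \<mu>" unfolding tight_def using rd by blast
  then obtain r M where r: "strict_mono r" and M: "real_distribution M" and "weak_conv_m (\<mu> \<circ> id \<circ> r) M"
    using tight_imp_convergent_subsubsequence[of \<mu> id] by (auto simp: strict_mono_def)
  then have wc: "weak_conv_m (\<lambda>k. \<mu> (r k)) M" by (simp add: comp_def)
  interpret M: real_distribution M by (rule M)
  define \<nu> where "\<nu> = distr M borel g"
  have gM[measurable]: "g \<in> measurable M borel"
    using \<open>g \<in> borel_measurable borel\<close> by simp
  have \<nu>: "prob_space \<nu>" "sets \<nu> = sets borel"
    unfolding \<nu>_def by (auto intro: M.prob_space_distr)
  have conv: "(\<lambda>k. LINT x|\<rho> (r k). f x) \<longlonglongrightarrow> (LINT x|\<nu>. f x)"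
    if f: "continuous_on UNIV f" and B: "\<And>x. \<bar>f x\<bar> \<le> B" for f and B :: real
  proof -
    have [measurable]: "f \<in> borel_measurable borel" using f by (rule borel_measurable_continuous_onI)
    have "continuous_on UNIV (\<lambda>t. f (g t))"
      using f g by (intro continuous_on_compose2[OF f g]) auto
    then have "(\<lambda>k. LINT t|\<mu> (r k). f (g t)) \<longlonglongrightarrow> (LINT t|M. f (g t))"
      by (intro weak_conv_imp_integral_bdd_continuous_conv[OF _ _ wc, of _ B] rd M)
        (auto simp: B continuous_on_eq_continuous_at)
    moreover have "(LINT t|M. f (g t)) = (LINT x|\<nu>. f x)"
      unfolding \<nu>_def by (subst integral_distr) auto
    moreover have "(LINT t|\<mu> k. f (g t)) = (LINT x|\<rho> k. f x)" for k
    proof -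
      have "(LINT t|\<mu> k. f (g t)) = (LINT x|\<rho> k. f (g (c x)))"
        unfolding \<mu>_def by (subst integral_distr) auto
      also have "\<dots> = (LINT x|\<rho> k. f x)"
      proof (rule integral_cong_AE)
        have "AE x in \<rho> k. x \<in> K"
          using supp[of k] Kc sets[of k] by (intro AE_I[of _ _ "- K"]) auto
        then show "AE x in \<rho> k. f (g (c x)) = f x" by (rule AE_mp) (auto simp: gc)
        show "f \<in> borel_measurable (\<rho> k)"
          using \<open>f \<in> borel_measurable borel\<close> by (simp add: measurable_cong_sets[OF sets refl])
      qed measurable
      finally show ?thesis .
    qed
    ultimately show ?thesis by simp
  qed
  have "emeasure \<nu> (- K) = 0"
  proof (cases "K = {}")
    \<comment> \<open>\<open>infdist\<close> to the empty set is 0 by convention, so this case is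
      separate; it is contradictory, as \<open>\<rho> 0\<close> has mass 1.\<close>
    case True
    then have "emeasure (\<rho> 0) (space (\<rho> 0)) = 0" 
      using supp[of 0] sets_eq_imp_space_eq[OF sets[of 0]] by simp
    then show ?thesis using prob_space.emeasure_space_1[OF P[of 0]] by simp
  next
    case False
    interpret \<nu>: prob_space \<nu> by (rule \<nu>)
    \<comment> \<open>A bounded continuous function vanishing exactly on \<open>K\<close>: its
      integrals are all 0 along the sequence, hence also for the limit.\<close>
    define f where "f x = min 1 (infdist x K)" for x
    have f: "continuous_on UNIV f" unfolding f_def[abs_def] by (intro continuous_intros)
    have f1: "\<bar>f x\<bar> \<le> 1" for x using infdist_nonneg[of x K] by (simp add: f_def)
    have [measurable]: "f \<in> borel_measurable borel" using f by (rule borel_measurable_continuous_onI)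
    have fK: "f x = 0 \<longleftrightarrow> x \<in> K" for x
      using in_closed_iff_infdist_zero[OF compact_imp_closed[OF K] False, of x] by (auto simp: f_def min_def)
    have "(LINT x|\<rho> k. f x) = 0" for k
    proof (rule integral_eq_zero_AE)
      have "AE x in \<rho> k. x \<in> K"
        using supp[of k] Kc sets[of k] by (intro AE_I[of _ _ "- K"]) auto
      then show "AE x in \<rho> k. f x = 0" by (rule AE_mp) (auto simp: fK)
    qed
    then have "(LINT x|\<nu>. f x) = 0" using conv[OF f f1] by (simp add: LIMSEQ_const_iff)
    moreover have "integrable \<nu> f"
      using f1 \<nu>(2) by (intro \<nu>.integrable_const_bound[of _ 1]) (auto simp: measurable_cong_sets[OF \<nu>(2) refl])
    moreover have "AE x in \<nu>. 0 \<le> f x" by (simp add: f_def infdist_nonneg)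
    ultimately have "AE x in \<nu>. f x = 0" by (simp add: integral_nonneg_eq_0_iff_AE)
    then have "AE x in \<nu>. \<not> x \<in> - K" by (simp add: fK)
    moreover have "{x \<in> space \<nu>. x \<in> -K} = - K" using sets_eq_imp_space_eq[OF \<nu>(2)] by auto
    ultimately show ?thesis using AE_iff_measurable[of "- K" \<nu> "\<lambda>x. \<not> x \<in> - K"] Kc \<nu>(2) by simp
  qed
  with r \<nu> conv that show thesis by blast
qed

section \<open>Equilibrium measures\<close>

context sobolev_exponent
begin

text \<open>Each potential minimises its own functional, and the two functionals differ by t times a
  pairing difference. With Clarkson's inequality the energy of the half difference w is at most t
  times the difference of the pairings with w, which the sup bound turns into a bound by a multiple
  of t (E(w) + 1); for small t this makes E(w) small.\<close>

lemma potential_mixture_close: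
  fixes \<rho> \<mu> :: "'a measure"
  assumes pm: "borel_prob \<rho>" "borel_prob \<mu>" and "\<epsilon> > 0"
  obtains t where "0 < t" "t \<le> 1"
    "\<And>x. \<bar>potential n (mixture t \<rho> \<mu>) x - potential n \<rho> x\<bar> \<le> \<epsilon>"
proof -
  \<comment> \<open>Working backwards: w is half the difference, so a sup bound of \<epsilon>/2 for
    w is enough, which fixes \<open>s\<close>; q \<le> 1/2 turns E(w) (1 - q) \<le> q into E(w)
    \<le> 2 q, below the threshold for \<open>s\<close>; and \<open>t\<close> is chosen to produce
    that q.\<close>
  define s where "s = \<epsilon> / (2 * sup_const)"
  have s: "s > 0" using sup_const(1) \<open>\<epsilon> > 0\<close> by (simp add: s_def)
  define q where "q = min (1/2) (min (s\<^sup>2) (s ^ (2 * n)) / 3)"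
  have q: "q > 0" "q \<le> 1/2" "2 * q < min (s\<^sup>2) (s ^ (2 * n))"
  proof -
    have p: "min (s\<^sup>2) (s ^ (2 * n)) > 0" using s by simp
    then show "q > 0" "q \<le> 1/2" by (simp_all add: q_def)
    have "2 * q \<le> 2 * (min (s\<^sup>2) (s ^ (2 * n)) / 3)" unfolding q_def
      by (intro mult_left_mono min.cobounded2) simp
    also have "\<dots> < min (s\<^sup>2) (s ^ (2 * n))" using p by linarith
    finally show "2 * q < min (s\<^sup>2) (s ^ (2 * n))" .
  qed
  define t where "t = min 1 (q / (2 * sup_const))"
  have t: "0 < t" "t \<le> 1" "2 * t * sup_const \<le> q"
  proof -
    show "0 < t" "t \<le> 1" using q sup_const(1) by (auto simp: t_def)
    have "2 * t * sup_const \<le> 2 * (q / (2 * sup_const)) * sup_const"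
      using sup_const(1) unfolding t_def by (intro mult_right_mono mult_left_mono) auto
    then show "2 * t * sup_const \<le> q" using sup_const(1) by simp
  qed
  define \<sigma> where "\<sigma> = mixture t \<rho> \<mu>"
  have \<sigma>: "borel_prob \<sigma>" unfolding \<sigma>_def using pm t by (intro borel_prob_mixture) auto
  define \<phi> where "\<phi> = potential n \<rho>"
  define \<psi> where "\<psi> = potential n \<sigma>"
  note \<phi> = potential_minimizes[OF pm(1), folded \<phi>_def] and \<psi> = potential_minimizes[OF \<sigma>, folded \<psi>_def]
  define w where "w x = 1/2 * (\<psi> x - \<phi> x)" for x
  have w: "w \<in> X" unfolding w_def[abs_def] by (intro X_scale X_diff \<phi> \<psi>)
  have I\<sigma>: "I_functional n \<sigma> \<xi> = I_functional n \<rho> \<xi> - t * (pairing \<mu> \<xi> - pairing \<rho> \<xi>)" if \<xi>: "\<xi> \<in> X" for \<xi>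
  proof -
    obtain B where B: "\<And>x. \<bar>\<xi> x\<bar> \<le> B" using X_bounded[OF \<xi>] by blast
    have "pairing \<sigma> \<xi> = t * pairing \<mu> \<xi> + (1 - t) * pairing \<rho> \<xi>"
      unfolding \<sigma>_def using pm t X_continuous[OF \<xi>] B by (intro pairing_mixture) auto
    then show ?thesis unfolding I_functional_eq by (simp add: algebra_simps)
  qed
  have mid: "I_functional n \<rho> \<phi> \<le> I_functional n \<rho> (\<lambda>x. 1/2 * (\<psi> x + \<phi> x))"
    by (intro \<phi> X_scale X_add \<psi>)
  have le: "I_functional n \<sigma> \<psi> \<le> I_functional n \<sigma> \<phi>" by (intro \<psi> \<phi>)
  have half: "pairing \<nu> w = 1/2 * (pairing \<nu> \<psi> - pairing \<nu> \<phi>)" if "borel_prob \<nu>" for \<nu>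
    unfolding w_def pairing_scale pairing_X_diff[OF that \<psi>(1) \<phi>(1)] ..
  have arith: "e \<le> t * (pwm - pwr)"
    if "ip \<le> im" "e \<le> (ips + ip) / 2 - im" "ips - t * (a1 - a2) \<le> ip - t * (b1 - b2)"
      "pwm = 1/2 * (a1 - b1)" "pwr = 1/2 * (a2 - b2)" for ip im e ips a1 a2 b1 b2 pwm pwr :: real
  proof -
    have "2 * e \<le> ips - ip" using that(1,2) by (simp add: field_simps)
    also have "\<dots> \<le> t * (a1 - a2) - t * (b1 - b2)" using that(3) by simp
    also have "\<dots> = 2 * (t * (pwm - pwr))" unfolding that(4,5) by (simp add: field_simps)
    finally show ?thesis by simp
  qed
  have "energy n w \<le> t * (pairing \<mu> w - pairing \<rho> w)"
    by (rule arith[OF mid I_Clarkson[OF pm(1) \<psi>(1) \<phi>(1), folded w_def]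
          le[unfolded I\<sigma>[OF \<psi>(1)] I\<sigma>[OF \<phi>(1)]] half[OF pm(2)] half[OF pm(1)]])
  also have "\<dots> \<le> t * (2 * (sup_const * (energy n w + 1)))"
  proof (rule mult_left_mono)
    have e: "energy n w \<ge> 0" by (rule energy_nonneg[OF w])
    have "sqrt (energy n w + 1) \<le> energy n w + 1"
      using e by (intro real_le_lsqrt) (auto simp: power2_eq_square algebra_simps)
    then have "sup_const * sqrt (energy n w + 1) \<le> sup_const * (energy n w + 1)"
      using sup_const(1) by (intro mult_left_mono) auto
    then have "\<bar>w x\<bar> \<le> sup_const * (energy n w + 1)" for x
      using X_sup_bound_sqrt[OF w, of x] by linarith
    then have "\<bar>pairing \<nu> w\<bar> \<le> sup_const * (energy n w + 1)" if "borel_prob \<nu>" for \<nu>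
      using that by (intro pairing_abs_le X_continuous w)
    from this[OF pm(1)] this[OF pm(2)]
    show "pairing \<mu> w - pairing \<rho> w \<le> 2 * (sup_const * (energy n w + 1))" by linarith
  qed (use t in simp)
  also have "\<dots> = (2 * t * sup_const) * (energy n w + 1)" by simp
  also have "\<dots> \<le> q * (energy n w + 1)"
    using t(3) energy_nonneg[OF w] by (intro mult_right_mono) auto
  finally have "energy n w * (1 - q) \<le> q" by (simp add: algebra_simps)
  moreover have "energy n w * (1/2) \<le> energy n w * (1 - q)"
    using q energy_nonneg[OF w] by (intro mult_left_mono) auto
  ultimately have "energy n w \<le> 2 * q" by simp
  then have "energy n w < min (s\<^sup>2) (s ^ (2 * n))" using q(3) by simp
  then have "\<bar>w x\<bar> \<le> sup_const * s" for x by (intro X_sup_bound w s)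
  then have "\<bar>\<psi> x - \<phi> x\<bar> \<le> \<epsilon>" for x
    using sup_const(1) by (simp add: w_def s_def abs_mult)
  with t show thesis using that[of t] unfolding \<psi>_def \<phi>_def \<sigma>_def by blast
qed

section \<open>Existence and uniqueness of the equilibrium measure\<close>

definition probs_on :: "'a set \<Rightarrow> 'a measure set" where
  "probs_on S = {\<rho>. borel_prob \<rho> \<and> emeasure \<rho> (- S) = 0}"

lemma probs_on_AE:
  assumes "\<rho> \<in> probs_on S" "compact S"
  shows "AE x in \<rho>. x \<in> S"
  using assms by (intro AE_I[of _ _ "- S"]) (auto simp: probs_on_def borel_prob_def compact_imp_closed)

lemma probs_on_mixture:
  assumes "\<rho> \<in> probs_on S" "\<mu> \<in> probs_on S" "0 \<le> t" "t \<le> 1" "compact S"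
  shows "mixture t \<rho> \<mu> \<in> probs_on S"
  using assms by (auto simp: probs_on_def compact_imp_closed intro!: borel_prob_mixture emeasure_mixture_null)

lemma point_mass_probs_on:
  assumes "x \<in> S" "compact S"
  shows "return borel x \<in> probs_on S"
proof -
  have "- S \<in> sets borel" using assms by (simp add: compact_imp_closed)
  then show ?thesis using assms
    by (auto simp: probs_on_def borel_prob_def prob_space_return)
qed

lemma pairing_return: "\<phi> \<in> X \<Longrightarrow> pairing (return borel x) \<phi> = \<phi> x"
  unfolding pairing_def
  by (intro integral_return) (auto intro: borel_measurable_continuous_onI X_continuous)

abbreviation D :: "'a measure \<Rightarrow> real" where
  "D \<rho> \<equiv> K_functional n (potential n \<rho>)"

lemma equilibrium_exists:
  assumes S: "compact S" "S \<noteq> {}"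
  shows "\<exists>\<rho>\<in>probs_on S. \<forall>\<mu>\<in>probs_on S. D \<rho> \<le> D \<mu>"
proof -
  define d where "d = Inf (D ` probs_on S)"
  have "0 \<le> D \<rho>" for \<rho>
    unfolding K_functional_def
    by (intro sum_nonneg mult_nonneg_nonneg less_imp_le[OF alpha_pos] zero_le_power Lp_norm_nonneg) auto
  then have bdd: "bdd_below (D ` probs_on S)" by (intro bdd_belowI2)
  have ne: "probs_on S \<noteq> {}" using point_mass_probs_on S by blast
  have "\<exists>\<rho>\<in>probs_on S. D \<rho> < d + inverse (real (Suc k))" for k
  proof -
    have "Inf (D ` probs_on S) < d + inverse (real (Suc k))" by (simp add: d_def[symmetric])
    from cInf_lessD[OF _ this] ne show ?thesis by auto
  qed
  then obtain \<rho> where \<rho>: "\<And>k. \<rho> k \<in> probs_on S" "\<And>k. D (\<rho> k) < d + inverse (real (Suc k))" by metis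
  obtain r \<nu> where r: "strict_mono r" and \<nu>: "prob_space \<nu>" "sets \<nu> = sets borel" "emeasure \<nu> (- S) = 0"
    and conv: "\<And>f B. continuous_on UNIV f \<Longrightarrow> (\<And>x. \<bar>f x\<bar> \<le> (B::real)) \<Longrightarrow>
      (\<lambda>k. LINT x|\<rho> (r k). f x) \<longlonglongrightarrow> (LINT x|\<nu>. f x)"
  proof (rule weak_compactness[of S \<rho>])
    show "prob_space (\<rho> k)" "sets (\<rho> k) = sets borel" "emeasure (\<rho> k) (- S) = 0" for k
      using \<rho>(1)[of k] by (auto simp: probs_on_def borel_prob_def)
  qed (use S(1) that in auto)
  have \<nu>': "borel_prob \<nu>" "\<nu> \<in> probs_on S" using \<nu> by (auto simp: probs_on_def borel_prob_def)
  \<comment> \<open>The potential of the limit is one fixed function, so its pairings converge, and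
    it bounds every \<open>D (\<rho> (r k))\<close> from below.\<close>
  define \<phi> where "\<phi> = potential n \<nu>"
  have \<phi>: "\<phi> \<in> X" unfolding \<phi>_def by (rule potential_minimizes[OF \<nu>'(1)])
  obtain B where B: "\<And>x. \<bar>\<phi> x\<bar> \<le> B" using X_bounded[OF \<phi>] by blast
  have "pairing \<nu> \<phi> - energy n \<phi> \<le> d"
  proof (rule LIMSEQ_le)
    show "(\<lambda>k. pairing (\<rho> (r k)) \<phi> - energy n \<phi>) \<longlonglongrightarrow> pairing \<nu> \<phi> - energy n \<phi>"
      unfolding pairing_def by (intro tendsto_diff tendsto_const conv[OF X_continuous[OF \<phi>] B])
    show "(\<lambda>k. d + inverse (real (Suc k))) \<longlonglongrightarrow> d" by (rule LIMSEQ_inverse_real_of_nat_add)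
    have "pairing (\<rho> (r k)) \<phi> - energy n \<phi> \<le> d + inverse (real (Suc k))" for k
    proof -
      have "pairing (\<rho> (r k)) \<phi> - energy n \<phi> \<le> D (\<rho> (r k))"
        using \<rho>(1) by (intro K_potential_ge \<phi>) (simp add: probs_on_def)
      also have "\<dots> \<le> d + inverse (real (Suc (r k)))" using \<rho>(2) less_imp_le by blast
      also have "\<dots> \<le> d + inverse (real (Suc k))"
        using seq_suble[OF r, of k] by (intro add_left_mono le_imp_inverse_le) auto
      finally show ?thesis .
    qed
    then show "\<exists>N. \<forall>k\<ge>N. pairing (\<rho> (r k)) \<phi> - energy n \<phi> \<le> d + inverse (real (Suc k))" by blast
  qed
  then have "D \<nu> \<le> d" using K_potential_eq[OF \<nu>'(1)] unfolding \<phi>_def by simp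
  moreover have "d \<le> D \<mu>" if "\<mu> \<in> probs_on S" for \<mu> unfolding d_def using that by (intro cInf_lower bdd) auto
  ultimately show ?thesis using \<nu>'(2) order.trans by blast
qed

text \<open>The common potential minimises both functionals. Adding the inequality at \<phi> + h
  \<psi> for \<open>\<rho>\<close> to the one at \<phi> - h \<psi> for \<open>\<mu>\<close> leaves
  the second difference of the energy, which is o(h). Exchanging the measures gives
  equality.\<close>

lemma pairing_eq_of_common_potential:
  fixes \<rho> \<mu> :: "'a measure"
  assumes pm: "borel_prob \<rho>" "borel_prob \<mu>" and eq: "potential n \<rho> = potential n \<mu>" and \<psi>: "\<psi> \<in> X"
  shows "pairing \<rho> \<psi> \<le> pairing \<mu> \<psi>"
proof -
  define \<phi> where "\<phi> = potential n \<rho>"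
  note \<phi> = potential_minimizes[OF pm(1), folded \<phi>_def]
  have \<phi>': "I_functional n \<mu> \<phi> \<le> I_functional n \<mu> \<xi>" if "\<xi> \<in> X" for \<xi>
    using potential_minimizes(2)[OF pm(2) that] unfolding \<phi>_def eq .
  have "0 \<ge> pairing \<rho> \<psi> - pairing \<mu> \<psi>"
  proof (rule LIMSEQ_le_const[OF energy_double_difference[OF \<phi>(1) \<psi>]], intro exI allI impI)
    fix k :: nat
    define h where "h = inverse (real (Suc k))"
    have h: "h > 0" by (simp add: h_def)
    have p: "pairing \<nu> (\<lambda>x. \<phi> x + h * \<psi> x) = pairing \<nu> \<phi> + h * pairing \<nu> \<psi>"
      "pairing \<nu> (\<lambda>x. \<phi> x - h * \<psi> x) = pairing \<nu> \<phi> - h * pairing \<nu> \<psi>" if "borel_prob \<nu>" for \<nu>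
      using pairing_X_add[OF that \<phi>(1) X_scale[OF \<psi>], of h] pairing_X_diff[OF that \<phi>(1) X_scale[OF \<psi>], of h]
      by (simp_all only: pairing_scale)
    have "energy n \<phi> - pairing \<rho> \<phi> \<le> energy n (\<lambda>x. \<phi> x + h * \<psi> x) - (pairing \<rho> \<phi> + h * pairing \<rho> \<psi>)"
      using \<phi>(2)[OF X_add[OF \<phi>(1) X_scale[OF \<psi>], of h]] unfolding I_functional_eq p[OF pm(1)] .
    moreover have "energy n \<phi> - pairing \<mu> \<phi> \<le> energy n (\<lambda>x. \<phi> x - h * \<psi> x) - (pairing \<mu> \<phi> - h * pairing \<mu> \<psi>)"
      using \<phi>'[OF X_diff[OF \<phi>(1) X_scale[OF \<psi>], of h]] unfolding I_functional_eq p[OF pm(2)] .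
    ultimately have "(pairing \<rho> \<psi> - pairing \<mu> \<psi>) * h
        \<le> energy n (\<lambda>x. \<phi> x + h * \<psi> x) + energy n (\<lambda>x. \<phi> x - h * \<psi> x) - 2 * energy n \<phi>"
      by (simp add: algebra_simps)
    then show "pairing \<rho> \<psi> - pairing \<mu> \<psi> \<le> (energy n (\<lambda>x. \<phi> x + inverse (real (Suc k)) * \<psi> x)
      + energy n (\<lambda>x. \<phi> x - inverse (real (Suc k)) * \<psi> x) - 2 * energy n \<phi>) / inverse (real (Suc k))"
      unfolding h_def[symmetric] using h by (simp only: pos_le_divide_eq)
  qed
  then show ?thesis by simp
qed

lemma potential_inj:
  fixes \<rho> \<mu> :: "'a measure"
  assumes pm: "borel_prob \<rho>" "borel_prob \<mu>" and eq: "potential n \<rho> = potential n \<mu>"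
  shows "\<rho> = \<mu>"
proof (rule finite_measure_eqI_test_functions)
  fix \<psi> :: "'a \<Rightarrow> real" assume "\<psi> \<in> test_functions"
  then show "(LINT x|\<rho>. \<psi> x) = (LINT x|\<mu>. \<psi> x)"
    using pairing_eq_of_common_potential[OF pm eq X_test] pairing_eq_of_common_potential[OF pm(2,1) eq[symmetric] X_test]
    unfolding pairing_def by (intro antisym)
qed (use pm in \<open>auto simp: borel_prob_def prob_space_imp_subprob_space prob_space.finite_measure\<close>)

lemma equilibrium_unique:
  assumes S: "compact S" and \<rho>: "\<rho> \<in> probs_on S" "\<And>\<nu>. \<nu> \<in> probs_on S \<Longrightarrow> D \<rho> \<le> D \<nu>"
    and \<mu>: "\<mu> \<in> probs_on S" "\<And>\<nu>. \<nu> \<in> probs_on S \<Longrightarrow> D \<mu> \<le> D \<nu>"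
  shows "\<rho> = \<mu>"
proof -
  have pm: "borel_prob \<rho>" "borel_prob \<mu>" using \<rho> \<mu> by (auto simp: probs_on_def)
  define \<sigma> where "\<sigma> = mixture (1/2) \<rho> \<mu>"
  have \<sigma>: "\<sigma> \<in> probs_on S" unfolding \<sigma>_def by (intro probs_on_mixture \<rho> \<mu> S) auto
  then have \<sigma>': "borel_prob \<sigma>" by (simp add: probs_on_def)
  define \<phi> where "\<phi> = potential n \<sigma>"
  have \<phi>: "\<phi> \<in> X" unfolding \<phi>_def by (rule potential_minimizes[OF \<sigma>'])
  obtain B where B: "\<And>x. \<bar>\<phi> x\<bar> \<le> B" using X_bounded[OF \<phi>] by blast
  have "pairing \<sigma> \<phi> = 1/2 * pairing \<mu> \<phi> + (1 - 1/2) * pairing \<rho> \<phi>"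
    unfolding \<sigma>_def using pm X_continuous[OF \<phi>] B by (intro pairing_mixture) auto
  moreover have "D \<sigma> = pairing \<sigma> \<phi> - energy n \<phi>" unfolding \<phi>_def by (rule K_potential_eq[OF \<sigma>'])
  moreover have "D \<rho> \<le> D \<sigma>" "D \<mu> \<le> D \<sigma>" using \<rho>(2) \<mu>(2) \<sigma> by blast+
  moreover have "pairing \<rho> \<phi> - energy n \<phi> \<le> D \<rho>" "pairing \<mu> \<phi> - energy n \<phi> \<le> D \<mu>"
    by (intro K_potential_ge pm \<phi>)+
  \<comment> \<open>\<open>D \<sigma>\<close> is the mean of two numbers bounded by
    \<open>D \<rho>\<close> and \<open>D \<mu>\<close>, which are in turn at most
    \<open>D \<sigma>\<close>; hence equality throughout, and \<phi> is optimal for both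
    measures.\<close>
  moreover have "pr - e = dr \<and> pm - e = dm"
    if "ps = 1/2 * pm + (1 - 1/2) * pr" "ds = ps - e" "dr \<le> ds" "dm \<le> ds" "pr - e \<le> dr" "pm - e \<le> dm"
    for pr pm ps e dr dm ds :: real using that by auto
  ultimately have "pairing \<rho> \<phi> - energy n \<phi> = D \<rho>" "pairing \<mu> \<phi> - energy n \<phi> = D \<mu>" by metis+
  then have "\<phi> = potential n \<rho>" "\<phi> = potential n \<mu>"
    by (auto intro!: potential_eqI pm \<phi> simp: K_potential I_functional_eq K_potential_eq pm)
  then show ?thesis using potential_inj[OF pm] by simp
qed

section \<open>Constancy of the equilibrium potential\<close>

theorem equilibrium_potential_constant:
  assumes \<Omega>: "open \<Omega>" "bounded \<Omega>" and \<rho>: "\<rho> \<in> probs_on (frontier \<Omega>)"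
    and min: "\<And>\<nu>. \<nu> \<in> probs_on (frontier \<Omega>) \<Longrightarrow> D \<rho> \<le> D \<nu>"
    and x: "x \<in> closure \<Omega>"
  shows "potential n \<rho> x = pairing \<rho> (potential n \<rho>)"
proof -
  let ?S = "frontier \<Omega>"
  have S: "compact ?S" by (rule compact_frontier_bounded[OF \<Omega>(2)])
  have pm: "borel_prob \<rho>" using \<rho> by (simp add: probs_on_def)
  define \<phi> where "\<phi> = potential n \<rho>"
  define l where "l = pairing \<rho> \<phi>"
  note \<phi> = potential_minimizes[OF pm, folded \<phi>_def]
  have lower: "l \<le> \<phi> y" if y: "y \<in> ?S" for y
  proof (rule field_le_epsilon)
    fix e :: real assume "e > 0"
    define \<mu> where "\<mu> = (return borel y :: 'a measure)"
    have \<mu>: "\<mu> \<in> probs_on ?S" unfolding \<mu>_def by (rule point_mass_probs_on[OF y S])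
    then have pm\<mu>: "borel_prob \<mu>" by (simp add: probs_on_def)
    obtain t where t: "0 < t" "t \<le> 1" and close: "\<And>x. \<bar>potential n (mixture t \<rho> \<mu>) x - potential n \<rho> x\<bar> \<le> e / 2"
      using potential_mixture_close[OF pm pm\<mu>, of "e / 2"] \<open>e > 0\<close> by auto
    define \<sigma> where "\<sigma> = mixture t \<rho> \<mu>"
    have \<sigma>: "\<sigma> \<in> probs_on ?S" unfolding \<sigma>_def using t by (intro probs_on_mixture \<rho> \<mu> S) auto
    then have pm\<sigma>: "borel_prob \<sigma>" by (simp add: probs_on_def)
    define \<psi> where "\<psi> = potential n \<sigma>"
    have \<psi>: "\<psi> \<in> X" unfolding \<psi>_def by (rule potential_minimizes[OF pm\<sigma>])
    obtain B where B: "\<And>x. \<bar>\<psi> x\<bar> \<le> B" using X_bounded[OF \<psi>] by blast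
    \<comment> \<open>Comparing both measures at the potential \<psi> of the mixture cancels the
      energies and leaves <\<rho>, \<psi>> \<le> \<psi>(y); uniform closeness then replaces \<psi>
      by \<phi> on both sides.\<close>
    have "pairing \<rho> \<psi> - energy n \<psi> \<le> D \<rho>" by (rule K_potential_ge[OF pm \<psi>])
    also have "\<dots> \<le> D \<sigma>" by (rule min[OF \<sigma>])
    also have "\<dots> = pairing \<sigma> \<psi> - energy n \<psi>" unfolding \<psi>_def by (rule K_potential_eq[OF pm\<sigma>])
    finally have "pairing \<rho> \<psi> \<le> pairing \<sigma> \<psi>" by simp
    also have "\<dots> = t * pairing \<mu> \<psi> + (1 - t) * pairing \<rho> \<psi>"
      unfolding \<sigma>_def using t pm pm\<mu> X_continuous[OF \<psi>] B by (intro pairing_mixture) auto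
    finally have "t * pairing \<rho> \<psi> \<le> t * pairing \<mu> \<psi>" by (simp add: algebra_simps)
    then have 1: "pairing \<rho> \<psi> \<le> \<psi> y" using t by (simp add: \<mu>_def pairing_return[OF \<psi>])
    have c: "\<bar>\<psi> z - \<phi> z\<bar> \<le> e / 2" for z using close unfolding \<psi>_def \<sigma>_def \<phi>_def .
    have "\<bar>pairing \<rho> (\<lambda>x. \<psi> x - \<phi> x)\<bar> \<le> e / 2"
      by (intro pairing_abs_le pm X_continuous X_diff \<psi> \<phi> c)
    then have "l - pairing \<rho> \<psi> \<le> e / 2"
      unfolding pairing_X_diff[OF pm \<psi> \<phi>(1)] l_def by linarith
    then show "l \<le> \<phi> y + e" using 1 c[of y] by linarith
  qed
  have i: "integrable \<rho> (\<lambda>x. \<phi> x - l)"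
  proof -
    interpret prob_space \<rho> using pm by (simp add: borel_prob_def)
    show ?thesis by (intro Bochner_Integration.integrable_diff pairing_X[OF pm \<phi>(1)]) simp
  qed
  have AE_S: "AE y in \<rho>. y \<in> ?S" by (rule probs_on_AE[OF \<rho> S])
  have AE_l: "AE y in \<rho>. \<phi> y = l"
  proof -
    interpret prob_space \<rho> using pm by (simp add: borel_prob_def)
    have "(LINT y|\<rho>. \<phi> y - l) = 0"
      using pairing_X[OF pm \<phi>(1)] by (simp add: l_def pairing_def prob_space)
    moreover have "AE y in \<rho>. 0 \<le> \<phi> y - l" using AE_S by (rule AE_mp) (simp add: lower)
    ultimately have "AE y in \<rho>. \<phi> y - l = 0" using integral_nonneg_eq_0_iff_AE[OF i] by blast
    then show ?thesis by simp
  qed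
  \<comment> \<open>Comparison with the zero function; truncation above requires a nonnegative
    level.\<close>
  have l0: "0 \<le> l"
  proof -
    have "energy n (\<lambda>x::'a. 0) = 0"
      by (simp add: energy_test[OF test_functions_zero] modular_def gradient_zero modular_density_zero)
    moreover have "pairing \<rho> (\<lambda>x. 0) = 0" by (simp add: pairing_def)
    ultimately have "I_functional n \<rho> \<phi> \<le> 0"
      using \<phi>(2)[OF X_test[OF test_functions_zero]] by (simp add: I_functional_eq)
    then show ?thesis using energy_nonneg[OF \<phi>(1)] by (simp add: I_functional_eq l_def)
  qed
  have upper: "\<phi> y \<le> l" for y
  proof -
    let ?\<psi> = "\<lambda>x. \<phi> x - ramp (\<phi> x - l)"
    note T = X_truncate_above[OF \<phi>(1) l0]
    have "pairing \<rho> ?\<psi> = pairing \<rho> \<phi>" unfolding pairing_def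
    proof (rule integral_cong_AE)
      show "AE x in \<rho>. ?\<psi> x = \<phi> x" using AE_l by (rule AE_mp) (simp add: ramp_eq_0_iff)
    qed (use borel_measurable_integrable pairing_X[OF pm] T(1) \<phi>(1) in blast)+
    then have "?\<psi> = \<phi>"
      using T by (intro potential_eqI[OF pm, folded \<phi>_def]) (simp_all add: I_functional_eq)
    then have "\<phi> y - ramp (\<phi> y - l) = \<phi> y" by (rule fun_cong)
    then show ?thesis by (simp add: ramp_eq_0_iff)
  qed
  have bdry: "\<phi> y = l" if "y \<in> ?S" for y using lower[OF that] upper[of y] by simp
  have inside: "l \<le> \<phi> y" if y: "y \<in> \<Omega>" for y
  proof (rule field_le_epsilon)
    fix e :: real assume "e > 0"
    \<comment> \<open>The margin \<open>e\<close> keeps the level strictly below the boundary value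
      l. The pairing does not change, since \<open>\<rho>\<close> lives on the frontier, which the
      open set \<Omega> misses.\<close>
    let ?\<psi> = "\<lambda>x. \<phi> x + (if x \<in> \<Omega> then ramp (l - e - \<phi> x) else 0)"
    have T: "?\<psi> \<in> X" "energy n ?\<psi> \<le> energy n \<phi>"
      using \<open>e > 0\<close> bdry by (intro X_truncate_below_inside[OF \<phi>(1) \<Omega>]; simp)+
    have "pairing \<rho> ?\<psi> = pairing \<rho> \<phi>" unfolding pairing_def
    proof (rule integral_cong_AE)
      show "AE x in \<rho>. ?\<psi> x = \<phi> x"
        using AE_S by (rule AE_mp) (use \<Omega>(1) in \<open>auto simp: frontier_def interior_open\<close>)
    qed (use borel_measurable_integrable pairing_X[OF pm] T(1) \<phi>(1) in blast)+
    then have "?\<psi> = \<phi>"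
      using T by (intro potential_eqI[OF pm, folded \<phi>_def]) (simp_all add: I_functional_eq)
    then have "?\<psi> y = \<phi> y" by (rule fun_cong)
    then show "l \<le> \<phi> y + e" using y by (simp add: ramp_eq_0_iff)
  qed
  have "\<phi> x = l"
    using x bdry[of x] inside[of x] upper[of x] \<Omega>(1) by (auto simp: frontier_def interior_open)
  then show ?thesis unfolding l_def \<phi>_def .
qed

end

section \<open>Transfer to measures on the boundary of the domain\<close>

lemma frontier_nonempty:
  fixes \<Omega> :: "'a::euclidean_space set"
  assumes "\<Omega> \<noteq> {}" "bounded \<Omega>"
  shows "frontier \<Omega> \<noteq> {}"
  using assms not_bounded_UNIV by (auto simp: frontier_eq_empty)

theorem theorem5p4:
  fixes \<Omega> :: "(real ^ 'N) set" and n :: nat and a :: real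
  assumes "CARD('N) \<ge> 3"
    and "real n > real CARD('N) / 2"
    and "open \<Omega>" and "connected \<Omega>" and "\<Omega> \<noteq> {}" and "bounded \<Omega>"
    and "a > 0" and "C1_holder_boundary a \<Omega>"
  shows "(\<exists>!\<rho>. equilibrium_measure n \<Omega> \<rho>) \<and>
    (\<forall>\<rho> l. equilibrium_measure n \<Omega> \<rho> \<longrightarrow> l = pairing \<rho> (potential n \<rho>) \<longrightarrow>
       (\<forall>x\<in>closure \<Omega>. potential n \<rho> x = l) \<and>
       (\<forall>\<mu>\<in>boundary_prob \<Omega>.
          l = pairing \<rho> (potential n \<rho>) \<and>
          pairing \<rho> (potential n \<rho>) = pairing \<mu> (potential n \<rho>)))"
proof -
  interpret sobolev_exponent n "TYPE(real ^ 'N)"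
    using assms(1,2) by unfold_locales (auto simp: field_simps)
  let ?S = "frontier \<Omega>"
  have S: "compact ?S" "?S \<noteq> {}"
    using compact_frontier_bounded[OF assms(6)] frontier_nonempty[OF assms(5,6)] by auto
  have P: "boundary_prob \<Omega> = probs_on ?S"
  proof (intro set_eqI iffI)
    fix \<rho> :: "(real ^ 'N) measure"
    have U: "emeasure \<rho> (space \<rho>) = emeasure \<rho> ?S + emeasure \<rho> (- ?S)" if "sets \<rho> = sets borel"
      using that sets_eq_imp_space_eq[OF that] S by (subst plus_emeasure) (auto simp: compact_imp_closed)
    show "\<rho> \<in> probs_on ?S" if "\<rho> \<in> boundary_prob \<Omega>"
      using that U by (auto simp: boundary_prob_def probs_on_def borel_prob_def intro!: prob_spaceI)
    show "\<rho> \<in> boundary_prob \<Omega>" if "\<rho> \<in> probs_on ?S"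
      using that U prob_space.emeasure_space_1[of \<rho>] by (auto simp: boundary_prob_def probs_on_def borel_prob_def)
  qed
  have eq: "equilibrium_measure n \<Omega> \<rho> \<longleftrightarrow> \<rho> \<in> probs_on ?S \<and> (\<forall>\<nu>\<in>probs_on ?S. D \<rho> \<le> D \<nu>)" for \<rho>
    unfolding equilibrium_measure_def P is_arg_min_linorder by blast
  have const: "potential n \<rho> x = pairing \<rho> (potential n \<rho>)"
    if "equilibrium_measure n \<Omega> \<rho>" "x \<in> closure \<Omega>" for \<rho> x
    using that(1) unfolding eq by (intro equilibrium_potential_constant[OF assms(3,6) _ _ that(2)]) auto
  have "pairing \<rho> (potential n \<rho>) = pairing \<mu> (potential n \<rho>)"
    if \<rho>: "equilibrium_measure n \<Omega> \<rho>" and \<mu>: "\<mu> \<in> boundary_prob \<Omega>" for \<rho> \<mu>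
  proof -
    have pm: "borel_prob \<rho>" "borel_prob \<mu>" using \<rho> \<mu> unfolding eq P by (auto simp: probs_on_def)
    interpret prob_space \<mu> using pm(2) by (simp add: borel_prob_def)
    have "pairing \<mu> (potential n \<rho>) = (LINT x|\<mu>. pairing \<rho> (potential n \<rho>))"
      unfolding pairing_def[of \<mu>]
    proof (rule integral_cong_AE)
      show "potential n \<rho> \<in> borel_measurable \<mu>"
        by (intro borel_measurable_integrable pairing_X pm potential_minimizes)
      show "AE x in \<mu>. potential n \<rho> x = pairing \<rho> (potential n \<rho>)"
        using probs_on_AE[OF \<mu>[unfolded P] S(1)]
        by (rule AE_mp) (auto intro!: AE_I2 const[OF \<rho>] simp: frontier_def)
    qed simp
    then show ?thesis by (simp add: prob_space)
  qed
  moreover have "\<exists>!\<rho>. equilibrium_measure n \<Omega> \<rho>"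
  proof (rule ex_ex1I)
    show "\<exists>\<rho>. equilibrium_measure n \<Omega> \<rho>" unfolding eq using equilibrium_exists[OF S] by blast
    show "\<rho> = \<mu>" if "equilibrium_measure n \<Omega> \<rho>" "equilibrium_measure n \<Omega> \<mu>" for \<rho> \<mu>
      using that unfolding eq by (intro equilibrium_unique[OF S(1)]) auto
  qed
  ultimately show ?thesis using const by blast
qed

end
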